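(* Let $M^2\hookrightarrow\mathbb{R}^4$ be a proper (non PMC) biconservative surface with constant mean curvature different from zero. Then, locally, the surface is given by $$X(u,v)=(\gamma(u),v+a)=(\gamma^1(u),\gamma^2(u),\gamma^3(u),v+a),\qquad a\in\mathbb{R},$$ where $\gamma:I\to\mathbb{R}^3$ is a curve in $\mathbb{R}^3$ parametrized by arc-length, with constant curvature $k\neq 0$ and torsion $\tau\neq 0$. Conversely, a surface in $\mathbb{R}^4$ parametrized by such an $X$ (with $\gamma$ a curve in $\mathbb{R}^3$ parametrized by arc-length, with constant curvature $k\neq 0$ and torsion $\tau\neq 0$) is a proper biconservative surface with constant mean curvature different from zero.
   Context: The surface $M^2$ is isometrically immersed in $\mathbb{R}^4$, with induced metric $\langle\,,\rangle$; $I$ is an interval. $B$ is the second fundamental form, $H=\frac12\,\mathrm{trace}\,B$ is the mean curvature vector field, $A_\xi$ is the shape operator in the normal direction $\xi$, i.e. $\langle A_\xi X,Y\rangle=\langle B(X,Y),\xi\rangle$ for tangent $X,Y$, and $\nabla^\perp$ is the normal connection. "Constant mean curvature different from zero" means that $|H|$ is a nonzero constant. The stress-bienergy tensor is $S_2(X,Y)=-2|H|^2\langle X,Y\rangle+4\langle A_H X,Y\rangle$, and the surface is called biconservative if $\mathrm{div}\,S_2=0$. For surfaces in $\mathbb{R}^4$ this is equivalent to $2\,\mathrm{trace}\,A_{\nabla^\perp_{(\cdot)}H}(\cdot)+\mathrm{grad}\,|H|^2=0$, where $\mathrm{trace}\,A_{\nabla^\perp_{(\cdot)}H}(\cdot)=\sum_i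 A_{\nabla^\perp_{e_i}H}(e_i)$ for a local orthonormal frame $\{e_i\}$ on $M^2$. A surface is PMC (has parallel mean curvature vector field) if $\nabla^\perp H=0$. "Proper" means non PMC.
   Formalization: The local form is claimed only near points where ∇^⊥H ≠ 0 (it fails wherever ∇^⊥H = 0, since torsion τ ≠ 0 forces ∇^⊥H ≠ 0) and up to an orthogonal transformation of R^4 (a rotated cylinder is otherwise a counterexample); τ ≠ 0 means nowhere zero. *)

theory Defs
  imports "HOL-Analysis.Analysis"
begin

section \<open>Smooth maps\<close>

text \<open>Iterated continuous differentiability; only used on open sets, where
  \<open>frechet_derivative f (at x)\<close> is the total derivative.\<close>

fun Ck_on :: "nat \<Rightarrow> ('a::euclidean_space) set \<Rightarrow> ('a \<Rightarrow> 'b::real_normed_vector) \<Rightarrow> bool" where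
  "Ck_on 0 S f \<longleftrightarrow> continuous_on S f"
| "Ck_on (Suc k) S f \<longleftrightarrow>
     f differentiable_on S \<and> (\<forall>v. Ck_on k S (\<lambda>x. frechet_derivative f (at x) v))"

definition smooth_on :: "('a::euclidean_space) set \<Rightarrow> ('a \<Rightarrow> 'b::real_normed_vector) \<Rightarrow> bool" where
  "smooth_on S f \<longleftrightarrow> (\<forall>k. Ck_on k S f)"

section \<open>Geometry of an immersion in a coordinate patch\<close>

text \<open>Here \<open>r\<close> is an immersion of an open subset of the coordinate plane \<open>real^2\<close> into \<open>real^4\<close>,
  \<open>q\<close> is a point of the coordinate domain, and a tangent vector at \<open>q\<close> is represented by its
  coordinate vector \<open>X :: real^2\<close>, i.e. it is \<open>dr_q X\<close> as a vector of \<open>real^4\<close>.  A fixed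
  \<open>X\<close> is at the same time the vector field with constant coordinates \<open>X\<close>; since all
  the objects below are tensorial in their tangent arguments, these fields suffice.\<close>

definition tangent_plane :: "(real^2 \<Rightarrow> real^4) \<Rightarrow> real^2 \<Rightarrow> (real^4) set" where
  "tangent_plane r q = range (frechet_derivative r (at q))"

definition normal_part :: "(real^2 \<Rightarrow> real^4) \<Rightarrow> real^2 \<Rightarrow> real^4 \<Rightarrow> real^4" where
  "normal_part r q w =
     (THE n. (\<forall>t\<in>tangent_plane r q. orthogonal n t) \<and> w - n \<in> tangent_plane r q)"

definition induced_metric :: "(real^2 \<Rightarrow> real^4) \<Rightarrow> real^2 \<Rightarrow> real^2 \<Rightarrow> real^2 \<Rightarrow> real" where
  "induced_metric r q X Y = frechet_derivative r (at q) X \<bullet> frechet_derivative r (at q) Y"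

text \<open>Metric trace \<open>g\<^sup>i\<^sup>j T(\<partial>\<^sub>i, \<partial>\<^sub>j)\<close> of a bilinear map, i.e. the sum of
  \<open>T(e\<^sub>i, e\<^sub>i)\<close> over an orthonormal frame.\<close>

definition metric_trace ::
    "(real^2 \<Rightarrow> real^4) \<Rightarrow> real^2 \<Rightarrow> (real^2 \<Rightarrow> real^2 \<Rightarrow> 'b::real_vector) \<Rightarrow> 'b" where
  "metric_trace r q T =
     (let G = (\<chi> i j. induced_metric r q (axis i 1) (axis j 1)) :: real^2^2
      in \<Sum>i\<in>UNIV. \<Sum>j\<in>UNIV. (matrix_inv G $ i $ j) *\<^sub>R T (axis i 1) (axis j 1))"

text \<open>Gauss formula: \<open>B(X,Y)\<close> is the normal part of the derivative of \<open>dr Y\<close> in direction \<open>X\<close>.\<close>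

definition second_fundamental_form ::
    "(real^2 \<Rightarrow> real^4) \<Rightarrow> real^2 \<Rightarrow> real^2 \<Rightarrow> real^2 \<Rightarrow> real^4" where
  "second_fundamental_form r q X Y =
     normal_part r q (frechet_derivative (\<lambda>q'. frechet_derivative r (at q') Y) (at q) X)"

definition mean_curvature_vector :: "(real^2 \<Rightarrow> real^4) \<Rightarrow> real^2 \<Rightarrow> real^4" where
  "mean_curvature_vector r q = (1/2) *\<^sub>R metric_trace r q (second_fundamental_form r q)"

definition shape_operator :: "(real^2 \<Rightarrow> real^4) \<Rightarrow> real^2 \<Rightarrow> real^4 \<Rightarrow> real^2 \<Rightarrow> real^2" where
  "shape_operator r q \<xi> X =
     (THE Z. \<forall>Y. induced_metric r q Z Y = second_fundamental_form r q X Y \<bullet> \<xi>)"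

definition normal_connection ::
    "(real^2 \<Rightarrow> real^4) \<Rightarrow> real^2 \<Rightarrow> real^2 \<Rightarrow> (real^2 \<Rightarrow> real^4) \<Rightarrow> real^4" where
  "normal_connection r q X \<xi> = normal_part r q (frechet_derivative \<xi> (at q) X)"

text \<open>Levi-Civita connection of the induced metric on fields with constant coordinates
  (Koszul formula; such fields commute, so the bracket terms vanish).\<close>

definition levi_civita :: "(real^2 \<Rightarrow> real^4) \<Rightarrow> real^2 \<Rightarrow> real^2 \<Rightarrow> real^2 \<Rightarrow> real^2" where
  "levi_civita r q X Y =
     (THE W. \<forall>Z. 2 * induced_metric r q W Z =
          frechet_derivative (\<lambda>q'. induced_metric r q' Y Z) (at q) X
        + frechet_derivative (\<lambda>q'. induced_metric r q' X Z) (at q) Y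
        - frechet_derivative (\<lambda>q'. induced_metric r q' X Y) (at q) Z)"

text \<open>\<open>(\<nabla>\<^sub>X S)(Y,Z)\<close> for a field \<open>S\<close> of bilinear forms.\<close>

definition covariant_derivative ::
    "(real^2 \<Rightarrow> real^4) \<Rightarrow> (real^2 \<Rightarrow> real^2 \<Rightarrow> real^2 \<Rightarrow> real) \<Rightarrow>
     real^2 \<Rightarrow> real^2 \<Rightarrow> real^2 \<Rightarrow> real^2 \<Rightarrow> real" where
  "covariant_derivative r S q X Y Z =
     frechet_derivative (\<lambda>q'. S q' Y Z) (at q) X
     - S q (levi_civita r q X Y) Z - S q Y (levi_civita r q X Z)"

definition divergence ::
    "(real^2 \<Rightarrow> real^4) \<Rightarrow> (real^2 \<Rightarrow> real^2 \<Rightarrow> real^2 \<Rightarrow> real) \<Rightarrow> real^2 \<Rightarrow> real^2 \<Rightarrow> real" where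
  "divergence r S q Y = metric_trace r q (\<lambda>X X'. covariant_derivative r S q X X' Y)"

definition stress_bienergy ::
    "(real^2 \<Rightarrow> real^4) \<Rightarrow> real^2 \<Rightarrow> real^2 \<Rightarrow> real^2 \<Rightarrow> real" where
  "stress_bienergy r q X Y =
     - 2 * (norm (mean_curvature_vector r q))\<^sup>2 * induced_metric r q X Y
     + 4 * induced_metric r q (shape_operator r q (mean_curvature_vector r q) X) Y"

section \<open>Immersed surfaces\<close>

text \<open>A chart is a pair \<open>(V, \<psi>)\<close>, where \<open>\<psi>\<close> maps the open set \<open>V\<close> of the coordinate plane
  homeomorphically onto an open subset of the surface; that is, charts are local parametrizations.\<close>

type_synonym 'm chart = "(real^2) set \<times> (real^2 \<Rightarrow> 'm)"

definition transition_smooth :: "'m chart \<Rightarrow> 'm chart \<Rightarrow> bool" where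
  "transition_smooth = (\<lambda>(V, \<psi>) (W, \<eta>).
     smooth_on {q \<in> V. \<psi> q \<in> \<eta> ` W} (\<lambda>q. the_inv_into W \<eta> (\<psi> q)))"

definition compatible_chart :: "'m topology \<Rightarrow> 'm chart set \<Rightarrow> 'm chart \<Rightarrow> bool" where
  "compatible_chart M \<A> c \<longleftrightarrow>
     (case c of (V, \<psi>) \<Rightarrow>
        open V \<and> openin M (\<psi> ` V) \<and>
        homeomorphic_map (top_of_set V) (subtopology M (\<psi> ` V)) \<psi>) \<and>
     (\<forall>d\<in>\<A>. transition_smooth c d \<and> transition_smooth d c)"

definition smooth_surface :: "'m topology \<Rightarrow> 'm chart set \<Rightarrow> bool" where
  "smooth_surface M \<A> \<longleftrightarrow>
     Hausdorff_space M \<and> second_countable M \<and>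
     (\<forall>c\<in>\<A>. compatible_chart M \<A> c) \<and>
     (\<Union>(V, \<psi>)\<in>\<A>. \<psi> ` V) = topspace M"

definition immersed_surface :: "'m topology \<Rightarrow> 'm chart set \<Rightarrow> ('m \<Rightarrow> real^4) \<Rightarrow> bool" where
  "immersed_surface M \<A> x \<longleftrightarrow>
     smooth_surface M \<A> \<and>
     (\<forall>(V, \<psi>)\<in>\<A>. smooth_on V (x \<circ> \<psi>) \<and>
        (\<forall>q\<in>V. inj (frechet_derivative (x \<circ> \<psi>) (at q))))"

definition biconservative :: "'m chart set \<Rightarrow> ('m \<Rightarrow> real^4) \<Rightarrow> bool" where
  "biconservative \<A> x \<longleftrightarrow>
     (\<forall>(V, \<psi>)\<in>\<A>. \<forall>q\<in>V. \<forall>Y. divergence (x \<circ> \<psi>) (stress_bienergy (x \<circ> \<psi>)) q Y = 0)"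

definition nonzero_CMC :: "'m chart set \<Rightarrow> ('m \<Rightarrow> real^4) \<Rightarrow> bool" where
  "nonzero_CMC \<A> x \<longleftrightarrow>
     (\<exists>c. c \<noteq> 0 \<and> (\<forall>(V, \<psi>)\<in>\<A>. \<forall>q\<in>V. norm (mean_curvature_vector (x \<circ> \<psi>) q) = c))"

definition parallel_H_at :: "'m chart set \<Rightarrow> ('m \<Rightarrow> real^4) \<Rightarrow> 'm \<Rightarrow> bool" where
  "parallel_H_at \<A> x p \<longleftrightarrow>
     (\<forall>(V, \<psi>)\<in>\<A>. \<forall>q\<in>V. \<psi> q = p \<longrightarrow>
        (\<forall>X. normal_connection (x \<circ> \<psi>) q X (mean_curvature_vector (x \<circ> \<psi>)) = 0))"

definition PMC :: "'m topology \<Rightarrow> 'm chart set \<Rightarrow> ('m \<Rightarrow> real^4) \<Rightarrow> bool" where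
  "PMC M \<A> x \<longleftrightarrow> (\<forall>p\<in>topspace M. parallel_H_at \<A> x p)"

section \<open>Space curves and the model surfaces\<close>

text \<open>The Frenet quantities below are those of a curve parametrized by arc length.\<close>

definition arc_length_curve :: "real set \<Rightarrow> (real \<Rightarrow> real^3) \<Rightarrow> bool" where
  "arc_length_curve I \<gamma> \<longleftrightarrow>
     smooth_on I \<gamma> \<and> (\<forall>s\<in>I. norm (vector_derivative \<gamma> (at s)) = 1)"

definition unit_tangent :: "(real \<Rightarrow> real^3) \<Rightarrow> real \<Rightarrow> real^3" where
  "unit_tangent \<gamma> s = vector_derivative \<gamma> (at s)"

definition curvature :: "(real \<Rightarrow> real^3) \<Rightarrow> real \<Rightarrow> real" where
  "curvature \<gamma> s = norm (vector_derivative (unit_tangent \<gamma>) (at s))"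

definition principal_normal :: "(real \<Rightarrow> real^3) \<Rightarrow> real \<Rightarrow> real^3" where
  "principal_normal \<gamma> s = (1 / curvature \<gamma> s) *\<^sub>R vector_derivative (unit_tangent \<gamma>) (at s)"

definition binormal :: "(real \<Rightarrow> real^3) \<Rightarrow> real \<Rightarrow> real^3" where
  "binormal \<gamma> s = cross3 (unit_tangent \<gamma> s) (principal_normal \<gamma> s)"

definition torsion :: "(real \<Rightarrow> real^3) \<Rightarrow> real \<Rightarrow> real" where
  "torsion \<gamma> s = - (vector_derivative (binormal \<gamma>) (at s) \<bullet> principal_normal \<gamma> s)"

text \<open>The curvature is a nonzero constant; the torsion is a function without zeros, which need
  not be constant.\<close>

definition admissible_curve :: "real set \<Rightarrow> (real \<Rightarrow> real^3) \<Rightarrow> bool" where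
  "admissible_curve I \<gamma> \<longleftrightarrow>
     arc_length_curve I \<gamma> \<and>
     (\<exists>k. k \<noteq> 0 \<and> (\<forall>s\<in>I. curvature \<gamma> s = k)) \<and>
     (\<forall>s\<in>I. torsion \<gamma> s \<noteq> 0)"

definition open_interval :: "real set \<Rightarrow> bool" where
  "open_interval I \<longleftrightarrow> open I \<and> is_interval I \<and> I \<noteq> {}"

definition rectangle :: "real set \<Rightarrow> real set \<Rightarrow> (real^2) set" where
  "rectangle I J = {q. q $ 1 \<in> I \<and> q $ 2 \<in> J}"

definition cylinder_map :: "(real \<Rightarrow> real^3) \<Rightarrow> real \<Rightarrow> real^2 \<Rightarrow> real^4" where
  "cylinder_map \<gamma> a q =
     vector [\<gamma> (q $ 1) $ 1, \<gamma> (q $ 1) $ 2, \<gamma> (q $ 1) $ 3, q $ 2 + a]"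

end

theory Submission
  imports Defs
begin

text \<open>
  If \<open>\<bar>H\<bar>\<close> is constant, then \<open>div S\<^sub>2 (Y) = 4 \<Sum>\<^sub>i \<langle>B(E\<^sub>i, Y), \<nabla>\<^sup>\<bottom>\<^bsub>E\<^sub>i\<^esub> H\<rangle>\<close> for an orthonormal frame \<open>E\<^sub>i\<close>.
  Where \<open>\<nabla>\<^sup>\<bottom>H \<noteq> 0\<close>, let \<open>\<xi> \<bottom> H\<close> span the rest of the normal plane and write
  \<open>\<nabla>\<^sup>\<bottom>H = \<omega> \<xi>\<close> up to scale.  Then \<open>A\<^sub>\<xi>\<close> is trace free with nontrivial kernel, so \<open>A\<^sub>\<xi> = 0\<close>, and the
  Codazzi equation makes \<open>A\<^sub>H\<close> of rank one with kernel \<open>ker \<omega>\<close>.  The unit tangent vector \<open>E\<close> spanning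
  this kernel turns out to be a constant vector of the ambient space, and the unit tangent vector \<open>t\<close>
  orthogonal to it satisfies \<open>dt = 2 \<langle>t, dr\<rangle> H\<close>.  The form \<open>\<langle>t, dr\<rangle>\<close> is closed; a potential of it
  together with \<open>\<langle>E, r\<rangle>\<close> gives coordinates in which the surface is a cylinder over a curve with
  curvature \<open>2 \<bar>H\<bar>\<close>, whose torsion is nonzero because \<open>\<omega>(t) \<noteq> 0\<close>.
\<close>

section \<open>Calculus of smooth maps\<close>

text \<open>Why the divergence formula holds: for constant |H| the metric part of S_2 is parallel,
  so only 4 div A_H is left. The Codazzi equation turns the derivatives of B occurring in it into 2
  \<langle>\<nabla>^\<bottom>_Y H, H\<rangle> = 0, and what is left is the stated sum.

  The obstacle is that every object is defined through derivatives of fields with constant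
  coordinates, and such fields are in general orthonormal at one point at most. Computations
  therefore use iterated derivatives of the immersion and a frame fixed at a single point; Codazzi
  becomes the symmetry of third derivatives. The fields E and t, which have to be smooth, come from
  explicit formulas: the kernel of \<omega> is read off its coordinates, and t comes from
  Gram-Schmidt.

  The factor in dt = 2 \<langle>t, dr\<rangle> H has its origin in the trace: A_H has rank one and
  trace 2 |H|^2, all of it carried by t. The torsion is detected without a Frenet frame: for
  constant curvature it vanishes exactly where \<gamma>''' is parallel to \<gamma>', and there the
  derivative of H along t would have no normal part.\<close>

definition dd :: "('a::real_normed_vector \<Rightarrow> 'b::real_normed_vector) \<Rightarrow> 'a \<Rightarrow> 'a \<Rightarrow> 'b" where
  "dd f v x = frechet_derivative f (at x) v"

text \<open>\<open>dd\<close> takes the direction before the point, so \<open>dd f v\<close> is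
  again a map of points and iterated derivatives are written \<open>dd (dd f X) Y\<close>.\<close>

lemma frechet_derivative_eq_dd:
  "frechet_derivative f (at x) = (\<lambda>v. dd f v x)"
  "(\<lambda>x. frechet_derivative f (at x) v) = dd f v"
  by (auto simp: dd_def)

lemma dd_fold: "frechet_derivative f (at x) v = dd f v x"
  by (simp add: dd_def)

lemma dd_eqI: "(f has_derivative f') (at x) \<Longrightarrow> dd f v x = f' v"
  by (metis dd_def frechet_derivative_at)

lemma has_derivative_dd: "f differentiable (at x) \<Longrightarrow> (f has_derivative (\<lambda>v. dd f v x)) (at x)"
  by (simp add: frechet_derivative_eq_dd(1)[symmetric] frechet_derivative_works[symmetric])

text \<open>Maps that agree near \<open>x\<close> have the same candidate derivatives there, so even
  the arbitrary value that \<open>frechet_derivative\<close> takes in the absence of a derivative is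
  the same.\<close>

lemma dd_cong:
  assumes "open S" "x \<in> S" "\<And>y. y \<in> S \<Longrightarrow> f y = g y"
  shows "dd f v x = dd g v x"
proof -
  have "(f has_derivative f') (at x) \<longleftrightarrow> (g has_derivative f') (at x)" for f'
    using has_derivative_transform_within_open[OF _ assms(1,2), of f f' UNIV g]
      has_derivative_transform_within_open[OF _ assms(1,2), of g f' UNIV f] assms(3) by auto
  then show ?thesis by (simp add: dd_def frechet_derivative_def)
qed

lemma differentiable_cong:
  assumes "open S" "x \<in> S" "\<And>y. y \<in> S \<Longrightarrow> f y = g y" "f differentiable (at x)"
  shows "g differentiable (at x)"
  using has_derivative_transform_within_open[OF _ assms(1,2), of f _ UNIV g] assms(3,4)
  unfolding differentiable_def by blast

lemma Ck_on_Suc_iff: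
  assumes "open S"
  shows "Ck_on (Suc k) S f \<longleftrightarrow> (\<forall>x\<in>S. f differentiable (at x)) \<and> (\<forall>v. Ck_on k S (dd f v))"
proof -
  have "f differentiable_on S \<longleftrightarrow> (\<forall>x\<in>S. f differentiable (at x))"
    using assms by (simp add: differentiable_on_eq_differentiable_at)
  then show ?thesis by (simp only: Ck_on.simps frechet_derivative_eq_dd)
qed

declare Ck_on.simps(2) [simp del]

lemma Ck_on_cong:
  assumes "open S" "\<And>y. y \<in> S \<Longrightarrow> f y = g y" "Ck_on k S f"
  shows "Ck_on k S g"
  using assms(2,3)
proof (induction k arbitrary: f g)
  case 0 then show ?case by (metis Ck_on.simps(1) continuous_on_eq)
next
  case (Suc k)
  have f: "f differentiable (at x)" if "x \<in> S" for x
    using Suc.prems(2) that by (simp add: Ck_on_Suc_iff[OF assms(1)])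
  have eq: "dd f v x = dd g v x" if "x \<in> S" for x v
    by (rule dd_cong[OF assms(1) that Suc.prems(1)])
  have "Ck_on k S (dd g v)" for v
    by (rule Suc.IH[of "dd f v"]) (use eq Suc.prems(2) in \<open>simp_all add: Ck_on_Suc_iff[OF assms(1)]\<close>)
  moreover have "g differentiable (at x)" if "x \<in> S" for x
    by (rule differentiable_cong[OF assms(1) that Suc.prems(1) f[OF that]])
  ultimately show ?case
    by (simp add: Ck_on_Suc_iff[OF assms(1)])
qed

lemma Ck_on_subset:
  assumes "open S" "open T" "T \<subseteq> S" "Ck_on k S f"
  shows "Ck_on k T f"
  using assms(4)
proof (induction k arbitrary: f)
  case 0 then show ?case using assms by (auto intro: continuous_on_subset)
next
  case (Suc k)
  have "\<forall>x\<in>T. f differentiable (at x)" "\<forall>v. Ck_on k S (dd f v)"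
    using Suc.prems assms(3) by (auto simp: Ck_on_Suc_iff[OF assms(1)])
  then show ?case
    using Suc.IH by (simp add: Ck_on_Suc_iff[OF assms(2)])
qed

lemma Ck_on_SucD: "open S \<Longrightarrow> Ck_on (Suc k) S f \<Longrightarrow> Ck_on k S f"
proof (induction k arbitrary: f)
  case 0 then show ?case
    by (auto simp: Ck_on_Suc_iff intro!: continuous_at_imp_continuous_on differentiable_imp_continuous_within)
next
  case (Suc k)
  then have "\<forall>x\<in>S. f differentiable (at x)" "\<forall>v. Ck_on (Suc k) S (dd f v)"
    by (simp_all add: Ck_on_Suc_iff[OF Suc.prems(1), of "Suc k"])
  then show ?case
    using Suc.IH[OF Suc.prems(1)] by (simp add: Ck_on_Suc_iff[OF Suc.prems(1), of k])
qed

text \<open>Lets an explicit formula for the derivative stand in for the chosen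
  \<open>frechet_derivative\<close> in the inductions on \<open>k\<close> below.\<close>

lemma Ck_on_SucI:
  assumes "open S" "\<And>x. x \<in> S \<Longrightarrow> (f has_derivative f' x) (at x)" "\<And>v. Ck_on k S (\<lambda>x. f' x v)"
  shows "Ck_on (Suc k) S f"
proof -
  have "Ck_on k S (dd f v)" for v
    by (rule Ck_on_cong[OF assms(1) _ assms(3)]) (simp add: dd_eqI[OF assms(2)])
  moreover have "f differentiable (at x)" if "x \<in> S" for x
    using assms(2)[OF that] unfolding differentiable_def by blast
  ultimately show ?thesis by (simp add: Ck_on_Suc_iff[OF assms(1)])
qed

lemma Ck_on_const [simp]: "open S \<Longrightarrow> Ck_on k S (\<lambda>x. c)"
proof (induction k arbitrary: c)
  case 0 then show ?case by simp
next
  case (Suc k)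
  have "dd (\<lambda>x. c) v = (\<lambda>x. 0)" for v :: 'a by (auto simp: dd_def)
  then show ?case using Suc by (auto simp: Ck_on_Suc_iff)
qed

lemma Ck_on_add:
  assumes "open S" "Ck_on k S f" "Ck_on k S g"
  shows "Ck_on k S (\<lambda>x. f x + g x)"
  using assms(2,3)
proof (induction k arbitrary: f g)
  case 0 then show ?case by (auto intro: continuous_intros)
next
  case (Suc k)
  have der: "((\<lambda>x. f x + g x) has_derivative (\<lambda>v. dd f v x + dd g v x)) (at x)" if "x \<in> S" for x
    using Suc.prems that
    by (intro has_derivative_add has_derivative_dd) (simp_all add: Ck_on_Suc_iff[OF assms(1)])
  have "Ck_on k S (\<lambda>x. dd f v x + dd g v x)" for v
    using Suc.prems by (intro Suc.IH) (simp_all add: Ck_on_Suc_iff[OF assms(1)])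
  show ?case by (rule Ck_on_SucI[OF assms(1)], erule der, fact)
qed

lemma Ck_on_bounded_linear:
  assumes "open S" "bounded_linear h" "Ck_on k S f"
  shows "Ck_on k S (\<lambda>x. h (f x))"
  using assms(3)
proof (induction k arbitrary: f)
  case 0 then show ?case
    using assms(2) by (auto intro: bounded_linear.continuous_on)
next
  case (Suc k)
  have der: "((\<lambda>x. h (f x)) has_derivative (\<lambda>v. h (dd f v x))) (at x)" if "x \<in> S" for x
    using Suc.prems that
    by (intro bounded_linear.has_derivative[OF assms(2)] has_derivative_dd) (simp add: Ck_on_Suc_iff[OF assms(1)])
  have "Ck_on k S (\<lambda>x. h (dd f v x))" for v
    using Suc.prems by (intro Suc.IH) (simp add: Ck_on_Suc_iff[OF assms(1)])
  show ?case by (rule Ck_on_SucI[OF assms(1)], erule der, fact)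
qed

text \<open>By the Leibniz rule the derivative is a sum of two products of the same kind, in which
  the undifferentiated factor has one order of smoothness to spare.\<close>

lemma Ck_on_bounded_bilinear:
  assumes "open S" "bounded_bilinear h" "Ck_on k S f" "Ck_on k S g"
  shows "Ck_on k S (\<lambda>x. h (f x) (g x))"
  using assms(3,4)
proof (induction k arbitrary: f g)
  case 0 then show ?case
    using assms(2) by (auto intro: bounded_bilinear.continuous_on)
next
  case (Suc k)
  have der: "((\<lambda>x. h (f x) (g x)) has_derivative (\<lambda>v. h (f x) (dd g v x) + h (dd f v x) (g x))) (at x)"
    if "x \<in> S" for x
    using Suc.prems that
    by (intro bounded_bilinear.FDERIV[OF assms(2)] has_derivative_dd) (simp_all add: Ck_on_Suc_iff[OF assms(1)])
  have "Ck_on k S (\<lambda>x. h (f x) (dd g v x) + h (dd f v x) (g x))" for v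
    using Suc.prems Ck_on_SucD[OF assms(1) Suc.prems(1)] Ck_on_SucD[OF assms(1) Suc.prems(2)]
    by (intro Ck_on_add[OF assms(1)] Suc.IH) (simp_all add: Ck_on_Suc_iff[OF assms(1)])
  show ?case by (rule Ck_on_SucI[OF assms(1)], erule der, fact)
qed

lemma Ck_on_sum:
  assumes "open S" "\<And>i. i \<in> A \<Longrightarrow> Ck_on k S (f i)"
  shows "Ck_on k S (\<lambda>x. \<Sum>i\<in>A. f i x)"
  using assms(2)
proof (induction A rule: infinite_finite_induct)
  case (insert i A)
  then show ?case using Ck_on_add[OF assms(1), of k "f i" "\<lambda>x. \<Sum>i\<in>A. f i x"] by simp
qed (simp_all add: assms(1))

lemma Ck_on_compose:
  fixes g :: "'a::euclidean_space \<Rightarrow> 'b::euclidean_space" and f :: "'b \<Rightarrow> 'c::real_normed_vector"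
  assumes "open S" "open T" "\<And>x. x \<in> S \<Longrightarrow> g x \<in> T" "Ck_on k S g" "Ck_on k T f"
  shows "Ck_on k S (\<lambda>x. f (g x))"
  using assms(4,5)
proof (induction k arbitrary: f)
  case 0 then show ?case
    using assms(3) by (auto intro: continuous_on_compose2)
next
  case (Suc k)
  have der: "((\<lambda>x. f (g x)) has_derivative (\<lambda>v. dd f (dd g v x) (g x))) (at x)" if "x \<in> S" for x
  proof (rule has_derivative_compose[OF has_derivative_dd has_derivative_dd])
    show "g differentiable (at x)" "f differentiable (at (g x))"
      using Suc.prems assms(3)[OF that] that
      by (simp_all add: Ck_on_Suc_iff[OF assms(1)] Ck_on_Suc_iff[OF assms(2)])
  qed
  \<comment> \<open>The direction \<open>dd g v x\<close> varies with \<open>x\<close>, while the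
    hypothesis controls \<open>dd f b\<close> for fixed \<open>b\<close> only; expanding in
    \<open>Basis\<close> reduces to fixed directions.\<close>
  have lin: "dd f (dd g v x) (g x) = (\<Sum>b\<in>Basis. (dd g v x \<bullet> b) *\<^sub>R dd f b (g x))" if "x \<in> S" for v x
  proof -
    have "linear (\<lambda>v. dd f v (g x))"
      using Suc.prems(2) assms(3)[OF that]
      by (intro has_derivative_linear[OF has_derivative_dd]) (simp add: Ck_on_Suc_iff[OF assms(2)])
    then interpret linear "\<lambda>v. dd f v (g x)" .
    have "dd f (\<Sum>b\<in>Basis. (dd g v x \<bullet> b) *\<^sub>R b) (g x) = (\<Sum>b\<in>Basis. (dd g v x \<bullet> b) *\<^sub>R dd f b (g x))"
      by (simp add: sum scale)
    then show ?thesis by (simp add: euclidean_representation)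
  qed
  have "Ck_on k S g" "Ck_on k S (dd g v)" "Ck_on k T (dd f b)" for v b
    using Suc.prems Ck_on_SucD[OF assms(1) Suc.prems(1)]
    by (simp_all add: Ck_on_Suc_iff[OF assms(1)] Ck_on_Suc_iff[OF assms(2)])
  then have "Ck_on k S (\<lambda>x. (\<Sum>b\<in>Basis. (dd g v x \<bullet> b) *\<^sub>R dd f b (g x)))" for v
    by (intro Ck_on_sum Ck_on_bounded_bilinear[where h=scaleR, OF _ bounded_bilinear_scaleR]
       Ck_on_bounded_linear[where h="\<lambda>x. x \<bullet> _", OF _ bounded_linear_inner_left] assms(1) Suc.IH)
  then have "Ck_on k S (\<lambda>x. dd f (dd g v x) (g x))" for v
    by (rule Ck_on_cong[OF assms(1), rotated]) (simp add: lin)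
  show ?case by (rule Ck_on_SucI[OF assms(1)], erule der, fact)
qed

section \<open>Closure properties of smooth maps\<close>

lemma smooth_on_iff:
  assumes "open S"
  shows "smooth_on S f \<longleftrightarrow> (\<forall>x\<in>S. f differentiable (at x)) \<and> (\<forall>v. smooth_on S (dd f v))"
proof -
  have "smooth_on S f \<longleftrightarrow> (\<forall>k. Ck_on (Suc k) S f)"
    unfolding smooth_on_def by (meson Ck_on_SucD[OF assms])
  also have "\<dots> \<longleftrightarrow> (\<forall>x\<in>S. f differentiable (at x)) \<and> (\<forall>v k. Ck_on k S (dd f v))"
    unfolding Ck_on_Suc_iff[OF assms] by blast
  finally show ?thesis by (simp only: smooth_on_def)
qed

lemma smooth_on_cong:
  "smooth_on S f \<Longrightarrow> open S \<Longrightarrow> (\<And>y. y \<in> S \<Longrightarrow> f y = g y) \<Longrightarrow> smooth_on S g"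
  unfolding smooth_on_def by (intro allI Ck_on_cong[of S f g]) auto

lemma smooth_on_subset:
  "smooth_on S f \<Longrightarrow> open S \<Longrightarrow> open T \<Longrightarrow> T \<subseteq> S \<Longrightarrow> smooth_on T f"
  unfolding smooth_on_def by (intro allI Ck_on_subset[of S T]) auto

lemma smooth_on_continuous: "smooth_on S f \<Longrightarrow> continuous_on S f"
  unfolding smooth_on_def by (metis Ck_on.simps(1))

lemma smooth_on_differentiable: "smooth_on S f \<Longrightarrow> open S \<Longrightarrow> x \<in> S \<Longrightarrow> f differentiable (at x)"
  using smooth_on_iff[of S f] by simp

lemma smooth_on_has_derivative:
  "smooth_on S f \<Longrightarrow> open S \<Longrightarrow> x \<in> S \<Longrightarrow> (f has_derivative (\<lambda>v. dd f v x)) (at x)"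
  by (intro has_derivative_dd smooth_on_differentiable)

lemma linear_dd: "smooth_on S f \<Longrightarrow> open S \<Longrightarrow> x \<in> S \<Longrightarrow> linear (\<lambda>v. dd f v x)"
  by (intro has_derivative_linear[OF smooth_on_has_derivative])

lemma smooth_on_dd: "open S \<Longrightarrow> smooth_on S f \<Longrightarrow> smooth_on S (dd f v)"
  using smooth_on_iff[of S f] by simp

lemma smooth_on_const: "open S \<Longrightarrow> smooth_on S (\<lambda>x. c)"
  by (simp add: smooth_on_def)

lemma smooth_on_add:
  "open S \<Longrightarrow> smooth_on S f \<Longrightarrow> smooth_on S g \<Longrightarrow> smooth_on S (\<lambda>x. f x + g x)"
  by (simp add: smooth_on_def Ck_on_add)

lemma smooth_on_bounded_linear:
  "open S \<Longrightarrow> bounded_linear h \<Longrightarrow> smooth_on S f \<Longrightarrow> smooth_on S (\<lambda>x. h (f x))"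
  by (simp add: smooth_on_def Ck_on_bounded_linear)

lemma smooth_on_bounded_bilinear:
  "open S \<Longrightarrow> bounded_bilinear h \<Longrightarrow> smooth_on S f \<Longrightarrow> smooth_on S g \<Longrightarrow> smooth_on S (\<lambda>x. h (f x) (g x))"
  by (simp add: smooth_on_def Ck_on_bounded_bilinear)

lemma smooth_on_minus: "open S \<Longrightarrow> smooth_on S f \<Longrightarrow> smooth_on S (\<lambda>x. - f x)"
  by (rule smooth_on_bounded_linear[OF _ bounded_linear_minus[OF bounded_linear_ident]])

lemma smooth_on_diff:
  "open S \<Longrightarrow> smooth_on S f \<Longrightarrow> smooth_on S g \<Longrightarrow> smooth_on S (\<lambda>x. f x - g x)"
  using smooth_on_add[of S f "\<lambda>x. - g x"] smooth_on_minus[of S g] by simp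

lemma smooth_on_scaleR:
  "open S \<Longrightarrow> smooth_on S f \<Longrightarrow> smooth_on S g \<Longrightarrow> smooth_on S (\<lambda>x. f x *\<^sub>R g x)"
  by (rule smooth_on_bounded_bilinear[OF _ bounded_bilinear_scaleR])

lemma smooth_on_mult:
  fixes f g :: "'a::euclidean_space \<Rightarrow> real"
  shows "open S \<Longrightarrow> smooth_on S f \<Longrightarrow> smooth_on S g \<Longrightarrow> smooth_on S (\<lambda>x. f x * g x)"
  by (rule smooth_on_bounded_bilinear[OF _ bounded_bilinear_mult])

lemma smooth_on_inner:
  "open S \<Longrightarrow> smooth_on S f \<Longrightarrow> smooth_on S g \<Longrightarrow> smooth_on S (\<lambda>x. f x \<bullet> g x)"
  by (rule smooth_on_bounded_bilinear[OF _ bounded_bilinear_inner])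

lemma smooth_on_compose:
  fixes g :: "'a::euclidean_space \<Rightarrow> 'b::euclidean_space"
  shows "smooth_on T f \<Longrightarrow> smooth_on S g \<Longrightarrow> open S \<Longrightarrow> open T \<Longrightarrow> (\<And>x. x \<in> S \<Longrightarrow> g x \<in> T)
    \<Longrightarrow> smooth_on S (\<lambda>x. f (g x))"
  using Ck_on_compose[of S T g _ f] by (simp add: smooth_on_def)

lemma smooth_on_ident: "open S \<Longrightarrow> smooth_on S (\<lambda>x. x)"
proof -
  assume S: "open S"
  have "dd (\<lambda>x. x) v = (\<lambda>x. v)" for v :: 'a by (auto simp: dd_def)
  then show ?thesis by (simp add: smooth_on_iff[OF S, of "\<lambda>x. x"] smooth_on_const[OF S])
qed

lemma smooth_on_real_inverse: "smooth_on (-{0::real}) inverse"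
proof -
  have S: "open (-{0::real})" by (simp add: open_Compl)
  have der: "((inverse :: real \<Rightarrow> real) has_derivative (\<lambda>h. - (inverse x * h * inverse x))) (at x)"
    if "x \<noteq> 0" for x :: real
    using has_derivative_inverse'[OF that] by simp
  have "Ck_on k (-{0::real}) inverse" for k
  proof (induction k)
    case 0 then show ?case by (auto intro: continuous_intros)
  next
    case (Suc k)
    \<comment> \<open>The derivative of \<open>inverse\<close> is a polynomial in
      \<open>inverse\<close> itself, so each order of smoothness yields the next.\<close>
    have "Ck_on k (-{0::real}) (\<lambda>x. (- v) * (inverse x * inverse x))" for v
      by (intro Ck_on_bounded_bilinear[OF S bounded_bilinear_mult] Ck_on_const[OF S] Suc)
    then show ?case by (intro Ck_on_SucI[OF S der]) (simp_all add: mult_ac)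
  qed
  then show ?thesis by (simp add: smooth_on_def)
qed

lemma smooth_on_inverse:
  fixes f :: "'a::euclidean_space \<Rightarrow> real"
  shows "open S \<Longrightarrow> smooth_on S f \<Longrightarrow> (\<And>x. x \<in> S \<Longrightarrow> f x \<noteq> 0) \<Longrightarrow> smooth_on S (\<lambda>x. inverse (f x))"
  by (rule smooth_on_compose[OF smooth_on_real_inverse, of S f]) (auto simp: open_Compl)

lemma smooth_on_divide:
  fixes f g :: "'a::euclidean_space \<Rightarrow> real"
  shows "open S \<Longrightarrow> smooth_on S f \<Longrightarrow> smooth_on S g \<Longrightarrow> (\<And>x. x \<in> S \<Longrightarrow> g x \<noteq> 0)
    \<Longrightarrow> smooth_on S (\<lambda>x. f x / g x)"
  unfolding divide_inverse by (intro smooth_on_mult smooth_on_inverse)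

lemma smooth_on_real_sqrt: "smooth_on {0<..} sqrt"
proof -
  have S: "open {0::real<..}" by simp
  have der: "(sqrt has_derivative (\<lambda>h. h * (inverse (sqrt x) * (1/2)))) (at x)"
    if "x > 0" for x :: real
    using DERIV_real_sqrt[OF that]
    unfolding has_field_derivative_def
    by (rule has_derivative_eq_rhs) (simp add: fun_eq_iff field_simps)
  have "Ck_on k {0<..} sqrt" for k
  proof (induction k)
    case 0 then show ?case by (auto intro: continuous_intros)
  next
    case (Suc k)
    have "Ck_on k (-{0::real}) inverse"
      using smooth_on_real_inverse by (simp add: smooth_on_def)
    then have inv: "Ck_on k {0<..} (\<lambda>x. inverse (sqrt x))"
      using Ck_on_compose[OF S _ _ Suc, of "-{0}" inverse] by (simp add: open_Compl)
    have "Ck_on k {0<..} (\<lambda>x. v * (inverse (sqrt x) * (1/2)))" for v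
      by (rule Ck_on_bounded_bilinear[OF S bounded_bilinear_mult Ck_on_const[OF S]
          Ck_on_bounded_bilinear[OF S bounded_bilinear_mult inv Ck_on_const[OF S]]])
    moreover have "(sqrt has_derivative (\<lambda>h. h * (inverse (sqrt x) * (1/2)))) (at x)"
      if "x \<in> {0<..}" for x
      using der that by simp
    ultimately show ?case by (rule Ck_on_SucI[OF S, rotated])
  qed
  then show ?thesis by (simp add: smooth_on_def)
qed

lemma smooth_on_norm:
  fixes f :: "'a::euclidean_space \<Rightarrow> 'b::real_inner"
  assumes "open S" "smooth_on S f" "\<And>x. x \<in> S \<Longrightarrow> f x \<noteq> 0"
  shows "smooth_on S (\<lambda>x. norm (f x))"
  unfolding norm_eq_sqrt_inner
  using assms by (intro smooth_on_compose[OF smooth_on_real_sqrt] smooth_on_inner) simp_all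

lemma dd_inner:
  assumes "f differentiable (at x)" "g differentiable (at x)"
  shows "dd (\<lambda>x. f x \<bullet> g x) v x = f x \<bullet> dd g v x + dd f v x \<bullet> g x"
  by (rule dd_eqI) (intro has_derivative_inner has_derivative_dd assms)

lemma dd_inner_smooth:
  assumes "open S" "smooth_on S f" "smooth_on S g" "x \<in> S"
  shows "dd (\<lambda>x. f x \<bullet> g x) v x = f x \<bullet> dd g v x + dd f v x \<bullet> g x"
  using assms by (intro dd_inner smooth_on_differentiable)

lemma dd_const [simp]: "dd (\<lambda>x. c) v x = 0"
  by (simp add: dd_def)

section \<open>Symmetry of second derivatives\<close>

lemma second_difference_mean_value:
  fixes f :: "'a::euclidean_space \<Rightarrow> real"
  assumes S: "open S" "smooth_on S f" and h: "h > 0"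
    and sub: "\<And>s t. \<bar>s\<bar> \<le> h \<Longrightarrow> \<bar>t\<bar> \<le> h \<Longrightarrow> q + s *\<^sub>R X + t *\<^sub>R Y \<in> S"
  shows "\<exists>s t. 0 < s \<and> s < h \<and> 0 < t \<and> t < h \<and>
    f (q + h *\<^sub>R X + h *\<^sub>R Y) - f (q + h *\<^sub>R X) - f (q + h *\<^sub>R Y) + f q
      = h * h * dd (dd f X) Y (q + s *\<^sub>R X + t *\<^sub>R Y)"
proof -
  have line: "((\<lambda>s. F (p + s *\<^sub>R X)) has_real_derivative dd F X (p + s *\<^sub>R X)) (at s)"
    if "smooth_on S F" "p + s *\<^sub>R X \<in> S" for F :: "'a \<Rightarrow> real" and p X s
  proof -
    have "((\<lambda>s. p + s *\<^sub>R X) has_derivative (\<lambda>a. a *\<^sub>R X)) (at s)"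
      by (auto intro!: derivative_eq_intros)
    then have "((\<lambda>s. F (p + s *\<^sub>R X)) has_derivative (\<lambda>a. dd F (a *\<^sub>R X) (p + s *\<^sub>R X))) (at s)"
      using smooth_on_has_derivative[OF that(1) S(1) that(2)] by (rule has_derivative_compose)
    moreover have "(\<lambda>a. dd F (a *\<^sub>R X) (p + s *\<^sub>R X)) = (*) (dd F X (p + s *\<^sub>R X))"
      by (rule ext, subst linear_scale[OF linear_dd[OF that(1) S(1) that(2)]])
         (simp only: real_scaleR_def mult.commute)
    ultimately show ?thesis by (simp only: has_field_derivative_def)
  qed
  \<comment> \<open>The second difference is \<open>g h - g 0\<close>. The mean value theorem is
    applied to \<open>g\<close> along \<open>X\<close> and then, at the parameter \<open>s\<close>
    found there, to \<open>k\<close> along \<open>Y\<close>.\<close>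
  define g where "g s = f (q + h *\<^sub>R Y + s *\<^sub>R X) - f (q + s *\<^sub>R X)" for s
  define g' where "g' s = dd f X (q + h *\<^sub>R Y + s *\<^sub>R X) - dd f X (q + s *\<^sub>R X)" for s
  have "(g has_real_derivative g' z) (at z)" if z: "0 \<le> z" "z \<le> h" for z
  proof -
    have "q + h *\<^sub>R Y + z *\<^sub>R X \<in> S" "q + z *\<^sub>R X \<in> S"
      using sub[of z h] sub[of z 0] z h by (simp_all add: ac_simps)
    then show ?thesis unfolding g_def g'_def by (intro DERIV_diff line S)
  qed
  from MVT2[OF h this] obtain s where s: "s > 0" "s < h" "g h - g 0 = (h - 0) * g' s"
    by blast
  define k where "k t = dd f X (q + s *\<^sub>R X + t *\<^sub>R Y)" for t
  have "(k has_real_derivative dd (dd f X) Y (q + s *\<^sub>R X + z *\<^sub>R Y)) (at z)"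
    if z: "0 \<le> z" "z \<le> h" for z
    unfolding k_def using z s sub[of s z] by (intro line smooth_on_dd S) auto
  from MVT2[OF h this] obtain t where t: "t > 0" "t < h"
    "k h - k 0 = (h - 0) * dd (dd f X) Y (q + s *\<^sub>R X + t *\<^sub>R Y)"
    by blast
  have "g' s = k h - k 0"
    by (simp add: g'_def k_def ac_simps)
  moreover have "f (q + h *\<^sub>R X + h *\<^sub>R Y) - f (q + h *\<^sub>R X) - f (q + h *\<^sub>R Y) + f q = g h - g 0"
    by (simp add: g_def ac_simps)
  ultimately show ?thesis using s t
    by (intro exI[of _ s] exI[of _ t]) simp
qed

text \<open>The second difference is symmetric in \<open>X\<close> and \<open>Y\<close>, so the two
  mixed derivatives share a value at suitable, possibly different, points close to \<open>q\<close>;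
  continuity at \<open>q\<close> then forces equality.\<close>

lemma dd_commute_real:
  fixes f :: "'a::euclidean_space \<Rightarrow> real"
  assumes S: "open S" "smooth_on S f" "q \<in> S"
  shows "dd (dd f X) Y q = dd (dd f Y) X q"
proof (rule ccontr)
  let ?a = "dd (dd f X) Y q" and ?b = "dd (dd f Y) X q"
  assume "?a \<noteq> ?b"
  define e where "e = \<bar>?a - ?b\<bar> / 2"
  have e: "e > 0" using \<open>?a \<noteq> ?b\<close> by (simp add: e_def)
  have ex: "\<exists>d>0. \<forall>x. dist x q < d \<longrightarrow> dist (F x) (F q) < e" if "smooth_on S F" for F :: "'a \<Rightarrow> real"
    using smooth_on_differentiable[OF that S(1,3)] e
    by (auto dest!: differentiable_imp_continuous_within simp: continuous_within_eps_delta)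
  obtain d1 where d1: "d1 > 0" "\<And>x. dist x q < d1 \<Longrightarrow> dist (dd (dd f X) Y x) ?a < e"
    using ex[OF smooth_on_dd[OF S(1) smooth_on_dd[OF S(1,2)]]] by blast
  obtain d2 where d2: "d2 > 0" "\<And>x. dist x q < d2 \<Longrightarrow> dist (dd (dd f Y) X x) ?b < e"
    using ex[OF smooth_on_dd[OF S(1) smooth_on_dd[OF S(1,2)]]] by blast
  obtain d3 where d3: "d3 > 0" "ball q d3 \<subseteq> S" using S open_contains_ball by blast
  define d where "d = min d1 (min d2 d3)"
  \<comment> \<open>The summand 1 keeps \<open>m\<close> positive when both vectors vanish; with
    \<open>h = d / (2 * m)\<close> the parallelogram of parameters up to \<open>h\<close> stays
    within distance \<open>d / 2\<close> of \<open>q\<close>.\<close>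
  define m where "m = norm X + norm Y + 1"
  define h where "h = d / (2 * m)"
  have pos: "m > 0" unfolding m_def by (intro add_nonneg_pos add_nonneg_nonneg) auto
  have d: "d > 0" using d1 d2 d3 by (simp add: d_def)
  then have h: "h > 0" using pos by (simp add: h_def)
  have near: "dist (q + s *\<^sub>R X + t *\<^sub>R Y) q < d" if "\<bar>s\<bar> \<le> h" "\<bar>t\<bar> \<le> h" for s t
  proof -
    have "dist (q + s *\<^sub>R X + t *\<^sub>R Y) q = norm (s *\<^sub>R X + t *\<^sub>R Y)"
      by (simp add: dist_norm add.assoc)
    also have "\<dots> \<le> \<bar>s\<bar> * norm X + \<bar>t\<bar> * norm Y"
      by (metis norm_scaleR norm_triangle_ineq)
    also have "\<dots> \<le> h * norm X + h * norm Y"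
      using that by (intro add_mono mult_right_mono) auto
    also have "\<dots> \<le> h * m"
      using h by (simp add: m_def distrib_left)
    also have "\<dots> = d / 2" using pos by (simp add: h_def)
    finally show ?thesis using d by linarith
  qed
  have sub: "q + s *\<^sub>R X + t *\<^sub>R Y \<in> S" if "\<bar>s\<bar> \<le> h" "\<bar>t\<bar> \<le> h" for s t
  proof -
    have "dist q (q + s *\<^sub>R X + t *\<^sub>R Y) < d3"
      using near[OF that] unfolding d_def by (metis dist_commute min_less_iff_conj)
    then show ?thesis using d3(2) by (simp only: subset_eq Ball_def mem_ball)
  qed
  obtain s t where st: "0 < s" "s < h" "0 < t" "t < h"
    "f (q + h *\<^sub>R X + h *\<^sub>R Y) - f (q + h *\<^sub>R X) - f (q + h *\<^sub>R Y) + f q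
      = h * h * dd (dd f X) Y (q + s *\<^sub>R X + t *\<^sub>R Y)"
    using second_difference_mean_value[OF S(1,2) h, of q X Y] sub by blast
  have sub': "q + s *\<^sub>R Y + t *\<^sub>R X \<in> S" if "\<bar>s\<bar> \<le> h" "\<bar>t\<bar> \<le> h" for s t
    using sub[OF that(2,1)] by (simp add: algebra_simps)
  obtain s' t' where st': "0 < s'" "s' < h" "0 < t'" "t' < h"
    "f (q + h *\<^sub>R Y + h *\<^sub>R X) - f (q + h *\<^sub>R Y) - f (q + h *\<^sub>R X) + f q
      = h * h * dd (dd f Y) X (q + s' *\<^sub>R Y + t' *\<^sub>R X)"
    using second_difference_mean_value[OF S(1,2) h, of q Y X] sub' by blast
  have "h * h * dd (dd f X) Y (q + s *\<^sub>R X + t *\<^sub>R Y) = h * h * dd (dd f Y) X (q + s' *\<^sub>R Y + t' *\<^sub>R X)"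
    using st(5) st'(5) by (simp add: algebra_simps)
  then have "dd (dd f X) Y (q + s *\<^sub>R X + t *\<^sub>R Y) = dd (dd f Y) X (q + t' *\<^sub>R X + s' *\<^sub>R Y)"
    using h by (simp add: algebra_simps)
  moreover have "dist (dd (dd f X) Y (q + s *\<^sub>R X + t *\<^sub>R Y)) ?a < e"
    using near[of s t] st by (intro d1(2)) (auto simp: d_def)
  moreover have "dist (dd (dd f Y) X (q + t' *\<^sub>R X + s' *\<^sub>R Y)) ?b < e"
    using near[of t' s'] st' by (intro d2(2)) (auto simp: d_def)
  ultimately show False unfolding e_def dist_real_def by argo
qed

text \<open>Pairing with an arbitrary vector reduces to the real-valued case.\<close>

lemma dd_commute:
  fixes f :: "'a::euclidean_space \<Rightarrow> 'b::real_inner"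
  assumes S: "open S" "smooth_on S f" "q \<in> S"
  shows "dd (dd f X) Y q = dd (dd f Y) X q"
proof -
  have *: "dd (\<lambda>x. F x \<bullet> w) v x = dd F v x \<bullet> w" if "smooth_on S F" "x \<in> S" for F :: "'a \<Rightarrow> 'b" and w v x
    using dd_inner_smooth[OF S(1) that(1) smooth_on_const[OF S(1)] that(2), of w] by simp
  have **: "dd (dd (\<lambda>x. f x \<bullet> w) X) Y q = dd (dd f X) Y q \<bullet> w" for w X Y
    using dd_cong[OF S(1,3), of "dd (\<lambda>x. f x \<bullet> w) X" "\<lambda>x. dd f X x \<bullet> w"] S *
    by (simp add: smooth_on_dd)
  have "dd (dd f X) Y q \<bullet> w = dd (dd f Y) X q \<bullet> w" for w
    using dd_commute_real[OF S(1) _ S(3), of "\<lambda>x. f x \<bullet> w" X Y] S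
    by (simp add: ** smooth_on_inner smooth_on_const)
  then show ?thesis by (metis inner_commute vector_eq_rdot)
qed

section \<open>Frames orthonormal at a point\<close>

lemma real2_expand: "x = x $ 1 *\<^sub>R axis 1 1 + x $ 2 *\<^sub>R (axis 2 1 :: real^2)"
  by (simp add: vec_eq_iff forall_2 axis_def)

lemma linear_real2:
  fixes L :: "real^2 \<Rightarrow> 'b::real_vector"
  assumes "linear L"
  shows "L x = x $ 1 *\<^sub>R L (axis 1 1) + x $ 2 *\<^sub>R L (axis 2 1)"
proof -
  interpret linear L by fact
  have "L x = L (x $ 1 *\<^sub>R axis 1 1 + x $ 2 *\<^sub>R axis 2 1)" using real2_expand[of x] by simp
  then show ?thesis by (simp only: add scale)
qed

text \<open>\<open>L\<close> stands for the differential of the immersion at a point.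
  \<open>E1\<close> and \<open>E2\<close> are coordinate vectors, so as constant fields they are
  known to be orthonormal at that point only.\<close>

definition frame :: "(real^2 \<Rightarrow> real^4) \<Rightarrow> real^2 \<Rightarrow> real^2 \<Rightarrow> bool" where
  "frame L E1 E2 \<longleftrightarrow> linear L \<and> L E1 \<bullet> L E1 = 1 \<and> L E1 \<bullet> L E2 = 0 \<and> L E2 \<bullet> L E2 = 1 \<and>
     (\<forall>X. X = (L X \<bullet> L E1) *\<^sub>R E1 + (L X \<bullet> L E2) *\<^sub>R E2)"

lemma frameI:
  assumes "linear L" "L E1 \<bullet> L E1 = 1" "L E1 \<bullet> L E2 = 0" "L E2 \<bullet> L E2 = 1"
    and ex: "\<And>X. \<exists>a b. X = a *\<^sub>R E1 + b *\<^sub>R E2"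
  shows "frame L E1 E2"
proof -
  interpret linear L by fact
  have "X = (L X \<bullet> L E1) *\<^sub>R E1 + (L X \<bullet> L E2) *\<^sub>R E2" for X
  proof -
    obtain a b where X: "X = a *\<^sub>R E1 + b *\<^sub>R E2" using ex by blast
    have "L X = a *\<^sub>R L E1 + b *\<^sub>R L E2" unfolding X by (simp only: add scale)
    then have "L X \<bullet> L E1 = a" "L X \<bullet> L E2 = b"
      using assms(2-4) inner_commute[of "L E1" "L E2"] by (simp_all add: inner_add_left)
    then show ?thesis using X by simp
  qed
  then show ?thesis unfolding frame_def using assms(1-4) by blast
qed

text \<open>Gram-Schmidt on the images of the two coordinate vectors; injectivity of
  \<open>L\<close> keeps the lengths nonzero.\<close>

lemma frame_exists:
  assumes "linear L" "inj L"
  obtains E1 E2 where "frame L E1 E2"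
proof -
  interpret linear L by fact
  have L0: "L x = 0 \<longleftrightarrow> x = 0" for x using assms(2) linear_injective_0[OF assms(1)] zero by blast
  define e1 where "e1 = (axis 1 1 :: real^2)"
  define e2 where "e2 = (axis 2 1 :: real^2)"
  have e: "e1 $ 1 = 1" "e1 $ 2 = 0" "e2 $ 1 = 0" "e2 $ 2 = 1"
    by (simp_all add: e1_def e2_def axis_def)
  define p where "p = norm (L e1)"
  have "e1 \<noteq> 0" using e(1) by auto
  then have p: "p > 0" using L0 by (simp add: p_def)
  define E1 where "E1 = (1/p) *\<^sub>R e1"
  have LE1: "L E1 = (1/p) *\<^sub>R L e1" unfolding E1_def by (rule scale)
  have n1: "L E1 \<bullet> L E1 = 1"
    using p unfolding LE1 by (simp add: p_def dot_square_norm power2_eq_square)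
  define k where "k = L e2 \<bullet> L E1"
  define F where "F = e2 - k *\<^sub>R E1"
  have "F $ 2 = 1" by (simp add: F_def E1_def e)
  then have "F \<noteq> 0" by auto
  define s where "s = norm (L F)"
  have s: "s > 0" using L0 \<open>F \<noteq> 0\<close> by (simp add: s_def)
  have LF: "L F = L e2 - k *\<^sub>R L E1" unfolding F_def by (simp only: diff scale)
  have o: "L E1 \<bullet> L F = 0" unfolding LF using n1 by (simp add: inner_diff_right inner_commute k_def)
  define E2 where "E2 = (1/s) *\<^sub>R F"
  have LE2: "L E2 = (1/s) *\<^sub>R L F" unfolding E2_def by (rule scale)
  have n2: "L E2 \<bullet> L E2 = 1"
    using s unfolding LE2 by (simp add: s_def dot_square_norm power2_eq_square)
  have o2: "L E1 \<bullet> L E2 = 0" unfolding LE2 using o by simp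
  have "\<exists>a b. X = a *\<^sub>R E1 + b *\<^sub>R E2" for X
  proof (intro exI)
    show "X = (p * X $ 1 + k * X $ 2) *\<^sub>R E1 + (s * X $ 2) *\<^sub>R E2"
      using s p by (simp add: vec_eq_iff forall_2 E2_def F_def E1_def e)
        (simp add: field_simps)
  qed
  then have "frame L E1 E2" by (intro frameI assms n1 o2 n2)
  then show ?thesis by (rule that)
qed

lemma frame_expand:
  assumes "frame L E1 E2"
  shows "X = (L X \<bullet> L E1) *\<^sub>R E1 + (L X \<bullet> L E2) *\<^sub>R E2"
    "L X = (L X \<bullet> L E1) *\<^sub>R L E1 + (L X \<bullet> L E2) *\<^sub>R L E2"
    "L X \<bullet> L Y = (L X \<bullet> L E1) * (L Y \<bullet> L E1) + (L X \<bullet> L E2) * (L Y \<bullet> L E2)"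
proof -
  interpret linear L using assms by (simp add: frame_def)
  show 1: "X = (L X \<bullet> L E1) *\<^sub>R E1 + (L X \<bullet> L E2) *\<^sub>R E2" for X
    using assms unfolding frame_def by blast
  have "L X = L ((L X \<bullet> L E1) *\<^sub>R E1 + (L X \<bullet> L E2) *\<^sub>R E2)" using 1[of X] by simp
  then show 2: "L X = (L X \<bullet> L E1) *\<^sub>R L E1 + (L X \<bullet> L E2) *\<^sub>R L E2" by (simp only: add scale)
  have "L X \<bullet> L Y = ((L X \<bullet> L E1) *\<^sub>R L E1 + (L X \<bullet> L E2) *\<^sub>R L E2) \<bullet> L Y" using 2 by simp
  then show "L X \<bullet> L Y = (L X \<bullet> L E1) * (L Y \<bullet> L E1) + (L X \<bullet> L E2) * (L Y \<bullet> L E2)"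
    by (simp add: inner_add_left inner_commute[of "L Y"])
qed

lemma bilinear_frame:
  assumes "frame L E1 E2" "bilinear T"
  shows "T X Y = ((L X \<bullet> L E1) * (L Y \<bullet> L E1)) *\<^sub>R T E1 E1 + ((L X \<bullet> L E1) * (L Y \<bullet> L E2)) *\<^sub>R T E1 E2
     + ((L X \<bullet> L E2) * (L Y \<bullet> L E1)) *\<^sub>R T E2 E1 + ((L X \<bullet> L E2) * (L Y \<bullet> L E2)) *\<^sub>R T E2 E2"
proof -
  define a b c d where "a = L X \<bullet> L E1" "b = L X \<bullet> L E2" "c = L Y \<bullet> L E1" "d = L Y \<bullet> L E2"
  have "X = a *\<^sub>R E1 + b *\<^sub>R E2" "Y = c *\<^sub>R E1 + d *\<^sub>R E2"
    unfolding a_b_c_d_def using frame_expand(1)[OF assms(1)] by blast+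
  then have "T X Y = T (a *\<^sub>R E1 + b *\<^sub>R E2) (c *\<^sub>R E1 + d *\<^sub>R E2)" by simp
  also have "\<dots> = (a * c) *\<^sub>R T E1 E1 + (a * d) *\<^sub>R T E1 E2 + (b * c) *\<^sub>R T E2 E1 + (b * d) *\<^sub>R T E2 E2"
    by (simp add: bilinear_ladd[OF assms(2)] bilinear_radd[OF assms(2)] bilinear_lmul[OF assms(2)]
        bilinear_rmul[OF assms(2)] algebra_simps)
  finally show ?thesis unfolding a_b_c_d_def .
qed

lemma matrix_inv_eqI:
  fixes A :: "real^'n^'n"
  assumes "M ** A = mat 1"
  shows "matrix_inv A = M"
proof -
  have "A ** M = mat 1" using assms matrix_left_right_inverse by blast
  then have "\<exists>A'. A ** A' = mat 1 \<and> A' ** A = mat 1" using assms by blast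
  then have "A ** matrix_inv A = mat 1" unfolding matrix_inv_def by (metis (mono_tags, lifting) someI_ex)
  then have "M ** (A ** matrix_inv A) = M" by simp
  then show ?thesis using assms by (simp add: matrix_mul_assoc)
qed

text \<open>For an orthonormal basis E_k the inverse Gram matrix is g^ij = sum_k E_k^i E_k^j. This
  is the matrix \<open>M\<close>, and inserting it makes the contraction collapse.\<close>

lemma metric_trace_frame:
  assumes fr: "frame (frechet_derivative r (at q)) E1 E2" and T: "bilinear T"
  shows "metric_trace r q T = T E1 E1 + T E2 E2"
proof -
  let ?L = "frechet_derivative r (at q)"
  define e where "e i = (axis i 1 :: real^2)" for i
  define G where "G = ((\<chi> i j. ?L (e i) \<bullet> ?L (e j)) :: real^2^2)"
  define M where "M = ((\<chi> i j. E1 $ i * E1 $ j + E2 $ i * E2 $ j) :: real^2^2)"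
  have lin: "linear ?L" using fr by (simp add: frame_def)
  have L: "?L x = x $ 1 *\<^sub>R ?L (e 1) + x $ 2 *\<^sub>R ?L (e 2)" for x
    unfolding e_def by (rule linear_real2[OF lin])
  have ex: "e k $ i = (?L (e k) \<bullet> ?L E1) * E1 $ i + (?L (e k) \<bullet> ?L E2) * E2 $ i" for i k
    using arg_cong[OF frame_expand(1)[OF fr, of "e k"], of "\<lambda>x. x $ i"] by simp
  have "(M ** G) $ i $ k = e k $ i" for i k
  proof -
    have 1: "?L (e k) \<bullet> ?L E = E $ 1 * (?L (e k) \<bullet> ?L (e 1)) + E $ 2 * (?L (e k) \<bullet> ?L (e 2))" for E
      using arg_cong[OF L[of E], of "\<lambda>w. ?L (e k) \<bullet> w"]
      by (simp only: inner_add_right inner_scaleR_right)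
    have "(M ** G) $ i $ k = M $ i $ 1 * G $ 1 $ k + M $ i $ 2 * G $ 2 $ k"
      by (simp add: matrix_matrix_mult_def sum_2)
    also have "\<dots> = (?L (e k) \<bullet> ?L E1) * E1 $ i + (?L (e k) \<bullet> ?L E2) * E2 $ i"
      unfolding 1[of E1] 1[of E2] by (simp add: M_def G_def inner_commute[of _ "?L (e k)"] algebra_simps)
    finally show ?thesis using ex by simp
  qed
  then have "M ** G = mat 1"
    by (simp add: vec_eq_iff mat_def e_def axis_def)
  then have inv: "matrix_inv G = M" by (rule matrix_inv_eqI)
  have tr: "metric_trace r q T = (\<Sum>i\<in>UNIV. \<Sum>j\<in>UNIV. (M $ i $ j) *\<^sub>R T (e i) (e j))"
    unfolding metric_trace_def induced_metric_def Let_def e_def[symmetric] G_def[symmetric] inv ..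
  have TE: "T E E = (E $ 1 * E $ 1) *\<^sub>R T (e 1) (e 1) + (E $ 1 * E $ 2) *\<^sub>R T (e 1) (e 2)
      + (E $ 2 * E $ 1) *\<^sub>R T (e 2) (e 1) + (E $ 2 * E $ 2) *\<^sub>R T (e 2) (e 2)" for E
  proof -
    have "T E E = T (E $ 1 *\<^sub>R e 1 + E $ 2 *\<^sub>R e 2) (E $ 1 *\<^sub>R e 1 + E $ 2 *\<^sub>R e 2)"
      unfolding e_def using real2_expand[of E] by simp
    then show ?thesis
      by (simp add: bilinear_ladd[OF T] bilinear_radd[OF T] bilinear_lmul[OF T]
        bilinear_rmul[OF T] algebra_simps)
  qed
  show ?thesis unfolding tr TE[of E1] TE[of E2] by (simp add: sum_2 M_def scaleR_add_left)
qed

text \<open>A frame chosen point by point says nothing about smoothness. Cramer's rule writes the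
  trace as a rational expression in the metric coefficients, which can be used on the whole
  domain.\<close>

lemma metric_trace_Cramer:
  assumes "linear (frechet_derivative r (at q))" "inj (frechet_derivative r (at q))"
  defines "g \<equiv> \<lambda>i j. induced_metric r q (axis i 1) (axis j 1)"
  shows "g 1 1 * g 2 2 - g 1 2 * g 1 2 \<noteq> 0"
    and "metric_trace r q T = (1 / (g 1 1 * g 2 2 - g 1 2 * g 1 2)) *\<^sub>R
      (g 2 2 *\<^sub>R T (axis 1 1) (axis 1 1) - g 1 2 *\<^sub>R T (axis 1 1) (axis 2 1)
       - g 1 2 *\<^sub>R T (axis 2 1) (axis 1 1) + g 1 1 *\<^sub>R T (axis 2 1) (axis 2 1))"
proof -
  let ?L = "frechet_derivative r (at q)"
  define d where "d = g 1 1 * g 2 2 - g 1 2 * g 1 2"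
  have g_sym: "g 2 1 = g 1 2" by (simp add: g_def induced_metric_def inner_commute)
  show d: "d \<noteq> 0"
  proof
    assume d: "d = 0"
    define a where "a = ?L (axis 1 1)" define b where "b = ?L (axis 2 1)"
    have ga: "g 1 1 = a \<bullet> a" "g 1 2 = a \<bullet> b" "g 2 2 = b \<bullet> b"
      by (simp_all add: g_def induced_metric_def a_def b_def)
    interpret linear ?L by fact
    have nz: "?L x = 0 \<longleftrightarrow> x = 0" for x using assms(2) linear_injective_0[OF assms(1)] zero by blast
    \<comment> \<open>This vector has squared length \<open>a \<bullet> a\<close> times the Gram
      determinant. If the determinant vanishes, so does the vector, and injectivity then forces
      \<open>a = 0\<close>.\<close>
    have "(a \<bullet> a) *\<^sub>R b - (a \<bullet> b) *\<^sub>R a = ?L ((a \<bullet> a) *\<^sub>R axis 2 1 - (a \<bullet> b) *\<^sub>R axis 1 1)"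
      unfolding a_def b_def by (simp only: diff scale)
    moreover have "((a \<bullet> a) *\<^sub>R b - (a \<bullet> b) *\<^sub>R a) \<bullet> ((a \<bullet> a) *\<^sub>R b - (a \<bullet> b) *\<^sub>R a) = (a \<bullet> a) * d"
      unfolding d_def ga by (simp add: inner_diff_left inner_diff_right inner_commute algebra_simps)
    ultimately have "?L ((a \<bullet> a) *\<^sub>R axis 2 1 - (a \<bullet> b) *\<^sub>R axis 1 1) = 0"
      unfolding d mult_zero_right inner_eq_zero_iff by (rule trans[OF sym])
    then have "(a \<bullet> a) *\<^sub>R axis 2 1 - (a \<bullet> b) *\<^sub>R axis 1 1 = (0::real^2)"
      by (simp only: nz)
    from arg_cong[OF this, of "\<lambda>x. x $ 2"] have "a = 0" by (simp add: axis_def)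
    then have "(axis 1 1 :: real^2) = 0" unfolding a_def by (simp only: nz)
    then show False by (simp add: axis_eq_0_iff)
  qed
  define G where "G = ((\<chi> i j. g i j) :: real^2^2)"
  define M where "M = (vector [vector [g 2 2 / d, - g 1 2 / d], vector [- g 1 2 / d, g 1 1 / d]] :: real^2^2)"
  have "M ** G = mat 1"
    using d by (simp add: vec_eq_iff forall_2 mat_def matrix_matrix_mult_def sum_2 M_def G_def g_sym
      divide_simps) (simp add: d_def algebra_simps)
  then have inv: "matrix_inv G = M" by (rule matrix_inv_eqI)
  have "G = (\<chi> i j. induced_metric r q (axis i 1) (axis j 1))" by (simp add: G_def g_def)
  then have tr: "metric_trace r q T = (\<Sum>i\<in>UNIV. \<Sum>j\<in>UNIV. (M $ i $ j) *\<^sub>R T (axis i 1) (axis j 1))"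
    by (simp add: metric_trace_def Let_def flip: inv)
  show "metric_trace r q T = (1 / (g 1 1 * g 2 2 - g 1 2 * g 1 2)) *\<^sub>R
      (g 2 2 *\<^sub>R T (axis 1 1) (axis 1 1) - g 1 2 *\<^sub>R T (axis 1 1) (axis 2 1)
       - g 1 2 *\<^sub>R T (axis 2 1) (axis 1 1) + g 1 1 *\<^sub>R T (axis 2 1) (axis 2 1))"
    unfolding tr d_def[symmetric] by (simp add: sum_2 M_def scaleR_add_right scaleR_diff_right)
qed

text \<open>Free of denominators and valid for any constant fields, so that it can be differentiated
  along a basis that is orthonormal only at one point.\<close>

lemma metric_trace_basis:
  fixes T :: "real^2 \<Rightarrow> real^2 \<Rightarrow> real"
  assumes fr: "frame (frechet_derivative r (at q)) E1 E2" and T: "bilinear T" and sym: "\<And>X Y. T X Y = T Y X"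
  defines "g \<equiv> induced_metric r q"
  shows "(g X X * g Y Y - g X Y * g X Y) * metric_trace r q T
    = g Y Y * T X X - 2 * (g X Y * T X Y) + g X X * T Y Y"
proof -
  let ?L = "frechet_derivative r (at q)"
  define a b c d where "a = ?L X \<bullet> ?L E1" "b = ?L X \<bullet> ?L E2" "c = ?L Y \<bullet> ?L E1" "d = ?L Y \<bullet> ?L E2"
  have g: "g X X = a * a + b * b" "g X Y = a * c + b * d" "g Y Y = c * c + d * d"
    unfolding g_def induced_metric_def a_b_c_d_def by (rule frame_expand(3)[OF fr])+
  have "T E2 E1 = T E1 E2" by (rule sym)
  then have TT: "T X X = a * a * T E1 E1 + 2 * (a * b) * T E1 E2 + b * b * T E2 E2"
     "T X Y = a * c * T E1 E1 + (a * d + b * c) * T E1 E2 + b * d * T E2 E2"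
     "T Y Y = c * c * T E1 E1 + 2 * (c * d) * T E1 E2 + d * d * T E2 E2"
    unfolding a_b_c_d_def using bilinear_frame[OF fr T, of X X] bilinear_frame[OF fr T, of X Y]
      bilinear_frame[OF fr T, of Y Y] by (simp_all add: algebra_simps)
  show ?thesis unfolding metric_trace_frame[OF fr T] g TT by algebra
qed

text \<open>Two candidates for the normal part differ by a vector that is both tangent and normal,
  hence zero; this is what gives the definite description in \<open>normal_part\<close> its
  value.\<close>

lemma normal_part_frame:
  assumes fr: "frame (frechet_derivative r (at q)) E1 E2"
  defines "L \<equiv> frechet_derivative r (at q)"
  shows "normal_part r q w = w - (w \<bullet> L E1) *\<^sub>R L E1 - (w \<bullet> L E2) *\<^sub>R L E2"
proof -
  let ?n = "w - (w \<bullet> L E1) *\<^sub>R L E1 - (w \<bullet> L E2) *\<^sub>R L E2"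
  have fr': "frame L E1 E2" using fr by (simp add: L_def)
  interpret linear L using fr' by (simp add: frame_def)
  have on: "L E1 \<bullet> L E1 = 1" "L E1 \<bullet> L E2 = 0" "L E2 \<bullet> L E1 = 0" "L E2 \<bullet> L E2 = 1"
    using fr' by (simp_all add: frame_def inner_commute)
  have n1: "?n \<bullet> L X = 0" for X
    using arg_cong[OF frame_expand(2)[OF fr', of X], of "\<lambda>v. ?n \<bullet> v"]
    by (simp only: inner_add_right inner_diff_left inner_scaleR_left inner_scaleR_right on) simp
  have "w - ?n = L ((w \<bullet> L E1) *\<^sub>R E1 + (w \<bullet> L E2) *\<^sub>R E2)"
    by (simp add: add scale)
  then have n2: "w - ?n \<in> range L" by simp
  show ?thesis unfolding normal_part_def tangent_plane_def L_def[symmetric]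
  proof (rule the_equality)
    show "(\<forall>t\<in>range L. orthogonal ?n t) \<and> w - ?n \<in> range L"
      using n1 n2 by (simp add: orthogonal_def)
    fix n assume n: "(\<forall>t\<in>range L. orthogonal n t) \<and> w - n \<in> range L"
    then obtain Z where Z: "w - n = L Z" by blast
    obtain Z' where Z': "w - ?n = L Z'" using n2 by blast
    have nn: "n - ?n = L (Z' - Z)" 
    proof -
      have "n - ?n = (w - ?n) - (w - n)" by (simp only: diff_diff_eq2 diff_add_cancel) simp
      then show ?thesis unfolding Z Z' diff .
    qed
    have "n \<bullet> L (Z' - Z) = 0" using n by (simp add: orthogonal_def)
    then have "(n - ?n) \<bullet> L (Z' - Z) = 0" using n1[of "Z' - Z"] by (simp only: inner_diff_left) 
    then have "n - ?n = 0" unfolding nn by (simp only: inner_eq_zero_iff)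
    then show "n = ?n" by (simp only: right_minus_eq)
  qed
qed

text \<open>Riesz representation in an orthonormal basis. The shape operator and the Levi-Civita
  connection are both definite descriptions of this kind and are evaluated by it.\<close>

lemma riesz_frame:
  assumes fr: "frame L E1 E2" and f: "linear f"
  shows "(THE Z. \<forall>Y. L Z \<bullet> L Y = f Y) = f E1 *\<^sub>R E1 + f E2 *\<^sub>R E2"
proof (rule the_equality)
  interpret L: linear L using fr by (simp add: frame_def)
  interpret f: linear f by fact
  have fY: "f Y = (L Y \<bullet> L E1) * f E1 + (L Y \<bullet> L E2) * f E2" for Y
    using arg_cong[OF frame_expand(1)[OF fr, of Y], of f]
    by (simp only: f.add f.scale real_scaleR_def)
  show "\<forall>Y. L (f E1 *\<^sub>R E1 + f E2 *\<^sub>R E2) \<bullet> L Y = f Y"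
  proof
    fix Y
    show "L (f E1 *\<^sub>R E1 + f E2 *\<^sub>R E2) \<bullet> L Y = f Y"
      unfolding fY[of Y] L.add L.scale inner_add_left inner_scaleR_left by (simp add: inner_commute)
  qed
  fix Z assume "\<forall>Y. L Z \<bullet> L Y = f Y"
  then show "Z = f E1 *\<^sub>R E1 + f E2 *\<^sub>R E2" using frame_expand(1)[OF fr, of Z] by simp
qed

section \<open>Immersed patches\<close>

lemma dd_cmult_add:
  fixes f g :: "'a::euclidean_space \<Rightarrow> real"
  assumes "f differentiable (at x)" "g differentiable (at x)"
  shows "dd (\<lambda>x. a * f x + b * g x) v x = a * dd f v x + b * dd g v x"
  by (rule dd_eqI) (intro has_derivative_add has_derivative_mult_right has_derivative_dd assms)

text \<open>\<open>r\<close> will be the immersion composed with one local parametrization; all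
  curvature computations take place in this coordinate picture.\<close>

locale immersed_patch =
  fixes V :: "(real^2) set" and r :: "real^2 \<Rightarrow> real^4"
  assumes open_V: "open V" and smooth_r: "smooth_on V r"
    and inj_r: "q \<in> V \<Longrightarrow> inj (frechet_derivative r (at q))"
begin

abbreviation H where "H \<equiv> mean_curvature_vector r"
abbreviation N where "N \<equiv> normal_part r"
abbreviation II where "II \<equiv> second_fundamental_form r"
abbreviation orthoframe where "orthoframe q \<equiv> frame (frechet_derivative r (at q))"

lemma smooth_dd_r: "smooth_on V (dd r X)" "smooth_on V (dd (dd r X) Y)"
  by (intro smooth_on_dd open_V smooth_r)+

lemma linear_L: "q \<in> V \<Longrightarrow> linear (frechet_derivative r (at q))"
  unfolding frechet_derivative_eq_dd(1) by (rule linear_dd[OF smooth_r open_V])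

lemma obtain_frame:
  assumes "q \<in> V" obtains E1 E2 where "orthoframe q E1 E2"
  using frame_exists[OF linear_L inj_r] assms by blast

lemma orthoframeD:
  assumes "orthoframe q E1 E2"
  shows "dd r E1 q \<bullet> dd r E1 q = 1" "dd r E1 q \<bullet> dd r E2 q = 0" "dd r E2 q \<bullet> dd r E1 q = 0"
    "dd r E2 q \<bullet> dd r E2 q = 1"
  using assms by (simp_all only: frame_def dd_fold inner_commute[of "dd r E2 q" "dd r E1 q"])

lemma orthoframe_expand:
  assumes "orthoframe q E1 E2"
  shows "X = (dd r X q \<bullet> dd r E1 q) *\<^sub>R E1 + (dd r X q \<bullet> dd r E2 q) *\<^sub>R E2"
    "dd r X q = (dd r X q \<bullet> dd r E1 q) *\<^sub>R dd r E1 q + (dd r X q \<bullet> dd r E2 q) *\<^sub>R dd r E2 q"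
  using frame_expand(1,2)[OF assms, of X] unfolding dd_fold .

lemma normal_part_eq:
  "orthoframe q E1 E2 \<Longrightarrow> N q w = w - (w \<bullet> dd r E1 q) *\<^sub>R dd r E1 q - (w \<bullet> dd r E2 q) *\<^sub>R dd r E2 q"
  using normal_part_frame[of r q E1 E2 w] by (simp only: dd_fold)

lemma normal_part_dd:
  assumes "q \<in> V"
  shows "N q w \<bullet> dd r X q = 0"
proof -
  obtain E1 E2 where fr: "orthoframe q E1 E2" using obtain_frame[OF assms] .
  have *: "N q w \<bullet> dd r E1 q = 0" "N q w \<bullet> dd r E2 q = 0"
    unfolding normal_part_eq[OF fr] by (simp_all add: inner_diff_left orthoframeD[OF fr])
  have "N q w \<bullet> dd r X q = N q w \<bullet> ((dd r X q \<bullet> dd r E1 q) *\<^sub>R dd r E1 q + (dd r X q \<bullet> dd r E2 q) *\<^sub>R dd r E2 q)"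
    using orthoframe_expand(2)[OF fr, of X] by simp
  also have "\<dots> = 0" by (simp add: inner_add_right *)
  finally show ?thesis .
qed

text \<open>Orthogonal projection is self-adjoint and fixes normal vectors.\<close>

lemma normal_part_inner:
  assumes "q \<in> V" "\<And>X. n \<bullet> dd r X q = 0"
  shows "N q w \<bullet> n = w \<bullet> n"
proof -
  obtain E1 E2 where fr: "orthoframe q E1 E2" using obtain_frame[OF assms(1)] .
  show ?thesis unfolding normal_part_eq[OF fr]
    using assms(2)[of E1] assms(2)[of E2]
    by (simp add: inner_diff_left inner_commute[of "dd r E1 q" n] inner_commute[of "dd r E2 q" n])
qed

lemma linear_normal_part:
  assumes "q \<in> V" shows "linear (N q)"
proof -
  obtain E1 E2 where fr: "orthoframe q E1 E2" using obtain_frame[OF assms] .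
  show ?thesis
    by (rule linearI) (simp_all add: normal_part_eq[OF fr] inner_add_left algebra_simps)
qed

lemma second_fundamental_form_eq: "II q X Y = N q (dd (dd r Y) X q)"
  unfolding second_fundamental_form_def frechet_derivative_eq_dd(2) dd_fold ..

lemma r2_commute: "q \<in> V \<Longrightarrow> dd (dd r Y) X q = dd (dd r X) Y q"
  by (rule dd_commute[OF open_V smooth_r])

text \<open>Together with \<open>r3_commute2\<close> this gives the total symmetry of third
  derivatives, the form in which the Codazzi equation of the flat ambient space enters.\<close>

lemma r3_commute1: "q \<in> V \<Longrightarrow> dd (dd (dd r Z) Y) X q = dd (dd (dd r Z) X) Y q"
  by (rule dd_commute[OF open_V smooth_dd_r(1)])

lemma r3_commute2:
  assumes "q \<in> V" shows "dd (dd (dd r Z) Y) X q = dd (dd (dd r Y) Z) X q"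
  by (rule dd_cong[OF open_V assms]) (rule r2_commute)

lemma r1_lin: assumes "q \<in> V"
  shows "dd r (X + Y) q = dd r X q + dd r Y q" "dd r (a *\<^sub>R X) q = a *\<^sub>R dd r X q"
  using linear_add[OF linear_dd[OF smooth_r open_V assms]] linear_scale[OF linear_dd[OF smooth_r open_V assms]]
  by auto

lemma r2_lin: assumes "q \<in> V"
  shows "dd (dd r Z) (X + Y) q = dd (dd r Z) X q + dd (dd r Z) Y q"
    "dd (dd r Z) (a *\<^sub>R X) q = a *\<^sub>R dd (dd r Z) X q"
    "dd (dd r (X + Y)) Z q = dd (dd r X) Z q + dd (dd r Y) Z q"
    "dd (dd r (a *\<^sub>R X)) Z q = a *\<^sub>R dd (dd r X) Z q"
proof -
  note lin = linear_dd[OF smooth_dd_r(1) open_V assms, of Z]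
  show 1: "dd (dd r Z) (X + Y) q = dd (dd r Z) X q + dd (dd r Z) Y q" by (rule linear_add[OF lin])
  show 2: "dd (dd r Z) (a *\<^sub>R X) q = a *\<^sub>R dd (dd r Z) X q" by (rule linear_scale[OF lin])
  show "dd (dd r (X + Y)) Z q = dd (dd r X) Z q + dd (dd r Y) Z q"
    unfolding r2_commute[OF assms, of _ Z] by (rule 1)
  show "dd (dd r (a *\<^sub>R X)) Z q = a *\<^sub>R dd (dd r X) Z q"
    unfolding r2_commute[OF assms, of _ Z] by (rule 2)
qed

lemma r3_lin: assumes "q \<in> V"
  shows "dd (dd (dd r W) Z) (X + Y) q = dd (dd (dd r W) Z) X q + dd (dd (dd r W) Z) Y q"
    "dd (dd (dd r W) Z) (a *\<^sub>R X) q = a *\<^sub>R dd (dd (dd r W) Z) X q"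
    "dd (dd (dd r W) (X + Y)) Z q = dd (dd (dd r W) X) Z q + dd (dd (dd r W) Y) Z q"
    "dd (dd (dd r W) (a *\<^sub>R X)) Z q = a *\<^sub>R dd (dd (dd r W) X) Z q"
proof -
  note lin = linear_dd[OF smooth_dd_r(2) open_V assms, of W Z]
  show 1: "dd (dd (dd r W) Z) (X + Y) q = dd (dd (dd r W) Z) X q + dd (dd (dd r W) Z) Y q" by (rule linear_add[OF lin])
  show 2: "dd (dd (dd r W) Z) (a *\<^sub>R X) q = a *\<^sub>R dd (dd (dd r W) Z) X q" by (rule linear_scale[OF lin])
  show "dd (dd (dd r W) (X + Y)) Z q = dd (dd (dd r W) X) Z q + dd (dd (dd r W) Y) Z q"
    unfolding r3_commute1[OF assms, of W _ Z] by (rule 1)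
  show "dd (dd (dd r W) (a *\<^sub>R X)) Z q = a *\<^sub>R dd (dd (dd r W) X) Z q"
    unfolding r3_commute1[OF assms, of W _ Z] by (rule 2)
qed

lemma bilinear_II: assumes "q \<in> V" shows "bilinear (II q)"
proof -
  interpret N: linear "N q" by (rule linear_normal_part[OF assms])
  show ?thesis unfolding bilinear_def
    by (intro conjI allI linearI) (simp_all only: second_fundamental_form_eq r2_lin[OF assms] N.add N.scale)
qed

lemma H_frame: "q \<in> V \<Longrightarrow> orthoframe q E1 E2 \<Longrightarrow> H q = (1/2) *\<^sub>R (II q E1 E1 + II q E2 E2)"
  unfolding mean_curvature_vector_def by (simp only: metric_trace_frame bilinear_II)

lemma H_normal: assumes "q \<in> V" shows "H q \<bullet> dd r X q = 0"
proof -
  obtain E1 E2 where fr: "orthoframe q E1 E2" using obtain_frame[OF assms] .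
  show ?thesis unfolding H_frame[OF assms fr] second_fundamental_form_eq
    by (simp add: inner_add_left normal_part_dd[OF assms])
qed

lemma smooth_metric_trace:
  fixes T :: "real^2 \<Rightarrow> real^2 \<Rightarrow> real^2 \<Rightarrow> 'b::real_normed_vector"
  assumes "\<And>X Y. smooth_on V (\<lambda>q. T q X Y)"
  shows "smooth_on V (\<lambda>q. metric_trace r q (T q))"
proof -
  define g where "g i j q = induced_metric r q (axis i 1) (axis j 1)" for i j :: 2 and q
  have g: "smooth_on V (g i j)" for i j
  proof -
    have "g i j = (\<lambda>q. dd r (axis i 1) q \<bullet> dd r (axis j 1) q)"
      by (simp add: fun_eq_iff g_def induced_metric_def dd_def)
    then show ?thesis by (simp add: smooth_on_inner[OF open_V smooth_dd_r(1) smooth_dd_r(1)])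
  qed
  have nz: "g 1 1 q * g 2 2 q - g 1 2 q * g 1 2 q \<noteq> 0" if "q \<in> V" for q
    unfolding g_def by (rule metric_trace_Cramer(1)[OF linear_L[OF that] inj_r[OF that]])
  have "smooth_on V (\<lambda>q. (1 / (g 1 1 q * g 2 2 q - g 1 2 q * g 1 2 q)) *\<^sub>R
      (g 2 2 q *\<^sub>R T q (axis 1 1) (axis 1 1) - g 1 2 q *\<^sub>R T q (axis 1 1) (axis 2 1)
       - g 1 2 q *\<^sub>R T q (axis 2 1) (axis 1 1) + g 1 1 q *\<^sub>R T q (axis 2 1) (axis 2 1)))"
    by (intro smooth_on_scaleR smooth_on_divide smooth_on_const smooth_on_diff smooth_on_add smooth_on_mult
        open_V g assms nz)
  then show ?thesis
  proof (rule smooth_on_cong[OF _ open_V])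
    fix q assume q: "q \<in> V"
    show "(1 / (g 1 1 q * g 2 2 q - g 1 2 q * g 1 2 q)) *\<^sub>R
      (g 2 2 q *\<^sub>R T q (axis 1 1) (axis 1 1) - g 1 2 q *\<^sub>R T q (axis 1 1) (axis 2 1)
       - g 1 2 q *\<^sub>R T q (axis 2 1) (axis 1 1) + g 1 1 q *\<^sub>R T q (axis 2 1) (axis 2 1)) =
      metric_trace r q (T q)"
      unfolding g_def by (rule metric_trace_Cramer(2)[OF linear_L[OF q] inj_r[OF q], symmetric])
  qed
qed

text \<open>The tangential part of \<open>w\<close> is the metric trace of the bilinear map sending
  X, Y to \<langle>w, dr X\<rangle> dr Y, so \<open>smooth_metric_trace\<close> applies.\<close>

lemma smooth_normal_part:
  assumes w: "smooth_on V w"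
  shows "smooth_on V (\<lambda>q. N q (w q))"
proof -
  have "smooth_on V (\<lambda>q. w q - metric_trace r q (\<lambda>X Y. (w q \<bullet> dd r X q) *\<^sub>R dd r Y q))"
    by (intro smooth_on_diff smooth_metric_trace smooth_on_scaleR smooth_on_inner open_V w smooth_dd_r)
  then show ?thesis
  proof (rule smooth_on_cong[OF _ open_V])
    fix q assume q: "q \<in> V"
    obtain E1 E2 where fr: "orthoframe q E1 E2" using obtain_frame[OF q] .
    have "bilinear (\<lambda>X Y. (w q \<bullet> dd r X q) *\<^sub>R dd r Y q)"
      unfolding bilinear_def
      by (intro conjI allI linearI) (simp_all add: r1_lin[OF q] inner_add_right algebra_simps)
    from metric_trace_frame[OF fr this]
    show "w q - metric_trace r q (\<lambda>X Y. (w q \<bullet> dd r X q) *\<^sub>R dd r Y q) = N q (w q)"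
      by (simp add: normal_part_eq[OF fr])
  qed
qed

lemma smooth_H: "smooth_on V H"
proof -
  have "smooth_on V (\<lambda>q. (1/2) *\<^sub>R metric_trace r q (II q))"
    unfolding second_fundamental_form_eq[abs_def]
    by (intro smooth_on_scaleR smooth_on_const smooth_metric_trace smooth_normal_part open_V smooth_dd_r)
  then show ?thesis unfolding mean_curvature_vector_def[abs_def] .
qed

section \<open>The stress-bienergy tensor and its divergence\<close>

lemma induced_metric_eq: "induced_metric r q X Y = dd r X q \<bullet> dd r Y q"
  by (simp add: induced_metric_def dd_def)

lemma II_inner_H: "q \<in> V \<Longrightarrow> II q X Y \<bullet> H q = dd (dd r Y) X q \<bullet> H q"
  unfolding second_fundamental_form_eq by (intro normal_part_inner H_normal)

text \<open>Since \<open>H\<close> is normal, \<langle>A_H X, Y\<rangle> = \<langle>B(X,Y),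
  H\<rangle> is the pairing of \<open>H\<close> with the plain second derivative of
  \<open>r\<close>. Shape operator and projection disappear, and the result can be differentiated
  directly.\<close>

lemma stress_eq:
  assumes q: "q \<in> V"
  shows "stress_bienergy r q X Y
    = - 2 * (norm (H q))\<^sup>2 * (dd r X q \<bullet> dd r Y q) + 4 * (dd (dd r Y) X q \<bullet> H q)"
proof -
  obtain E1 E2 where fr: "orthoframe q E1 E2" using obtain_frame[OF q] .
  define f where "f Y = II q X Y \<bullet> H q" for Y
  have f: "linear f" unfolding f_def
    by (rule linearI) (simp_all add: bilinear_radd[OF bilinear_II[OF q]] bilinear_rmul[OF bilinear_II[OF q]] inner_add_left)
  have "shape_operator r q (H q) X = f E1 *\<^sub>R E1 + f E2 *\<^sub>R E2"
    unfolding shape_operator_def f_def[symmetric] induced_metric_def by (rule riesz_frame[OF fr f])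
  then have "induced_metric r q (shape_operator r q (H q) X) Y
      = f E1 * (dd r E1 q \<bullet> dd r Y q) + f E2 * (dd r E2 q \<bullet> dd r Y q)"
    unfolding induced_metric_eq by (simp add: r1_lin[OF q] inner_add_left)
  also have "\<dots> = f ((dd r Y q \<bullet> dd r E1 q) *\<^sub>R E1 + (dd r Y q \<bullet> dd r E2 q) *\<^sub>R E2)"
    by (simp add: linear_add[OF f] linear_scale[OF f] inner_commute)
  also have "\<dots> = f Y" using orthoframe_expand(1)[OF fr, of Y] by simp
  finally show ?thesis
    unfolding stress_bienergy_def f_def II_inner_H[OF q] by (simp only: induced_metric_eq)
qed

text \<open>By symmetry of second derivatives the Koszul expression collapses to
  \<open>2 * f Z\<close>, so \<nabla>_X Y is the tangential part of the second derivative of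
  \<open>r\<close>: the tangential half of the Gauss formula.\<close>

lemma levi_civita_eq:
  assumes q: "q \<in> V" and fr: "orthoframe q E1 E2"
  shows "levi_civita r q X Y
    = (dd (dd r Y) X q \<bullet> dd r E1 q) *\<^sub>R E1 + (dd (dd r Y) X q \<bullet> dd r E2 q) *\<^sub>R E2"
proof -
  have dg: "frechet_derivative (\<lambda>q'. induced_metric r q' A B) (at q) Z
      = dd r A q \<bullet> dd (dd r B) Z q + dd (dd r A) Z q \<bullet> dd r B q" for A B Z
    unfolding induced_metric_eq dd_fold by (rule dd_inner_smooth[OF open_V smooth_dd_r(1) smooth_dd_r(1) q])
  define f where "f Z = dd (dd r Y) X q \<bullet> dd r Z q" for Z
  have f: "linear f" unfolding f_def
    by (rule linearI) (simp_all add: r1_lin[OF q] inner_add_right)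
  have rhs: "frechet_derivative (\<lambda>q'. induced_metric r q' Y Z) (at q) X
        + frechet_derivative (\<lambda>q'. induced_metric r q' X Z) (at q) Y
        - frechet_derivative (\<lambda>q'. induced_metric r q' X Y) (at q) Z = 2 * f Z" for Z
    unfolding dg f_def using r2_commute[OF q, of X Y] r2_commute[OF q, of X Z] r2_commute[OF q, of Y Z]
    by (simp add: inner_commute)
  show ?thesis
    unfolding levi_civita_def rhs using riesz_frame[OF fr f]
    by (simp add: induced_metric_def f_def)
qed

lemma trace_H:
  assumes q: "q \<in> V"
  shows "metric_trace r q (\<lambda>X Y. dd (dd r Y) X q \<bullet> H q) = 2 * (norm (H q))\<^sup>2"
proof -
  obtain E1 E2 where fr: "orthoframe q E1 E2" using obtain_frame[OF q] .
  have "bilinear (\<lambda>X Y. dd (dd r Y) X q \<bullet> H q)"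
    unfolding bilinear_def by (intro conjI allI linearI) (simp_all add: r2_lin[OF q] inner_add_left)
  from metric_trace_frame[OF fr this]
  have "metric_trace r q (\<lambda>X Y. dd (dd r Y) X q \<bullet> H q) = (II q E1 E1 + II q E2 E2) \<bullet> H q"
    by (simp only: II_inner_H[OF q] inner_add_left)
  also have "\<dots> = (2 *\<^sub>R H q) \<bullet> H q" unfolding H_frame[OF q fr] by simp
  finally show ?thesis by (simp add: dot_square_norm)
qed

text \<open>The Weingarten equation, from differentiating \<langle>H, dr Y\<rangle> = 0.\<close>

lemma dd_H_tangent:
  assumes q: "q \<in> V"
  shows "dd H X q \<bullet> dd r Y q = - (dd (dd r Y) X q \<bullet> H q)"
proof -
  have "dd (\<lambda>q. H q \<bullet> dd r Y q) X q = dd (\<lambda>q. 0) X q"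
    by (rule dd_cong[OF open_V q]) (rule H_normal)
  then show ?thesis
    unfolding dd_inner_smooth[OF open_V smooth_H smooth_dd_r(1) q] by (simp add: inner_commute)
qed

lemma dd_H_H:
  assumes q: "q \<in> V" and cmc: "\<forall>q\<in>V. norm (H q) = c"
  shows "dd H X q \<bullet> H q = 0"
proof -
  have "dd (\<lambda>q. H q \<bullet> H q) X q = dd (\<lambda>q. c\<^sup>2) X q"
    by (rule dd_cong[OF open_V q]) (simp add: dot_square_norm cmc)
  then show ?thesis
    unfolding dd_inner_smooth[OF open_V smooth_H smooth_H q] by (simp add: inner_commute)
qed

text \<open>This is trace A_H = 2 c^2 differentiated along \<open>Y\<close>. Since
  \<open>E1\<close>, \<open>E2\<close> are orthonormal at \<open>q\<close> only, the derivatives of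
  the metric coefficients appear; they make up the right-hand side.\<close>

lemma trace_derivative:
  assumes q: "q \<in> V" and fr: "orthoframe q E1 E2" and cmc: "\<forall>q\<in>V. norm (H q) = c"
  shows "dd (dd (dd r E1) E1) Y q \<bullet> H q + dd (dd (dd r E2) E2) Y q \<bullet> H q
      + dd (dd r E1) E1 q \<bullet> dd H Y q + dd (dd r E2) E2 q \<bullet> dd H Y q
    = 2 * ((dd (dd r E1) Y q \<bullet> dd r E1 q) * (dd (dd r E1) E1 q \<bullet> H q)
      + (dd (dd r E1) Y q \<bullet> dd r E2 q + dd (dd r E2) Y q \<bullet> dd r E1 q) * (dd (dd r E2) E1 q \<bullet> H q)
      + (dd (dd r E2) Y q \<bullet> dd r E2 q) * (dd (dd r E2) E2 q \<bullet> H q))"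
proof -
  define g where "g A B p = dd r A p \<bullet> dd r B p" for A B p
  define h where "h A B p = dd (dd r B) A p \<bullet> H p" for A B p
  have sg: "smooth_on V (g A B)" for A B
    unfolding g_def[abs_def] by (intro smooth_on_inner smooth_dd_r open_V)
  have sh: "smooth_on V (h A B)" for A B
    unfolding h_def[abs_def] by (intro smooth_on_inner smooth_dd_r smooth_H open_V)
  have dg: "(g A B has_derivative (\<lambda>v. dd (g A B) v q)) (at q)" for A B
    by (rule smooth_on_has_derivative[OF sg open_V q])
  have dh: "(h A B has_derivative (\<lambda>v. dd (h A B) v q)) (at q)" for A B
    by (rule smooth_on_has_derivative[OF sh open_V q])
  \<comment> \<open>The trace identity is stated at every point of \<open>V\<close>, for the
    constant fields \<open>E1\<close> and \<open>E2\<close>; only so can it be differentiated at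
    \<open>q\<close>.\<close>
  have rel: "(g E1 E1 p * g E2 E2 p - g E1 E2 p * g E1 E2 p) * (2 * c\<^sup>2)
     = g E2 E2 p * h E1 E1 p - 2 * (g E1 E2 p * h E1 E2 p) + g E1 E1 p * h E2 E2 p" if p: "p \<in> V" for p
  proof -
    obtain F1 F2 where F: "orthoframe p F1 F2" using obtain_frame[OF p] .
    have bl: "bilinear (\<lambda>X Y. dd (dd r Y) X p \<bullet> H p)"
      unfolding bilinear_def by (intro conjI allI linearI) (simp_all add: r2_lin[OF p] inner_add_left)
    have "dd (dd r Y) X p \<bullet> H p = dd (dd r X) Y p \<bullet> H p" for X Y
      by (simp only: r2_commute[OF p, of Y X])
    from metric_trace_basis[OF F bl this, of E1 E2] show ?thesis
      unfolding trace_H[OF p] cmc[rule_format, OF p] induced_metric_eq g_def h_def .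
  qed
  define F where "F p = (g E1 E1 p * g E2 E2 p - g E1 E2 p * g E1 E2 p) * (2 * c\<^sup>2)
     - (g E2 E2 p * h E1 E1 p - 2 * (g E1 E2 p * h E1 E2 p) + g E1 E1 p * h E2 E2 p)" for p
  have "dd F Y q = dd (\<lambda>p. 0) Y q"
    by (rule dd_cong[OF open_V q]) (simp add: F_def rel)
  then have F0: "dd F Y q = 0" by simp
  have "(F has_derivative (\<lambda>v.
      ((g E1 E1 q * dd (g E2 E2) v q + dd (g E1 E1) v q * g E2 E2 q)
        - (g E1 E2 q * dd (g E1 E2) v q + dd (g E1 E2) v q * g E1 E2 q)) * (2 * c\<^sup>2)
     - ((g E2 E2 q * dd (h E1 E1) v q + dd (g E2 E2) v q * h E1 E1 q)
       - 2 * (g E1 E2 q * dd (h E1 E2) v q + dd (g E1 E2) v q * h E1 E2 q)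
       + (g E1 E1 q * dd (h E2 E2) v q + dd (g E1 E1) v q * h E2 E2 q)))) (at q)"
    unfolding F_def[abs_def]
    by (intro has_derivative_diff has_derivative_add has_derivative_mult_right has_derivative_mult_left
       has_derivative_mult dg dh)
  from dd_eqI[OF this, of Y] F0 have
     "((g E1 E1 q * dd (g E2 E2) Y q + dd (g E1 E1) Y q * g E2 E2 q)
        - (g E1 E2 q * dd (g E1 E2) Y q + dd (g E1 E2) Y q * g E1 E2 q)) * (2 * c\<^sup>2)
     = ((g E2 E2 q * dd (h E1 E1) Y q + dd (g E2 E2) Y q * h E1 E1 q)
       - 2 * (g E1 E2 q * dd (h E1 E2) Y q + dd (g E1 E2) Y q * h E1 E2 q)
       + (g E1 E1 q * dd (h E2 E2) Y q + dd (g E1 E1) Y q * h E2 E2 q))"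
    by linarith
  moreover have gq: "g E1 E1 q = 1" "g E1 E2 q = 0" "g E2 E2 q = 1"
    unfolding g_def by (rule orthoframeD[OF fr])+
  moreover have "2 * c\<^sup>2 = h E1 E1 q + h E2 E2 q"
    using rel[OF q] unfolding gq by simp
  ultimately have 1: "(dd (g E2 E2) Y q + dd (g E1 E1) Y q) * (h E1 E1 q + h E2 E2 q)
     = dd (h E1 E1) Y q + dd (g E2 E2) Y q * h E1 E1 q - 2 * (dd (g E1 E2) Y q * h E1 E2 q)
       + (dd (h E2 E2) Y q + dd (g E1 E1) Y q * h E2 E2 q)"
    by simp
  have dgq: "dd (g A B) Y q = dd (dd r A) Y q \<bullet> dd r B q + dd (dd r B) Y q \<bullet> dd r A q" for A B
    unfolding g_def[abs_def] dd_inner_smooth[OF open_V smooth_dd_r(1) smooth_dd_r(1) q]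
    by (simp add: inner_commute)
  have dhq: "dd (h A B) Y q = dd (dd (dd r B) A) Y q \<bullet> H q + dd (dd r B) A q \<bullet> dd H Y q" for A B
    unfolding h_def[abs_def] dd_inner_smooth[OF open_V smooth_dd_r(2) smooth_H q]
    by simp
  have "dd (h E1 E1) Y q + dd (h E2 E2) Y q = dd (g E1 E1) Y q * h E1 E1 q + 2 * (dd (g E1 E2) Y q * h E1 E2 q)
     + dd (g E2 E2) Y q * h E2 E2 q"
    using 1 by (simp add: algebra_simps)
  then show ?thesis unfolding dgq dhq h_def by (simp add: algebra_simps)
qed

text \<open>The induced metric is parallel, so for constant |H| the part -2 c^2 g of the stress
  tensor cancels and only the shape operator contributes.\<close>

lemma covariant_derivative_eq:
  assumes q: "q \<in> V" and fr: "orthoframe q E1 E2" and cmc: "\<forall>q\<in>V. norm (H q) = c"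
  shows "covariant_derivative r (stress_bienergy r) q X Z Y =
    4 * (dd (dd (dd r Y) Z) X q \<bullet> H q + dd (dd r Y) Z q \<bullet> dd H X q
      - ((dd (dd r Z) X q \<bullet> dd r E1 q) * (dd (dd r Y) E1 q \<bullet> H q)
        + (dd (dd r Z) X q \<bullet> dd r E2 q) * (dd (dd r Y) E2 q \<bullet> H q))
      - ((dd (dd r Y) X q \<bullet> dd r E1 q) * (dd (dd r E1) Z q \<bullet> H q)
        + (dd (dd r Y) X q \<bullet> dd r E2 q) * (dd (dd r E2) Z q \<bullet> H q)))"
proof -
  define g where "g p = dd r Z p \<bullet> dd r Y p" for p
  define h where "h p = dd (dd r Y) Z p \<bullet> H p" for p
  have sg: "smooth_on V g" unfolding g_def[abs_def] by (intro smooth_on_inner smooth_dd_r open_V)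
  have sh: "smooth_on V h" unfolding h_def[abs_def] by (intro smooth_on_inner smooth_dd_r smooth_H open_V)
  have "dd (\<lambda>p. stress_bienergy r p Z Y) X q = dd (\<lambda>p. (- 2 * c\<^sup>2) * g p + 4 * h p) X q"
    by (rule dd_cong[OF open_V q]) (simp add: stress_eq cmc g_def h_def)
  also have "\<dots> = (- 2 * c\<^sup>2) * dd g X q + 4 * dd h X q"
    by (intro dd_cmult_add smooth_on_differentiable[OF _ open_V q] sg sh)
  finally have st: "frechet_derivative (\<lambda>p. stress_bienergy r p Z Y) (at q) X = (- 2 * c\<^sup>2) * dd g X q + 4 * dd h X q"
    by (simp only: dd_fold)
  have dg: "dd g X q = dd r Z q \<bullet> dd (dd r Y) X q + dd (dd r Z) X q \<bullet> dd r Y q"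
    unfolding g_def[abs_def] by (rule dd_inner_smooth[OF open_V smooth_dd_r(1) smooth_dd_r(1) q])
  have dh: "dd h X q = dd (dd r Y) Z q \<bullet> dd H X q + dd (dd (dd r Y) Z) X q \<bullet> H q"
    unfolding h_def[abs_def] by (rule dd_inner_smooth[OF open_V smooth_dd_r(2) smooth_H q])
  note 1 = st[unfolded dg dh]
  \<comment> \<open>Pairing with \<open>dd r A q\<close> sees only the tangential part of
    \<open>w\<close>, which the frame recovers completely.\<close>
  have tan: "(w \<bullet> dd r E1 q) * (dd r E1 q \<bullet> dd r A q) + (w \<bullet> dd r E2 q) * (dd r E2 q \<bullet> dd r A q) = w \<bullet> dd r A q" for w A
    using arg_cong[OF orthoframe_expand(2)[OF fr, of A], of "\<lambda>v. w \<bullet> v"]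
    by (simp add: inner_add_right inner_commute mult.commute)
  have 2: "stress_bienergy r q (levi_civita r q X Z) Y = (- 2 * c\<^sup>2) * (dd (dd r Z) X q \<bullet> dd r Y q)
     + 4 * ((dd (dd r Z) X q \<bullet> dd r E1 q) * (dd (dd r Y) E1 q \<bullet> H q)
        + (dd (dd r Z) X q \<bullet> dd r E2 q) * (dd (dd r Y) E2 q \<bullet> H q))"
    unfolding levi_civita_eq[OF q fr] stress_eq[OF q] cmc[rule_format, OF q] r1_lin[OF q] r2_lin[OF q]
      inner_add_left inner_scaleR_left tan ..
  have 3: "stress_bienergy r q Z (levi_civita r q X Y) = (- 2 * c\<^sup>2) * (dd (dd r Y) X q \<bullet> dd r Z q)
     + 4 * ((dd (dd r Y) X q \<bullet> dd r E1 q) * (dd (dd r E1) Z q \<bullet> H q)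
        + (dd (dd r Y) X q \<bullet> dd r E2 q) * (dd (dd r E2) Z q \<bullet> H q))"
    unfolding levi_civita_eq[OF q fr] stress_eq[OF q] cmc[rule_format, OF q] r1_lin[OF q] r2_lin[OF q]
      inner_add_left inner_scaleR_left inner_commute[of "dd r Z q"] tan ..
  show ?thesis unfolding covariant_derivative_def 1 2 3
    by (simp add: algebra_simps inner_commute[of "dd r Z q"])
qed

text \<open>Total symmetry of third derivatives moves \<open>Y\<close> to the outermost place, where
  \<open>trace_derivative\<close> evaluates the sum; the remaining derivatives of \<open>H\<close>
  then assemble into their normal parts.\<close>

lemma divergence_stress_bienergy:
  assumes q: "q \<in> V" and fr: "orthoframe q E1 E2" and cmc: "\<forall>q\<in>V. norm (H q) = c"
  shows "divergence r (stress_bienergy r) q Y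
    = 4 * (dd (dd r Y) E1 q \<bullet> N q (dd H E1 q) + dd (dd r Y) E2 q \<bullet> N q (dd H E2 q))"
proof -
  have lH: "dd H (A + B) q = dd H A q + dd H B q" "dd H (a *\<^sub>R A) q = a *\<^sub>R dd H A q" for A B a
    using linear_add[OF linear_dd[OF smooth_H open_V q]] linear_scale[OF linear_dd[OF smooth_H open_V q]] by auto
  have "bilinear (\<lambda>X Z. covariant_derivative r (stress_bienergy r) q X Z Y)"
    unfolding bilinear_def covariant_derivative_eq[OF assms]
    by (intro conjI allI linearI)
       (simp_all add: r2_lin[OF q] r3_lin[OF q] lH inner_add_left inner_add_right algebra_simps)
  from metric_trace_frame[OF fr this]
  have div: "divergence r (stress_bienergy r) q Y =
    covariant_derivative r (stress_bienergy r) q E1 E1 Y + covariant_derivative r (stress_bienergy r) q E2 E2 Y"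
    unfolding divergence_def .
  define P11 P12 P22 where "P11 = dd (dd r E1) E1 q" "P12 = dd (dd r E2) E1 q" "P22 = dd (dd r E2) E2 q"
  define Q1 Q2 where "Q1 = dd (dd r Y) E1 q" "Q2 = dd (dd r Y) E2 q"
  define R1 R2 where "R1 = dd (dd (dd r Y) E1) E1 q" "R2 = dd (dd (dd r Y) E2) E2 q"
  have P21: "dd (dd r E1) E2 q = P12" unfolding P11_P12_P22_def by (rule r2_commute[OF q])
  have Qs: "dd (dd r E1) Y q = Q1" "dd (dd r E2) Y q = Q2" unfolding Q1_Q2_def by (rule r2_commute[OF q])+
  have Rs: "dd (dd (dd r E1) E1) Y q = R1" "dd (dd (dd r E2) E2) Y q = R2"
    unfolding R1_R2_def using r3_commute1[OF q, of E1 E1 Y] r3_commute2[OF q, of E1 Y E1]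
      r3_commute1[OF q, of E2 E2 Y] r3_commute2[OF q, of E2 Y E2] by (simp_all only:)
  let ?u1 = "dd r E1 q" and ?u2 = "dd r E2 q" and ?h = "H q"
  have C: "divergence r (stress_bienergy r) q Y = 4 * (R1 \<bullet> ?h + Q1 \<bullet> dd H E1 q
      - ((P11 \<bullet> ?u1) * (Q1 \<bullet> ?h) + (P11 \<bullet> ?u2) * (Q2 \<bullet> ?h)) - ((Q1 \<bullet> ?u1) * (P11 \<bullet> ?h) + (Q1 \<bullet> ?u2) * (P12 \<bullet> ?h)))
     + 4 * (R2 \<bullet> ?h + Q2 \<bullet> dd H E2 q
      - ((P22 \<bullet> ?u1) * (Q1 \<bullet> ?h) + (P22 \<bullet> ?u2) * (Q2 \<bullet> ?h)) - ((Q2 \<bullet> ?u1) * (P12 \<bullet> ?h) + (Q2 \<bullet> ?u2) * (P22 \<bullet> ?h)))"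
    unfolding div covariant_derivative_eq[OF assms] P21 P11_P12_P22_def[symmetric] Q1_Q2_def[symmetric] R1_R2_def[symmetric] ..
  have D: "R1 \<bullet> ?h + R2 \<bullet> ?h + P11 \<bullet> dd H Y q + P22 \<bullet> dd H Y q
    = 2 * ((Q1 \<bullet> ?u1) * (P11 \<bullet> ?h) + (Q1 \<bullet> ?u2 + Q2 \<bullet> ?u1) * (P12 \<bullet> ?h) + (Q2 \<bullet> ?u2) * (P22 \<bullet> ?h))"
    using trace_derivative[OF assms, of Y] unfolding Rs Qs P11_P12_P22_def[symmetric] .
  have HY: "dd H Y q \<bullet> ?u1 = - (Q1 \<bullet> ?h)" "dd H Y q \<bullet> ?u2 = - (Q2 \<bullet> ?h)"
    unfolding dd_H_tangent[OF q] Qs by (rule refl)+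
  \<comment> \<open>\<open>P11 + P22\<close> has normal part 2 H, and \<open>dd H Y q\<close> is
    orthogonal to \<open>H\<close> because the length of \<open>H\<close> is constant; hence only
    tangential components survive the pairing.\<close>
  have "(P11 + P22) - 2 *\<^sub>R ?h = ((P11 + P22) \<bullet> ?u1) *\<^sub>R ?u1 + ((P11 + P22) \<bullet> ?u2) *\<^sub>R ?u2"
    unfolding H_frame[OF q fr] second_fundamental_form_eq normal_part_eq[OF fr] P11_P12_P22_def[symmetric]
    by (simp add: inner_add_left algebra_simps)
  from arg_cong[OF this, of "\<lambda>w. dd H Y q \<bullet> w"]
  have E: "P11 \<bullet> dd H Y q + P22 \<bullet> dd H Y q
     = - ((P11 \<bullet> ?u1 + P22 \<bullet> ?u1) * (Q1 \<bullet> ?h) + (P11 \<bullet> ?u2 + P22 \<bullet> ?u2) * (Q2 \<bullet> ?h))"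
    unfolding inner_commute[of P11 "dd H Y q"] inner_commute[of P22 "dd H Y q"]
    by (simp add: inner_add_left inner_add_right inner_diff_right HY dd_H_H[OF q cmc])
  have G: "Q1 \<bullet> N q (dd H E1 q) = Q1 \<bullet> dd H E1 q + (P11 \<bullet> ?h) * (Q1 \<bullet> ?u1) + (P12 \<bullet> ?h) * (Q1 \<bullet> ?u2)"
    "Q2 \<bullet> N q (dd H E2 q) = Q2 \<bullet> dd H E2 q + (P12 \<bullet> ?h) * (Q2 \<bullet> ?u1) + (P22 \<bullet> ?h) * (Q2 \<bullet> ?u2)"
    unfolding normal_part_eq[OF fr] dd_H_tangent[OF q] P21 P11_P12_P22_def[symmetric]
    by (simp_all add: inner_diff_right inner_add_right)
  show ?thesis unfolding C Q1_Q2_def[symmetric] G using D E by (simp add: algebra_simps)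
qed

end

section \<open>Local structure of non-parallel biconservative patches\<close>

text \<open>Four orthogonal nonzero vectors span the space, so the remainder \<open>v\<close>,
  orthogonal to all of them, vanishes. The vectors are left unnormalized because \<open>H\<close>
  and \<open>\<xi>\<close> will be among them.\<close>

lemma orthogonal_basis_expand4:
  fixes a b c d w :: "real^4"
  assumes nz: "a \<noteq> 0" "b \<noteq> 0" "c \<noteq> 0" "d \<noteq> 0"
    and o: "a \<bullet> b = 0" "a \<bullet> c = 0" "a \<bullet> d = 0" "b \<bullet> c = 0" "b \<bullet> d = 0" "c \<bullet> d = 0"
  shows "w = (w \<bullet> a / (a \<bullet> a)) *\<^sub>R a + (w \<bullet> b / (b \<bullet> b)) *\<^sub>R b + (w \<bullet> c / (c \<bullet> c)) *\<^sub>R c + (w \<bullet> d / (d \<bullet> d)) *\<^sub>R d"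
proof -
  let ?B = "{a, b, c, d}"
  have o': "b \<bullet> a = 0" "c \<bullet> a = 0" "d \<bullet> a = 0" "c \<bullet> b = 0" "d \<bullet> b = 0" "d \<bullet> c = 0"
    using o by (simp_all add: inner_commute)
  have ne: "a \<noteq> b" "a \<noteq> c" "a \<noteq> d" "b \<noteq> c" "b \<noteq> d" "c \<noteq> d"
    using o nz by auto
  have "pairwise orthogonal ?B"
    using o o' by (auto simp: pairwise_insert orthogonal_def)
  moreover have "0 \<notin> ?B" using nz by simp
  ultimately have "independent ?B" by (rule pairwise_orthogonal_independent)
  moreover have "card ?B = 4" using ne by simp
  ultimately have "UNIV \<subseteq> span ?B"
    by (intro card_ge_dim_independent) (simp_all add: dim_UNIV)
  define v where "v = w - ((w \<bullet> a / (a \<bullet> a)) *\<^sub>R a + (w \<bullet> b / (b \<bullet> b)) *\<^sub>R b + (w \<bullet> c / (c \<bullet> c)) *\<^sub>R c + (w \<bullet> d / (d \<bullet> d)) *\<^sub>R d)"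
  have "v \<bullet> a = 0" "v \<bullet> b = 0" "v \<bullet> c = 0" "v \<bullet> d = 0"
    using nz by (simp_all add: v_def inner_diff_left inner_add_left o o')
  then have "\<And>y. y \<in> ?B \<Longrightarrow> orthogonal v y" by (auto simp: orthogonal_def)
  then have "orthogonal v v" using orthogonal_to_span[of v ?B v] \<open>UNIV \<subseteq> span ?B\<close> by blast
  then have "v = 0" by (simp add: orthogonal_def)
  then show ?thesis by (simp add: v_def)
qed

context immersed_patch
begin

text \<open>\<open>e\<close> will be the direction of the rulings and \<open>t\<close> the unit
  tangent of the base curve. The last clause records that the derivative of \<open>H\<close> along
  \<open>t\<close> has a normal component; it turns into nonvanishing torsion.\<close>

theorem local_structure:
  assumes cmc: "\<forall>q\<in>V. norm (H q) = c" and c: "c \<noteq> 0"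
    and bicons: "\<And>q Y. q \<in> V \<Longrightarrow> divergence r (stress_bienergy r) q Y = 0"
    and q0: "q0 \<in> V" and X0: "N q0 (dd H X0 q0) \<noteq> 0"
  obtains d t e where "d > 0" "ball q0 d \<subseteq> V" "smooth_on (ball q0 d) t" "norm e = 1"
    "\<And>q. q \<in> ball q0 d \<Longrightarrow> norm (t q) = 1" "\<And>q. q \<in> ball q0 d \<Longrightarrow> t q \<bullet> e = 0"
    "\<And>q. q \<in> ball q0 d \<Longrightarrow> H q \<bullet> e = 0"
    "\<And>q. q \<in> ball q0 d \<Longrightarrow> t q \<bullet> H q = 0"
    "\<And>q Z. q \<in> ball q0 d \<Longrightarrow> dd r Z q = (t q \<bullet> dd r Z q) *\<^sub>R t q + (e \<bullet> dd r Z q) *\<^sub>R e"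
    "\<And>q Z. q \<in> ball q0 d \<Longrightarrow> dd t Z q = (2 * (t q \<bullet> dd r Z q)) *\<^sub>R H q"
    "\<And>q Z. q \<in> ball q0 d \<Longrightarrow> t q \<bullet> dd r Z q \<noteq> 0 \<Longrightarrow> N q (dd H Z q) \<noteq> 0"
proof -
  \<comment> \<open>Differentiating \<open>H\<close> along the fixed vector \<open>X0\<close>
    produces a smooth normal field, orthogonal to \<open>H\<close> because |H| is constant and
    nonzero at \<open>q0\<close> by assumption.\<close>
  define \<xi> where "\<xi> q = N q (dd H X0 q)" for q
  have smooth_\<xi>V: "smooth_on V \<xi>"
    unfolding \<xi>_def[abs_def] by (intro smooth_normal_part smooth_on_dd open_V smooth_H)
  have "open (V \<inter> \<xi> -` (-{0}))"
    by (intro continuous_open_preimage smooth_on_continuous smooth_\<xi>V open_V) (simp add: open_Compl)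
  moreover have "q0 \<in> V \<inter> \<xi> -` (-{0})" using q0 X0 by (simp add: \<xi>_def)
  \<comment> \<open>A ball is taken because its convexity later turns a vanishing derivative of
    \<open>E\<close> into constancy.\<close>
  ultimately obtain d where d: "d > 0" "ball q0 d \<subseteq> V \<inter> \<xi> -` (-{0})"
    unfolding open_contains_ball by blast
  define U where "U = ball q0 d"
  have openU: "open U" and q0U: "q0 \<in> U" using d by (simp_all add: U_def)
  have UV: "q \<in> V" and \<xi>0: "\<xi> q \<noteq> 0" if "q \<in> U" for q using d(2) that by (auto simp: U_def)
  have sub: "smooth_on U f" if "smooth_on V f" for f :: "real^2 \<Rightarrow> 'z::real_normed_vector"
    by (rule smooth_on_subset[OF that open_V openU]) (use UV in blast)
  note sr = sub[OF smooth_dd_r(1)] and srr = sub[OF smooth_dd_r(2)]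
    and sH = sub[OF smooth_H] and s\<xi> = sub[OF smooth_\<xi>V]
  have sHd: "smooth_on U (dd H Z)" for Z by (rule smooth_on_dd[OF openU sH])
  have HH: "H q \<bullet> H q = c\<^sup>2" if "q \<in> U" for q using cmc UV[OF that] by (simp add: dot_square_norm)
  have H0: "H q \<noteq> 0" if "q \<in> U" for q using HH[OF that] c by auto
  have Hr: "H q \<bullet> dd r X q = 0" "dd r X q \<bullet> H q = 0" if "q \<in> U" for q X
    using H_normal[OF UV[OF that], of X] by (simp_all only: inner_commute[of "dd r X q" "H q"])
  have \<xi>r: "\<xi> q \<bullet> dd r X q = 0" "dd r X q \<bullet> \<xi> q = 0" if "q \<in> U" for q X
    using normal_part_dd[OF UV[OF that], of "dd H X0 q" X] inner_commute[of "dd r X q" "\<xi> q"]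
    by (simp_all only: \<xi>_def)
  have HHZ: "dd H Z q \<bullet> H q = 0" "H q \<bullet> dd H Z q = 0" if "q \<in> U" for q Z
    using dd_H_H[OF UV[OF that] cmc, of Z] by (simp_all only: inner_commute[of "H q" "dd H Z q"])
  have \<xi>H: "\<xi> q \<bullet> H q = 0" "H q \<bullet> \<xi> q = 0" if "q \<in> U" for q
  proof -
    show "\<xi> q \<bullet> H q = 0"
      unfolding \<xi>_def using normal_part_inner[OF UV[OF that] Hr(1)[OF that], of "dd H X0 q"] HHZ(1)[OF that]
      by simp
    then show "H q \<bullet> \<xi> q = 0" by (simp only: inner_commute[of "H q" "\<xi> q"])
  qed
  define \<omega> where "\<omega> Z q = dd H Z q \<bullet> \<xi> q" for Z q
  have N\<xi>: "N q w \<bullet> \<xi> q = w \<bullet> \<xi> q" if "q \<in> U" for q w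
    by (rule normal_part_inner[OF UV[OF that]]) (rule \<xi>r[OF that])
  have \<omega>X0: "\<omega> X0 q \<noteq> 0" if "q \<in> U" for q
  proof -
    have "\<xi> q \<bullet> \<xi> q \<noteq> 0" using \<xi>0[OF that] by simp
    then show ?thesis using N\<xi>[OF that, of "dd H X0 q"] unfolding \<omega>_def \<xi>_def[symmetric] by simp
  qed
  have \<omega>_lin: "\<omega> (X + Y) q = \<omega> X q + \<omega> Y q" "\<omega> (a *\<^sub>R X) q = a * \<omega> X q" if "q \<in> U" for q X Y a
    using linear_add[OF linear_dd[OF smooth_H open_V UV[OF that]]] linear_scale[OF linear_dd[OF smooth_H open_V UV[OF that]]]
    by (simp_all add: \<omega>_def inner_add_left)
  \<comment> \<open>\<open>H\<close> and \<open>\<xi>\<close> span the normal plane and the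
    derivative of \<open>H\<close> is orthogonal to \<open>H\<close>, so the form
    \<open>\<omega>\<close> carries all of \<nabla>^\<bottom>H.\<close>
  have NH: "N q (dd H Z q) = (\<omega> Z q / (\<xi> q \<bullet> \<xi> q)) *\<^sub>R \<xi> q" if q: "q \<in> U" for q Z
  proof -
    obtain E1 E2 where fr: "orthoframe q E1 E2" using obtain_frame[OF UV[OF q]] .
    let ?w = "N q (dd H Z q)"
    have w: "?w \<bullet> dd r X q = 0" for X by (rule normal_part_dd[OF UV[OF q]])
    have wH: "?w \<bullet> H q = 0"
      using normal_part_inner[OF UV[OF q], of "H q" "dd H Z q"] Hr[OF q] HHZ[OF q] by simp
    have w\<xi>: "?w \<bullet> \<xi> q = \<omega> Z q" unfolding N\<xi>[OF q] \<omega>_def ..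
    have nz: "dd r E1 q \<noteq> 0" "dd r E2 q \<noteq> 0" using orthoframeD[OF fr] by auto
    from orthogonal_basis_expand4[OF nz H0[OF q] \<xi>0[OF q] orthoframeD(2)[OF fr] Hr(2)[OF q] \<xi>r(2)[OF q]
        Hr(2)[OF q] \<xi>r(2)[OF q] \<xi>H(2)[OF q], of ?w]
    show ?thesis unfolding w wH w\<xi> by simp
  qed
  \<comment> \<open>The shape operator in direction \<open>\<xi>\<close> is trace free and, by biconservativity, annihilates the
    dual of \<open>\<omega> \<noteq> 0\<close>; hence it vanishes.\<close>
  have A: "dd (dd r Y) X q \<bullet> \<xi> q = 0" if q: "q \<in> U" for q X Y
  proof -
    obtain E1 E2 where fr: "orthoframe q E1 E2" using obtain_frame[OF UV[OF q]] .
    define b11 b12 b22 where "b11 = dd (dd r E1) E1 q \<bullet> \<xi> q" "b12 = dd (dd r E2) E1 q \<bullet> \<xi> q"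
      "b22 = dd (dd r E2) E2 q \<bullet> \<xi> q"
    define w1 w2 where "w1 = \<omega> E1 q" "w2 = \<omega> E2 q"
    have b21: "dd (dd r E1) E2 q \<bullet> \<xi> q = b12" unfolding b11_b12_b22_def by (simp only: r2_commute[OF UV[OF q], of E1 E2])
    have "w1 * (dd (dd r Y) E1 q \<bullet> \<xi> q) + w2 * (dd (dd r Y) E2 q \<bullet> \<xi> q) = 0" for Y
      using divergence_stress_bienergy[OF UV[OF q] fr cmc, of Y] bicons[OF UV[OF q], of Y] \<xi>0[OF q]
      unfolding NH[OF q] w1_w2_def[symmetric] by (simp add: field_simps)
    from this[of E1] this[of E2] have eq: "w1 * b11 + w2 * b12 = 0" "w1 * b12 + w2 * b22 = 0"
      unfolding b21 b11_b12_b22_def[symmetric] .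
    have "(II q E1 E1 + II q E2 E2) \<bullet> \<xi> q = (2 *\<^sub>R H q) \<bullet> \<xi> q"
      unfolding H_frame[OF UV[OF q] fr] by simp
    then have tr: "b11 + b22 = 0"
      unfolding second_fundamental_form_eq inner_add_left N\<xi>[OF q] b11_b12_b22_def[symmetric]
      by (simp add: \<xi>H[OF q])
    define x1 x2 where "x1 = dd r X0 q \<bullet> dd r E1 q" "x2 = dd r X0 q \<bullet> dd r E2 q"
    have "\<omega> X0 q = \<omega> (x1 *\<^sub>R E1 + x2 *\<^sub>R E2) q"
      unfolding x1_x2_def using orthoframe_expand(1)[OF fr, of X0] by simp
    then have "\<omega> X0 q = x1 * w1 + x2 * w2" by (simp only: \<omega>_lin[OF q] w1_w2_def)
    then have "w1 \<noteq> 0 \<or> w2 \<noteq> 0" using \<omega>X0[OF q] by auto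
    then have ww: "w1 * w1 + w2 * w2 \<noteq> 0" by (simp add: sum_squares_eq_zero_iff)
    \<comment> \<open>With \<open>b22 = - b11\<close> the equations are a linear system for
      \<open>b11\<close> and \<open>b12\<close> whose determinant is
      \<open>w1 * w1 + w2 * w2\<close>.\<close>
    have "(w1 * w1 + w2 * w2) * b11 = 0" "(w1 * w1 + w2 * w2) * b12 = 0"
      using eq tr by algebra+
    then have b: "b11 = 0" "b12 = 0" "b22 = 0" using ww tr by auto
    have "bilinear (\<lambda>X Y. dd (dd r Y) X q \<bullet> \<xi> q)"
      unfolding bilinear_def by (intro conjI allI linearI) (simp_all add: r2_lin[OF UV[OF q]] inner_add_left)
    from bilinear_frame[OF fr this, where X=X and Y=Y] show ?thesis
      unfolding b21 b11_b12_b22_def[symmetric] b by simp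
  qed
  have \<xi>Zr: "dd \<xi> Z q \<bullet> dd r X q = 0" "dd r X q \<bullet> dd \<xi> Z q = 0" if q: "q \<in> U" for q X Z
  proof -
    have "dd (\<lambda>q. \<xi> q \<bullet> dd r X q) Z q = dd (\<lambda>q. 0) Z q" by (rule dd_cong[OF openU q]) (rule \<xi>r)
    then show "dd \<xi> Z q \<bullet> dd r X q = 0"
      unfolding dd_inner_smooth[OF openU s\<xi> sr q] using A[OF q, of X Z] by (simp add: inner_commute)
    then show "dd r X q \<bullet> dd \<xi> Z q = 0" by (simp add: inner_commute)
  qed
  have \<xi>ZH: "dd \<xi> Z q \<bullet> H q = - \<omega> Z q" if q: "q \<in> U" for q Z
  proof -
    have "dd (\<lambda>q. \<xi> q \<bullet> H q) Z q = dd (\<lambda>q. 0) Z q" by (rule dd_cong[OF openU q]) (rule \<xi>H)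
    then show ?thesis
      unfolding dd_inner_smooth[OF openU s\<xi> sH q] \<omega>_def by (simp add: inner_commute)
  qed
  define T where "T X Y q = dd (dd r Y) X q \<bullet> H q" for X Y q
  have T_sym: "T X Y q = T Y X q" if "q \<in> U" for X Y q
    unfolding T_def using r2_commute[OF UV[OF that], of Y X] by simp
  have T_lin: "T (X + X') Y q = T X Y q + T X' Y q" "T (a *\<^sub>R X) Y q = a * T X Y q"
     if "q \<in> U" for X X' Y q a
    by (simp_all add: T_def r2_lin[OF UV[OF that]] inner_add_left)
  \<comment> \<open>The \<open>\<xi>\<close>-component of the Codazzi equation: \<open>T\<close> is a multiple of \<open>\<omega> \<otimes> \<omega>\<close>.\<close>
  have T\<omega>: "T X Y q * \<omega> Z q = T Z Y q * \<omega> X q" if q: "q \<in> U" for q X Y Z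
  proof -
    obtain E1 E2 where fr: "orthoframe q E1 E2" using obtain_frame[OF UV[OF q]] .
    have nz: "dd r E1 q \<noteq> 0" "dd r E2 q \<noteq> 0" using orthoframeD[OF fr] by auto
    \<comment> \<open>\<open>dd \<xi> Z q\<close> has no tangential part and the second derivative
      of \<open>r\<close> has no \<open>\<xi>\<close> part, so only the \<open>H\<close> components
      meet.\<close>
    have sw: "dd (dd r Y) X q \<bullet> dd \<xi> Z q = - (T X Y q * \<omega> Z q) / c\<^sup>2" for X Z
    proof -
      note ex = orthogonal_basis_expand4[OF nz H0[OF q] \<xi>0[OF q] orthoframeD(2)[OF fr] Hr(2)[OF q] \<xi>r(2)[OF q]
        Hr(2)[OF q] \<xi>r(2)[OF q] \<xi>H(2)[OF q], of "dd (dd r Y) X q"]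
      show ?thesis using arg_cong[OF ex, of "\<lambda>w. w \<bullet> dd \<xi> Z q"]
        by (simp add: inner_add_left \<xi>Zr[OF q] A[OF q] HH[OF q] T_def inner_commute[of "H q" "dd \<xi> Z q"] \<xi>ZH[OF q])
    qed
    have der: "dd (dd (dd r Y) X) Z q \<bullet> \<xi> q + dd (dd r Y) X q \<bullet> dd \<xi> Z q = 0" for X Z
    proof -
      have "dd (\<lambda>q. dd (dd r Y) X q \<bullet> \<xi> q) Z q = dd (\<lambda>q. 0) Z q" by (rule dd_cong[OF openU q]) (rule A)
      then show ?thesis unfolding dd_inner_smooth[OF openU srr s\<xi> q] by simp
    qed
    have "dd (dd r Y) X q \<bullet> dd \<xi> Z q = dd (dd r Y) Z q \<bullet> dd \<xi> X q"
      using der[of X Z] der[of Z X] r3_commute1[OF UV[OF q], of Y X Z] by simp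
    then show ?thesis unfolding sw using c by simp
  qed
  \<comment> \<open>\<open>k\<close> is the coordinate covector of \<open>\<omega>\<close> turned by
    a right angle, so it spans the kernel of \<open>\<omega>\<close> and depends smoothly on
    \<open>q\<close>. \<open>F\<close> is its image in the ambient space; \<open>E\<close> and
    \<open>\<epsilon>\<close> are the normalized vector and its coordinates.\<close>
  define k where "k q = \<omega> (axis 2 1) q *\<^sub>R axis 1 1 - \<omega> (axis 1 1) q *\<^sub>R (axis 2 1 :: real^2)" for q
  define F where "F q = \<omega> (axis 2 1) q *\<^sub>R dd r (axis 1 1) q - \<omega> (axis 1 1) q *\<^sub>R dd r (axis 2 1) q" for q
  define \<epsilon> where "\<epsilon> q = (1 / norm (F q)) *\<^sub>R k q" for q
  define E where "E q = (1 / norm (F q)) *\<^sub>R F q" for q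
  \<comment> \<open>Gram-Schmidt on \<open>X0\<close> against \<open>E\<close>. The result cannot
    vanish, since \<open>\<omega>\<close> kills \<open>\<epsilon>\<close> but not
    \<open>X0\<close>.\<close>
  define \<tau>' where "\<tau>' q = X0 - (dd r X0 q \<bullet> E q) *\<^sub>R \<epsilon> q" for q
  define G where "G q = dd r X0 q - (dd r X0 q \<bullet> E q) *\<^sub>R E q" for q
  define \<tau> where "\<tau> q = (1 / norm (G q)) *\<^sub>R \<tau>' q" for q
  define t where "t q = (1 / norm (G q)) *\<^sub>R G q" for q
  have r_diff: "dd r (X - Y) q = dd r X q - dd r Y q" and r_scale: "dd r (a *\<^sub>R X) q = a *\<^sub>R dd r X q"
    and \<omega>_diff: "\<omega> (X - Y) q = \<omega> X q - \<omega> Y q"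
    if "q \<in> U" for q X Y a
    using linear_diff[OF linear_dd[OF smooth_r open_V UV[OF that]]] r1_lin(2)[OF UV[OF that]]
      linear_diff[OF linear_dd[OF smooth_H open_V UV[OF that]]]
    by (simp_all add: \<omega>_def inner_diff_left)
  have inj0: "X = 0" if "q \<in> U" "dd r X q = 0" for q X
    using inj_r[OF UV[OF that(1)]] that(2) linear_injective_0[OF linear_L[OF UV[OF that(1)]]]
    by (simp add: dd_def)
  have Fk: "F q = dd r (k q) q" if "q \<in> U" for q
    unfolding F_def k_def by (simp only: r_diff[OF that] r_scale[OF that])
  have \<omega>k: "\<omega> (k q) q = 0" if "q \<in> U" for q
    unfolding k_def by (simp only: \<omega>_diff[OF that] \<omega>_lin[OF that]) simp
  have F0: "F q \<noteq> 0" if q: "q \<in> U" for q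
  proof
    assume "F q = 0"
    then have "k q = 0" using inj0[OF q] Fk[OF q] by simp
    from arg_cong[OF this, of "\<lambda>x. x $ 1"] arg_cong[OF this, of "\<lambda>x. x $ 2"]
    have w0: "\<omega> (axis 2 1) q = 0" "\<omega> (axis 1 1) q = 0" by (simp_all add: k_def axis_def)
    have "\<omega> X0 q = \<omega> (X0 $ 1 *\<^sub>R axis 1 1 + X0 $ 2 *\<^sub>R axis 2 1) q" using real2_expand[of X0] by simp
    then have "\<omega> X0 q = 0" by (simp add: \<omega>_lin[OF q] w0)
    then show False using \<omega>X0[OF q] by simp
  qed
  have E\<epsilon>: "E q = dd r (\<epsilon> q) q" if "q \<in> U" for q
    unfolding E_def \<epsilon>_def r_scale[OF that] Fk[OF that, symmetric] ..
  have EE: "E q \<bullet> E q = 1" if "q \<in> U" for q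
    using F0[OF that] by (simp add: E_def dot_square_norm power2_eq_square)
  have \<omega>\<epsilon>: "\<omega> (\<epsilon> q) q = 0" if "q \<in> U" for q
    unfolding \<epsilon>_def \<omega>_lin[OF that] \<omega>k[OF that] by simp
  have T\<epsilon>: "T (\<epsilon> q) Y q = 0" if q: "q \<in> U" for q Y
    using T\<omega>[OF q, of "\<epsilon> q" Y X0] \<omega>\<epsilon>[OF q] \<omega>X0[OF q] by simp
  have G\<tau>: "G q = dd r (\<tau>' q) q" if "q \<in> U" for q
    unfolding G_def \<tau>'_def r_diff[OF that] r_scale[OF that] E\<epsilon>[OF that, symmetric] ..
  have \<omega>\<tau>': "\<omega> (\<tau>' q) q = \<omega> X0 q" if "q \<in> U" for q
    unfolding \<tau>'_def \<omega>_diff[OF that] \<omega>_lin[OF that] \<omega>\<epsilon>[OF that] by simp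
  have G0: "G q \<noteq> 0" if q: "q \<in> U" for q
  proof
    assume "G q = 0"
    then have "\<tau>' q = 0" using inj0[OF q] G\<tau>[OF q] by simp
    moreover have "\<omega> 0 q = 0" using \<omega>_lin(2)[OF q, of 0 0] by simp
    ultimately show False using \<omega>\<tau>'[OF q] \<omega>X0[OF q] by simp
  qed
  have t\<tau>: "t q = dd r (\<tau> q) q" if "q \<in> U" for q
    unfolding t_def \<tau>_def r_scale[OF that] G\<tau>[OF that, symmetric] ..
  have tt: "t q \<bullet> t q = 1" if "q \<in> U" for q
    using G0[OF that] by (simp add: t_def dot_square_norm power2_eq_square)
  have tE: "t q \<bullet> E q = 0" "E q \<bullet> t q = 0" if "q \<in> U" for q
    using EE[OF that] by (simp_all add: t_def G_def inner_diff_left inner_diff_right inner_commute)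
  have tH: "t q \<bullet> H q = 0" "E q \<bullet> H q = 0" and t\<xi>: "t q \<bullet> \<xi> q = 0" "E q \<bullet> \<xi> q = 0" if "q \<in> U" for q
    unfolding t\<tau>[OF that] E\<epsilon>[OF that] by (rule Hr[OF that] \<xi>r[OF that])+
  have tE0: "t q \<noteq> 0" "E q \<noteq> 0" if "q \<in> U" for q using tt[OF that] EE[OF that] by auto
  have expand: "w = (w \<bullet> t q) *\<^sub>R t q + (w \<bullet> E q) *\<^sub>R E q + (w \<bullet> H q / c\<^sup>2) *\<^sub>R H q + (w \<bullet> \<xi> q / (\<xi> q \<bullet> \<xi> q)) *\<^sub>R \<xi> q"
    if q: "q \<in> U" for q w
    using orthogonal_basis_expand4[OF tE0[OF q] H0[OF q] \<xi>0[OF q] tE(1)[OF q] tH(1)[OF q] t\<xi>(1)[OF q]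
      tH(2)[OF q] t\<xi>(2)[OF q] \<xi>H(2)[OF q], of w] unfolding tt[OF q] EE[OF q] HH[OF q] div_by_1 .
  have r_expand: "dd r Z q = (dd r Z q \<bullet> t q) *\<^sub>R t q + (dd r Z q \<bullet> E q) *\<^sub>R E q" if q: "q \<in> U" for q Z
    using expand[OF q, of "dd r Z q"] Hr(2)[OF q, of Z] \<xi>r(2)[OF q, of Z] by simp
  have X_expand: "Z = (dd r Z q \<bullet> t q) *\<^sub>R \<tau> q + (dd r Z q \<bullet> E q) *\<^sub>R \<epsilon> q" if q: "q \<in> U" for q Z
  proof -
    have "dd r ((dd r Z q \<bullet> t q) *\<^sub>R \<tau> q + (dd r Z q \<bullet> E q) *\<^sub>R \<epsilon> q) q = dd r Z q"
      unfolding r1_lin(1)[OF UV[OF q]] r_scale[OF q] t\<tau>[OF q, symmetric] E\<epsilon>[OF q, symmetric]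
      using r_expand[OF q, of Z] by simp
    then have "dd r (Z - ((dd r Z q \<bullet> t q) *\<^sub>R \<tau> q + (dd r Z q \<bullet> E q) *\<^sub>R \<epsilon> q)) q = 0"
      unfolding r_diff[OF q] by simp
    from inj0[OF q this] show ?thesis by simp
  qed
  have fr: "orthoframe q (\<tau> q) (\<epsilon> q)" if q: "q \<in> U" for q
  proof (rule frameI)
    show "linear (frechet_derivative r (at q))" by (rule linear_L[OF UV[OF q]])
    show "\<exists>a b. Z = a *\<^sub>R \<tau> q + b *\<^sub>R \<epsilon> q" for Z using X_expand[OF q, of Z] by blast
  qed (simp_all only: dd_fold t\<tau>[OF q, symmetric] E\<epsilon>[OF q, symmetric] tt[OF q] tE[OF q] EE[OF q])
  define \<alpha> where "\<alpha> Z q = t q \<bullet> dd r Z q" for Z q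
  define \<beta> where "\<beta> Z q = E q \<bullet> dd r Z q" for Z q
  have Z\<alpha>\<beta>: "Z = \<alpha> Z q *\<^sub>R \<tau> q + \<beta> Z q *\<^sub>R \<epsilon> q" if "q \<in> U" for q Z
    unfolding \<alpha>_def \<beta>_def using X_expand[OF that, of Z] by (simp only: inner_commute[of "dd r Z q"])
  \<comment> \<open>The trace of A_H is 2 c^2 and the direction \<open>\<epsilon>\<close>
    contributes nothing, so all of it falls on \<open>\<tau>\<close>.\<close>
  have T\<tau>\<tau>: "T (\<tau> q) (\<tau> q) q = 2 * c\<^sup>2" if q: "q \<in> U" for q
  proof -
    have "(II q (\<tau> q) (\<tau> q) + II q (\<epsilon> q) (\<epsilon> q)) \<bullet> H q = (2 *\<^sub>R H q) \<bullet> H q"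
      unfolding H_frame[OF UV[OF q] fr[OF q]] by simp
    then have "T (\<tau> q) (\<tau> q) q + T (\<epsilon> q) (\<epsilon> q) q = 2 * c\<^sup>2"
      unfolding inner_add_left II_inner_H[OF UV[OF q]] T_def by (simp add: HH[OF q])
    then show ?thesis by (simp add: T\<epsilon>[OF q])
  qed
  have T\<tau>: "T Z (\<tau> q) q = 2 * c\<^sup>2 * \<alpha> Z q" if q: "q \<in> U" for q Z
  proof -
    have "T Z (\<tau> q) q = T (\<alpha> Z q *\<^sub>R \<tau> q + \<beta> Z q *\<^sub>R \<epsilon> q) (\<tau> q) q" using Z\<alpha>\<beta>[OF q, of Z] by simp
    also have "\<dots> = 2 * c\<^sup>2 * \<alpha> Z q" by (simp add: T_lin[OF q] T\<tau>\<tau>[OF q] T\<epsilon>[OF q])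
    finally show ?thesis .
  qed
  have tHZ: "t q \<bullet> dd H Z q = - (2 * c\<^sup>2 * \<alpha> Z q)" if q: "q \<in> U" for q Z
    using dd_H_tangent[OF UV[OF q], of Z "\<tau> q"] T\<tau>[OF q, of Z] t\<tau>[OF q]
    by (simp add: T_def inner_commute)
  have EHZ: "E q \<bullet> dd H Z q = 0" if q: "q \<in> U" for q Z
    using dd_H_tangent[OF UV[OF q], of Z "\<epsilon> q"] T_sym[OF q, of Z "\<epsilon> q"] T\<epsilon>[OF q, of Z] E\<epsilon>[OF q]
    by (simp add: T_def inner_commute)
  have s\<omega>: "smooth_on U (\<omega> Z)" for Z
    unfolding \<omega>_def[abs_def] by (intro smooth_on_inner openU sHd s\<xi>)
  have sF: "smooth_on U F"
    unfolding F_def[abs_def] by (intro smooth_on_diff smooth_on_scaleR openU s\<omega> sr)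
  have sE: "smooth_on U E"
    unfolding E_def[abs_def]
    by (intro smooth_on_scaleR smooth_on_divide smooth_on_const smooth_on_norm openU sF F0) (simp_all add: F0)
  have sG: "smooth_on U G"
    unfolding G_def[abs_def] by (intro smooth_on_diff smooth_on_scaleR smooth_on_inner openU sr sE)
  have st: "smooth_on U t"
    unfolding t_def[abs_def]
    by (intro smooth_on_scaleR smooth_on_divide smooth_on_const smooth_on_norm openU sG G0) (simp_all add: G0)
  have ip: "f q \<bullet> dd g Z q + dd f Z q \<bullet> g q = 0"
    if "smooth_on U f" "smooth_on U g" "q \<in> U" "\<And>q. q \<in> U \<Longrightarrow> f q \<bullet> g q = a"
    for f g :: "real^2 \<Rightarrow> real^4" and Z q a
  proof -
    have "dd (\<lambda>q. f q \<bullet> g q) Z q = dd (\<lambda>q. a) Z q" by (rule dd_cong[OF openU that(3,4)])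
    then show ?thesis unfolding dd_inner_smooth[OF openU that(1-3)] by simp
  qed
  \<comment> \<open>The connection form of the orthonormal tangent frame \<open>t\<close>,
    \<open>E\<close>.\<close>
  define \<theta> where "\<theta> Z q = dd t Z q \<bullet> E q" for Z q
  have EZ: "dd E Z q \<bullet> E q = 0" "dd E Z q \<bullet> H q = 0" "dd E Z q \<bullet> \<xi> q = 0" "dd E Z q \<bullet> t q = - \<theta> Z q"
    if q: "q \<in> U" for q Z
    using ip[OF sE sE q EE, of Z] ip[OF sE sH q tH(2), of Z] ip[OF sE s\<xi> q t\<xi>(2), of Z] ip[OF sE st q tE(2), of Z]
      EHZ[OF q, of Z] \<xi>Zr(2)[OF q, of "\<epsilon> q" Z] E\<epsilon>[OF q]
    by (simp_all add: \<theta>_def inner_commute)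
  have tZ: "dd t Z q \<bullet> t q = 0" "dd t Z q \<bullet> H q = 2 * c\<^sup>2 * \<alpha> Z q" "dd t Z q \<bullet> \<xi> q = 0"
    if q: "q \<in> U" for q Z
    using ip[OF st st q tt, of Z] ip[OF st sH q tH(1), of Z] ip[OF st s\<xi> q t\<xi>(1), of Z]
      tHZ[OF q, of Z] \<xi>Zr(2)[OF q, of "\<tau> q" Z] t\<tau>[OF q]
    by (simp_all add: inner_commute)
  have E_Z: "dd E Z q = - \<theta> Z q *\<^sub>R t q" if q: "q \<in> U" for q Z
    using expand[OF q, of "dd E Z q"] unfolding EZ[OF q] by simp
  have t_Z: "dd t Z q = \<theta> Z q *\<^sub>R E q + (2 * \<alpha> Z q) *\<^sub>R H q" if q: "q \<in> U" for q Z
    using expand[OF q, of "dd t Z q"] c unfolding tZ[OF q] \<theta>_def[symmetric] by simp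
  \<comment> \<open>Symmetry of the second derivatives of \<open>E\<close> and of \<open>t\<close>, paired with \<open>H\<close>, forces the connection
    form \<open>\<theta>\<close> to be a multiple of both \<open>\<alpha>\<close> and \<open>\<beta>\<close>.\<close>
  have \<theta>\<alpha>: "\<theta> Z q * \<alpha> W q = \<theta> W q * \<alpha> Z q" if q: "q \<in> U" for q Z W
  proof -
    have *: "dd (dd E Z) W q \<bullet> H q = - (2 * c\<^sup>2) * (\<theta> Z q * \<alpha> W q)" for Z W
      using ip[OF smooth_on_dd[OF openU sE, of Z] sH q EZ(2), of W]
      by (simp add: E_Z[OF q, of Z] tHZ[OF q] algebra_simps)
    show ?thesis using *[of Z W] *[of W Z] dd_commute[OF openU sE q, of Z W] c by simp
  qed
  have \<theta>\<beta>: "\<theta> W q * \<beta> Z q = \<theta> Z q * \<beta> W q" if q: "q \<in> U" for q Z W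
  proof -
    have d\<alpha>: "dd (\<alpha> Z) W q = t q \<bullet> dd (dd r Z) W q + \<theta> W q * \<beta> Z q" for Z W
      unfolding \<alpha>_def[abs_def] dd_inner_smooth[OF openU st sr q]
      by (simp add: t_Z[OF q] inner_add_left \<beta>_def Hr[OF q])
    have *: "dd (dd t Z) W q \<bullet> H q = 2 * c\<^sup>2 * dd (\<alpha> Z) W q" for Z W
    proof -
      have s\<alpha>: "smooth_on U (\<alpha> Z)" unfolding \<alpha>_def[abs_def] by (intro smooth_on_inner openU st sr)
      have "dd (\<lambda>q. dd t Z q \<bullet> H q) W q = dd (\<lambda>q. (2 * c\<^sup>2) * \<alpha> Z q + 0 * \<alpha> Z q) W q"
        by (rule dd_cong[OF openU q]) (simp add: tZ)
      also have "\<dots> = (2 * c\<^sup>2) * dd (\<alpha> Z) W q + 0 * dd (\<alpha> Z) W q"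
        by (intro dd_cmult_add smooth_on_differentiable[OF s\<alpha> openU q])
      finally show ?thesis
        unfolding dd_inner_smooth[OF openU smooth_on_dd[OF openU st] sH q]
        by (simp add: t_Z[OF q, of Z] inner_add_left EHZ[OF q] HHZ[OF q])
    qed
    have "dd (\<alpha> Z) W q = dd (\<alpha> W) Z q"
      using *[of Z W] *[of W Z] dd_commute[OF openU st q, of Z W] c by simp
    then show ?thesis using r2_commute[OF UV[OF q], of Z W] unfolding d\<alpha> by simp
  qed
  have \<alpha>\<beta>: "\<alpha> (\<tau> q) q = 1" "\<beta> (\<tau> q) q = 0" "\<beta> (\<epsilon> q) q = 1" if q: "q \<in> U" for q
    unfolding \<alpha>_def \<beta>_def t\<tau>[OF q, symmetric] E\<epsilon>[OF q, symmetric] by (rule tt[OF q] tE[OF q] EE[OF q])+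
  \<comment> \<open>\<open>\<alpha>\<close> and \<open>\<beta>\<close> form a coframe, and a form
    proportional to both of its members is zero; evaluation at \<open>\<tau>\<close> and
    \<open>\<epsilon>\<close> shows it.\<close>
  have \<theta>0: "\<theta> Z q = 0" if q: "q \<in> U" for q Z
  proof -
    have "\<theta> (\<tau> q) q = 0" using \<theta>\<beta>[OF q, of "\<tau> q" "\<epsilon> q"] by (simp add: \<alpha>\<beta>[OF q])
    then show ?thesis using \<theta>\<alpha>[OF q, of Z "\<tau> q"] by (simp add: \<alpha>\<beta>[OF q])
  qed
  obtain e where e: "E q = e" if "q \<in> U" for q
  proof -
    have "(E has_derivative (\<lambda>h. 0)) (at x within U)" if "x \<in> U" for x
      using smooth_on_has_derivative[OF sE openU that] unfolding E_Z[OF that] \<theta>0[OF that]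
      by (auto intro: has_derivative_at_withinI)
    from has_derivative_zero_constant[OF _ this] have "\<exists>c. \<forall>x\<in>U. E x = c" by (auto simp: U_def)
    then show ?thesis using that by blast
  qed
  show ?thesis
  proof (rule that[of d t e])
    show "d > 0" "ball q0 d \<subseteq> V" using d by blast+
    show "smooth_on (ball q0 d) t" using st by (simp add: U_def)
    show "norm e = 1" using EE[OF q0U] unfolding e[OF q0U] by (simp add: norm_eq_1)
    fix q assume "q \<in> ball q0 d" then have q: "q \<in> U" by (simp add: U_def)
    show "norm (t q) = 1" using tt[OF q] by (simp add: norm_eq_1)
    show "t q \<bullet> e = 0" "H q \<bullet> e = 0" "t q \<bullet> H q = 0"
      using tE(1)[OF q] tH[OF q] unfolding e[OF q] by (simp_all add: inner_commute)
    fix Z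
    show "dd r Z q = (t q \<bullet> dd r Z q) *\<^sub>R t q + (e \<bullet> dd r Z q) *\<^sub>R e"
      using r_expand[OF q, of Z] unfolding e[OF q] inner_commute[of "dd r Z q"] .
    show "dd t Z q = (2 * (t q \<bullet> dd r Z q)) *\<^sub>R H q"
      using t_Z[OF q, of Z] by (simp add: \<theta>0[OF q] \<alpha>_def)
    \<comment> \<open>\<open>\<omega>\<close> kills \<open>\<epsilon>\<close> and is thus a multiple
      of \<open>\<alpha>\<close>; the factor is nonzero because \<open>\<omega> X0 q\<close>
      is.\<close>
    have \<omega>Z: "\<omega> Z q = \<alpha> Z q * \<omega> (\<tau> q) q" for Z
      using arg_cong[OF Z\<alpha>\<beta>[OF q, of Z], of "\<lambda>Z. \<omega> Z q"]
      unfolding \<omega>_lin[OF q] \<omega>\<epsilon>[OF q] by simp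
    assume "t q \<bullet> dd r Z q \<noteq> 0"
    then have "\<omega> Z q \<noteq> 0" using \<omega>Z[of Z] \<omega>Z[of X0] \<omega>X0[OF q] by (simp add: \<alpha>_def)
    then show "N q (dd H Z q) \<noteq> 0" using N\<xi>[OF q, of "dd H Z q"] by (auto simp: \<omega>_def)
  qed
qed

end

section \<open>Potentials and local inverses\<close>

text \<open>The Poincare lemma on a ball: \<open>u\<close> integrates \<open>A\<close> along the
  segment from the centre. By symmetry the gradient of the integrand is \<open>W x t\<close>, which
  is the derivative of \<open>t *\<^sub>R A (p x t)\<close> in \<open>t\<close> and integrates to
  \<open>A x\<close>.\<close>

lemma gradient_potential:
  fixes A :: "'a::euclidean_space \<Rightarrow> 'a"
  assumes A: "smooth_on (ball x0 d) A"
    and sym: "\<And>x v w. x \<in> ball x0 d \<Longrightarrow> dd A v x \<bullet> w = dd A w x \<bullet> v"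
  obtains u where "\<And>x. x \<in> ball x0 d \<Longrightarrow> (u has_derivative (\<lambda>h. A x \<bullet> h)) (at x)"
proof -
  define p where "p x t = x0 + t *\<^sub>R (x - x0)" for x and t :: real
  define W where "W x t = t *\<^sub>R dd A (x - x0) (p x t) + A (p x t)" for x t
  have p_in: "p x t \<in> ball x0 d" if "x \<in> ball x0 d" "t \<in> cbox 0 1" for x t
  proof -
    have "dist x0 (p x t) = \<bar>t\<bar> * norm (x - x0)" by (simp add: p_def dist_norm)
    also have "\<dots> \<le> 1 * norm (x - x0)" using that(2) by (intro mult_right_mono) auto
    also have "\<dots> < d" using that(1) by (simp add: dist_norm norm_minus_commute)
    finally show ?thesis by simp
  qed
  have lin: "dd A (t *\<^sub>R h) y = t *\<^sub>R dd A h y" if "y \<in> ball x0 d" for t h y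
    by (rule linear_scale[OF linear_dd[OF A open_ball that]])
  have derA: "(A has_derivative (\<lambda>v. dd A v y)) (at y)" if "y \<in> ball x0 d" for y
    by (rule smooth_on_has_derivative[OF A open_ball that])
  define u where "u x = integral (cbox 0 1) (\<lambda>t. A (p x t) \<bullet> (x - x0))" for x
  have contA: "continuous_on (ball x0 d) A" "\<And>v. continuous_on (ball x0 d) (dd A v)"
    by (intro smooth_on_continuous A smooth_on_dd open_ball)+
  have "(u has_derivative (\<lambda>h. A x \<bullet> h)) (at x)" if x: "x \<in> ball x0 d" for x
  proof -
    have "((\<lambda>x. A (p x t) \<bullet> (x - x0)) has_derivative blinfun_apply (blinfun_inner_right (W x t))) (at x within ball x0 d)"
      if x: "x \<in> ball x0 d" and t: "t \<in> cbox 0 1" for x t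
    proof -
      have dp: "((\<lambda>x. p x t) has_derivative (\<lambda>h. t *\<^sub>R h)) (at x)"
        unfolding p_def by (auto intro!: derivative_eq_intros)
      have dAp: "((\<lambda>x. A (p x t)) has_derivative (\<lambda>h. dd A (t *\<^sub>R h) (p x t))) (at x)"
        by (rule has_derivative_compose[OF dp derA[OF p_in[OF x t]]])
      have dx: "((\<lambda>x. x - x0) has_derivative (\<lambda>h. h)) (at x)" by (auto intro!: derivative_eq_intros)
      have "((\<lambda>x. A (p x t) \<bullet> (x - x0)) has_derivative
          (\<lambda>h. A (p x t) \<bullet> h + dd A (t *\<^sub>R h) (p x t) \<bullet> (x - x0))) (at x)"
        by (rule has_derivative_inner[OF dAp dx])
      moreover have "A (p x t) \<bullet> h + dd A (t *\<^sub>R h) (p x t) \<bullet> (x - x0) = W x t \<bullet> h" for h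
        unfolding W_def lin[OF p_in[OF x t]]
        using sym[OF p_in[OF x t], of h "x - x0"] by (simp add: inner_add_left)
      ultimately show ?thesis by (simp add: has_derivative_at_withinI)
    qed
    moreover have contW: "continuous_on (ball x0 d \<times> cbox 0 1) (\<lambda>z. W (fst z) (snd z))"
    proof -
      have cp: "continuous_on (ball x0 d \<times> cbox 0 1) (\<lambda>z. p (fst z) (snd z))"
        unfolding p_def by (intro continuous_intros)
      have cc: "continuous_on (ball x0 d \<times> cbox 0 1) (\<lambda>z. f (p (fst z) (snd z)))"
        if "continuous_on (ball x0 d) f" for f :: "'a \<Rightarrow> 'a"
        by (rule continuous_on_compose2[OF that cp]) (auto intro!: p_in simp del: mem_ball)
      \<comment> \<open>Continuity of \<open>dd A b\<close> is known for fixed \<open>b\<close>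
        only, while here the direction moves with the point; hence the expansion in
        \<open>Basis\<close>.\<close>
      have eq: "(\<Sum>b\<in>Basis. ((fst z - x0) \<bullet> b) *\<^sub>R dd A b (p (fst z) (snd z))) = dd A (fst z - x0) (p (fst z) (snd z))"
        if z: "z \<in> ball x0 d \<times> cbox 0 1" for z
      proof -
        have "p (fst z) (snd z) \<in> ball x0 d" using z by (intro p_in) auto
        note L = linear_dd[OF A open_ball this]
        have "dd A (\<Sum>b\<in>Basis. ((fst z - x0) \<bullet> b) *\<^sub>R b) (p (fst z) (snd z))
          = (\<Sum>b\<in>Basis. ((fst z - x0) \<bullet> b) *\<^sub>R dd A b (p (fst z) (snd z)))"
          unfolding linear_sum[OF L] linear_scale[OF L] ..
        then show ?thesis by (simp only: euclidean_representation)
      qed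
      have "continuous_on (ball x0 d \<times> cbox 0 1) (\<lambda>z. \<Sum>b\<in>Basis. ((fst z - x0) \<bullet> b) *\<^sub>R dd A b (p (fst z) (snd z)))"
        by (intro continuous_on_sum continuous_on_scaleR continuous_on_inner continuous_on_diff
            continuous_on_fst continuous_on_id continuous_on_const cc contA)
      then have "continuous_on (ball x0 d \<times> cbox 0 1) (\<lambda>z. dd A (fst z - x0) (p (fst z) (snd z)))"
        by (rule continuous_on_eq) (rule eq)
      then show ?thesis unfolding W_def
        by (intro continuous_on_add continuous_on_scaleR continuous_on_snd continuous_on_id cc contA)
    qed
    moreover have "(\<lambda>t. A (p x t) \<bullet> (x - x0)) integrable_on cbox 0 1" if x: "x \<in> ball x0 d" for x
    proof (rule integrable_continuous)
      have "continuous_on (cbox 0 1) (\<lambda>t. p x t)" unfolding p_def by (intro continuous_intros)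
      then have "continuous_on (cbox 0 1) (\<lambda>t. A (p x t))"
        by (rule continuous_on_compose2[OF contA(1)]) (auto intro!: p_in x simp del: mem_ball)
      then show "continuous_on (cbox 0 1) (\<lambda>t. A (p x t) \<bullet> (x - x0))" by (intro continuous_intros)
    qed
    moreover have "continuous_on (ball x0 d \<times> cbox 0 1) (\<lambda>(x, t). blinfun_inner_right (W x t))"
      unfolding split_beta by (intro bounded_linear.continuous_on[OF bounded_linear_blinfun_inner_right] contW)
    ultimately have "(u has_derivative blinfun_apply (integral (cbox 0 1) (\<lambda>t. blinfun_inner_right (W x t)))) (at x within ball x0 d)"
      unfolding u_def[abs_def] by (intro leibniz_rule[where U="ball x0 d"] x convex_ball)
    moreover have "((\<lambda>t. W x t) has_integral (1 *\<^sub>R A (p x 1) - 0 *\<^sub>R A (p x 0))) {0..1}"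
    proof (rule fundamental_theorem_of_calculus)
      fix t :: real assume "t \<in> {0..1}"
      then have t: "t \<in> cbox 0 1" by simp
      have "((\<lambda>t. p x t) has_derivative (\<lambda>h. h *\<^sub>R (x - x0))) (at t)"
        unfolding p_def by (auto intro!: derivative_eq_intros)
      then have "((\<lambda>t. A (p x t)) has_derivative (\<lambda>h. dd A (h *\<^sub>R (x - x0)) (p x t))) (at t)"
        using derA[OF p_in[OF x t]] by (rule has_derivative_compose)
      then have "((\<lambda>t. A (p x t)) has_vector_derivative dd A (x - x0) (p x t)) (at t)"
        unfolding has_vector_derivative_def lin[OF p_in[OF x t]] .
      from has_vector_derivative_scaleR[OF DERIV_ident this]
      have "((\<lambda>t. t *\<^sub>R A (p x t)) has_vector_derivative W x t) (at t)"
        unfolding W_def by simp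
      then show "((\<lambda>t. t *\<^sub>R A (p x t)) has_vector_derivative W x t) (at t within {0..1})"
        by (rule has_vector_derivative_at_within)
    qed simp
    then have "((\<lambda>t. W x t) has_integral A x) (cbox 0 1)" by (simp add: p_def)
    then have "((\<lambda>t. blinfun_inner_right (W x t)) has_integral blinfun_inner_right (A x)) (cbox 0 1)"
      using has_integral_linear[OF _ bounded_linear_blinfun_inner_right] by (simp add: o_def)
    then have "integral (cbox 0 1) (\<lambda>t. blinfun_inner_right (W x t)) = blinfun_inner_right (A x)"
      by (rule integral_unique)
    ultimately show ?thesis using x by (simp add: at_within_open[OF _ open_ball])
  qed
  then show ?thesis by (rule that)
qed

text \<open>\<open>B w\<close> is the vector field that \<open>f\<close> maps to the constant field \<open>w\<close>.\<close>

lemma smooth_local_inverse: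
  fixes f :: "'a::euclidean_space \<Rightarrow> 'a"
  assumes U: "open U" "x0 \<in> U" and f: "smooth_on U f" and B: "\<And>w. smooth_on U (B w)"
    and fB: "\<And>x w. x \<in> U \<Longrightarrow> dd f (B w x) x = w"
    and Bf: "\<And>x v. x \<in> U \<Longrightarrow> B (dd f v x) x = v"
  obtains U' V g where "open U'" "U' \<subseteq> U" "x0 \<in> U'" "open V" "f x0 \<in> V" "homeomorphism U' V f g"
    "smooth_on V g" "\<And>y. y \<in> V \<Longrightarrow> (g has_derivative (\<lambda>w. B w (g y))) (at y)"
proof -
  define f' where "f' x = Blinfun (\<lambda>v. dd f v x)" for x
  have der: "(f has_derivative (\<lambda>v. dd f v x)) (at x)" if "x \<in> U" for x
    by (rule smooth_on_has_derivative[OF f U(1) that])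
  have f': "blinfun_apply (f' x) = (\<lambda>v. dd f v x)" if "x \<in> U" for x
    unfolding f'_def by (rule bounded_linear_Blinfun_apply[OF has_derivative_bounded_linear[OF der[OF that]]])
  have derf: "\<And>x. x \<in> U \<Longrightarrow> (f has_derivative blinfun_apply (f' x)) (at x)"
    by (simp only: f' der)
  have contf: "continuous_on U f'"
  proof (rule continuous_on_blinfun_componentwise)
    fix i :: 'a
    have "continuous_on U (dd f i)" by (intro smooth_on_continuous smooth_on_dd U f)
    then show "continuous_on U (\<lambda>x. blinfun_apply (f' x) i)"
      by (rule continuous_on_eq) (simp add: f')
  qed
  have linB: "linear (\<lambda>w. B w x)" if "x \<in> U" for x
  proof -
    note L = linear_dd[OF f U(1) that]
    show ?thesis
    proof (rule linearI)
      fix a b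
      have "dd f (B a x + B b x) x = a + b" by (simp only: linear_add[OF L] fB[OF that])
      then show "B (a + b) x = B a x + B b x" using Bf[OF that, of "B a x + B b x"] by simp
    next
      fix c a
      have "dd f (c *\<^sub>R B a x) x = c *\<^sub>R a" by (simp only: linear_scale[OF L] fB[OF that])
      then show "B (c *\<^sub>R a) x = c *\<^sub>R B a x" using Bf[OF that, of "c *\<^sub>R B a x"] by simp
    qed
  qed
  define invf where "invf = Blinfun (\<lambda>w. B w x0)"
  have invf: "blinfun_apply invf = (\<lambda>w. B w x0)"
    unfolding invf_def by (rule bounded_linear_Blinfun_apply) (simp add: linear_linear linB[OF U(2)])
  have "invf o\<^sub>L f' x0 = id_blinfun"
    by (rule blinfun_eqI) (simp add: invf f'[OF U(2)] Bf[OF U(2)])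
  from inverse_function_theorem[OF U(1) derf contf U(2) this]
  obtain U' V g g' where *: "open U'" "U' \<subseteq> U" "x0 \<in> U'" "open V" "f x0 \<in> V" "homeomorphism U' V f g"
    and g: "\<And>y. y \<in> V \<Longrightarrow> (g has_derivative (g' y)) (at y)"
    and g': "\<And>y. y \<in> V \<Longrightarrow> g' y = inv (blinfun_apply (f' (g y)))"
    by metis
  have gU: "g y \<in> U" if "y \<in> V" for y
    using *(2,6) that unfolding homeomorphism_def by blast
  have gder: "(g has_derivative (\<lambda>w. B w (g y))) (at y)" if y: "y \<in> V" for y
  proof -
    have "inv (\<lambda>v. dd f v (g y)) = (\<lambda>w. B w (g y))"
      by (rule inv_equality) (simp_all add: fB Bf gU[OF y])
    then show ?thesis using g[OF y] unfolding g'[OF y] f'[OF gU[OF y]] by simp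
  qed
  \<comment> \<open>The derivative of \<open>g\<close> is \<open>B w\<close> composed with
    \<open>g\<close>, so smoothness bootstraps from mere continuity.\<close>
  have "Ck_on k V g" for k
  proof (induction k)
    case 0
    show ?case using *(6) by (simp add: homeomorphism_def)
  next
    case (Suc k)
    have "Ck_on k V (\<lambda>y. B w (g y))" for w
      by (rule Ck_on_compose[OF *(4) U(1) gU Suc]) (use B in \<open>simp_all add: smooth_on_def\<close>)
    show ?case by (rule Ck_on_SucI[OF *(4), where f'="\<lambda>y w. B w (g y)"], erule gder, fact)
  qed
  then have "smooth_on V g" by (simp add: smooth_on_def)
  then show ?thesis using * gder by (intro that)
qed

text \<open>Meant for the coordinate map built from the potential, which is known only through its
  derivative.\<close>

lemma smooth_on_primitive:
  assumes "open S" "\<And>x. x \<in> S \<Longrightarrow> (f has_derivative f' x) (at x)" "\<And>v. smooth_on S (\<lambda>x. f' x v)"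
  shows "smooth_on S f"
proof -
  have "Ck_on k S f" for k
  proof (cases k)
    case 0
    have "continuous_on S f"
      using assms(2) by (intro continuous_at_imp_continuous_on ballI has_derivative_continuous)
    then show ?thesis by (simp add: 0)
  next
    case (Suc k')
    have "Ck_on k' S (\<lambda>x. f' x v)" for v using assms(3)[of v] by (simp add: smooth_on_def)
    show ?thesis unfolding Suc by (rule Ck_on_SucI[OF assms(1), where f'=f'], erule assms(2), fact)
  qed
  then show ?thesis by (simp add: smooth_on_def)
qed

lemma open_rectangle: "open I \<Longrightarrow> open J \<Longrightarrow> open (rectangle I J)"
proof -
  assume IJ: "open I" "open J"
  have "rectangle I J = (\<lambda>q. q $ 1) -` I \<inter> (\<lambda>q. q $ 2) -` J" by (auto simp: rectangle_def)
  then show ?thesis using IJ by (auto intro!: open_Int open_vimage continuous_intros)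
qed

lemma rectangle_in_open:
  assumes "open W" "(p :: real^2) \<in> W"
  obtains h where "h > 0" "rectangle {p $ 1 - h<..<p $ 1 + h} {p $ 2 - h<..<p $ 2 + h} \<subseteq> W"
proof -
  obtain d where d: "d > 0" "ball p d \<subseteq> W" using assms open_contains_ball by blast
  have "rectangle {p $ 1 - d/2<..<p $ 1 + d/2} {p $ 2 - d/2<..<p $ 2 + d/2} \<subseteq> ball p d"
  proof
    fix x assume x: "x \<in> rectangle {p $ 1 - d/2<..<p $ 1 + d/2} {p $ 2 - d/2<..<p $ 2 + d/2}"
    have "dist p x \<le> \<bar>(p - x) $ 1\<bar> + \<bar>(p - x) $ 2\<bar>"
      using norm_le_l1_cart[of "p - x"] by (simp add: dist_norm sum_2)
    also have "\<dots> < d" using x by (simp add: rectangle_def abs_if)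
    finally show "x \<in> ball p d" by simp
  qed
  then show ?thesis using d by (intro that[of "d/2"]) auto
qed

section \<open>Curvature and torsion\<close>

lemma frenet_quantities:
  assumes I: "open I" "s \<in> I"
    and T: "\<And>s. s \<in> I \<Longrightarrow> (\<gamma> has_vector_derivative T s) (at s)"
    and K: "\<And>s. s \<in> I \<Longrightarrow> (T has_vector_derivative K s) (at s)"
  shows "unit_tangent \<gamma> s = T s" "vector_derivative (unit_tangent \<gamma>) (at s) = K s" "curvature \<gamma> s = norm (K s)"
proof -
  have u: "unit_tangent \<gamma> x = T x" if "x \<in> I" for x
    unfolding unit_tangent_def by (rule vector_derivative_at[OF T[OF that]])
  show "unit_tangent \<gamma> s = T s" by (rule u[OF I(2)])
  have "(unit_tangent \<gamma> has_vector_derivative K s) (at s)"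
    by (rule has_vector_derivative_transform_within_open[OF K[OF I(2)] I]) (rule u[symmetric])
  then show k: "vector_derivative (unit_tangent \<gamma>) (at s) = K s" by (rule vector_derivative_at)
  show "curvature \<gamma> s = norm (K s)" unfolding curvature_def k ..
qed

text \<open>The classical formula det(\<gamma>', \<gamma>'', \<gamma>''') / k^2. For constant
  \<open>k\<close> the principal normal is a constant multiple of \<open>K\<close>, and the term
  \<open>cross3 (K s) (K s)\<close> drops out of the derivative of the binormal.\<close>

lemma torsion_eq:
  assumes I: "open I" "s \<in> I"
    and T: "\<And>s. s \<in> I \<Longrightarrow> (\<gamma> has_vector_derivative T s) (at s)"
    and K: "\<And>s. s \<in> I \<Longrightarrow> (T has_vector_derivative K s) (at s)"
    and L: "\<And>s. s \<in> I \<Longrightarrow> (K has_vector_derivative L s) (at s)"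
    and k: "\<And>s. s \<in> I \<Longrightarrow> norm (K s) = k"
  shows "torsion \<gamma> s = (cross3 (T s) (K s) \<bullet> L s) / k\<^sup>2"
proof -
  have fq: "unit_tangent \<gamma> x = T x" "vector_derivative (unit_tangent \<gamma>) (at x) = K x" "curvature \<gamma> x = norm (K x)"
    if "x \<in> I" for x
    by (rule frenet_quantities(1)[OF I(1) that T K] frenet_quantities(2)[OF I(1) that T K]
      frenet_quantities(3)[OF I(1) that T K]; assumption)+
  have n: "principal_normal \<gamma> x = (1/k) *\<^sub>R K x" if "x \<in> I" for x
    unfolding principal_normal_def fq(2)[OF that] fq(3)[OF that] k[OF that] ..
  have b: "binormal \<gamma> x = cross3 (T x) ((1/k) *\<^sub>R K x)" if "x \<in> I" for x
    unfolding binormal_def fq(1)[OF that] n[OF that] ..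
  have bb: "bounded_bilinear cross3" using bilinear_cross by (simp add: bilinear_conv_bounded_bilinear)
  have K': "((\<lambda>x. (1/k) *\<^sub>R K x) has_vector_derivative (1/k) *\<^sub>R L s) (at s)"
    by (rule bounded_linear.has_vector_derivative[OF bounded_linear_scaleR_right L[OF I(2)]])
  have "((\<lambda>x. cross3 (T x) ((1/k) *\<^sub>R K x)) has_vector_derivative
      (cross3 (T s) ((1/k) *\<^sub>R L s) + cross3 (K s) ((1/k) *\<^sub>R K s))) (at s)"
    by (rule bounded_bilinear.has_vector_derivative[OF bb K[OF I(2)] K'])
  then have "(binormal \<gamma> has_vector_derivative
      (cross3 (T s) ((1/k) *\<^sub>R L s) + cross3 (K s) ((1/k) *\<^sub>R K s))) (at s)"
    by (rule has_vector_derivative_transform_within_open[OF _ I]) (rule b[symmetric])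
  then have "vector_derivative (binormal \<gamma>) (at s) = (1/k) *\<^sub>R cross3 (T s) (L s)"
    by (simp add: vector_derivative_at cross_mult_right)
  then have "torsion \<gamma> s = - (cross3 (T s) (L s) \<bullet> K s) / k\<^sup>2"
    unfolding torsion_def n[OF I(2)] by (simp add: power2_eq_square)
  moreover have "cross3 (T s) (K s) \<bullet> L s = - (cross3 (T s) (L s) \<bullet> K s)"
    by (simp add: cross3_simps)
  ultimately show ?thesis by simp
qed

text \<open>Constant curvature gives \<open>K \<bullet> L = 0\<close>, so a linear dependence among
  the three vectors can only put \<open>L\<close> along \<open>T\<close>. This trades the torsion
  for a condition that makes sense after embedding into R^4.\<close>

lemma triple_product_zero_iff:
  fixes T K L :: "real^3"
  assumes "T \<bullet> T = 1" "T \<bullet> K = 0" "K \<bullet> L = 0" "K \<noteq> 0"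
  shows "cross3 T K \<bullet> L = 0 \<longleftrightarrow> L = (L \<bullet> T) *\<^sub>R T"
proof
  assume 0: "cross3 T K \<bullet> L = 0"
  define v where "v = L - (L \<bullet> T) *\<^sub>R T"
  have vT: "v \<bullet> T = 0" using assms(1) by (simp add: v_def inner_diff_left)
  have vK: "v \<bullet> K = 0" using assms(2,3) by (simp add: v_def inner_diff_left inner_commute[of L K])
  have vw: "v \<bullet> cross3 T K = 0"
    using 0 by (simp add: v_def inner_diff_left dot_cross_self inner_commute[of L])
  \<comment> \<open>\<open>v\<close> has zero cross product and zero inner product with the nonzero
    vector \<open>cross3 T K\<close>; Lagrange's identity then gives \<open>v = 0\<close>.\<close>
  have "cross3 v (cross3 T K) = (v \<bullet> K) *\<^sub>R T - (v \<bullet> T) *\<^sub>R K"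
    by (simp add: cross3_simps forall_3)
  then have c0: "cross3 v (cross3 T K) = 0" using vT vK by simp
  have "(norm v * norm (cross3 T K))\<^sup>2 = 0"
    using norm_cross_dot[of v "cross3 T K"] unfolding c0 vw by simp
  moreover have "(norm (cross3 T K))\<^sup>2 = (norm K)\<^sup>2"
    using norm_cross_dot[of T K] assms(1,2) by (simp add: norm_eq_1[symmetric])
  ultimately have "v = 0" using assms(4) by auto
  then show "L = (L \<bullet> T) *\<^sub>R T" by (simp add: v_def)
next
  assume "L = (L \<bullet> T) *\<^sub>R T"
  then have "cross3 T K \<bullet> L = cross3 T K \<bullet> ((L \<bullet> T) *\<^sub>R T)" by simp
  also have "\<dots> = 0" by (simp add: dot_cross_self)
  finally show "cross3 T K \<bullet> L = 0" .
qed

section \<open>The cylinder over a space curve\<close>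

lemma vector_4: "vector [a, b, c, d :: real] $ (1::4) = a" "vector [a, b, c, d] $ (2::4) = b"
  "vector [a, b, c, d] $ (3::4) = c" "vector [a, b, c, d] $ (4::4) = d"
  unfolding vector_def by simp_all

definition embed3 :: "real^3 \<Rightarrow> real^4" where
  "embed3 w = vector [w $ 1, w $ 2, w $ 3, 0]"

lemma embed3_component [simp]:
  "embed3 w $ 1 = w $ 1" "embed3 w $ 2 = w $ 2" "embed3 w $ 3 = w $ 3" "embed3 w $ 4 = 0"
  by (simp_all add: embed3_def vector_4)

lemma linear_embed3: "linear embed3"
  by (rule linearI) (simp_all add: vec_eq_iff forall_4)

lemma inner_embed3 [simp]: "embed3 v \<bullet> embed3 w = v \<bullet> w" "embed3 v \<bullet> axis 4 1 = 0" "axis 4 1 \<bullet> embed3 v = 0"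
  by (simp_all add: inner_vec_def sum_4 sum_3 axis_def)

lemma embed3_inj: "embed3 v = embed3 w \<Longrightarrow> v = w"
  by (simp add: vec_eq_iff forall_4 forall_3)

lemma cylinder_map_eq: "cylinder_map \<gamma> a q = embed3 (\<gamma> (q $ 1)) + (q $ 2 + a) *\<^sub>R axis 4 1"
  by (simp add: vec_eq_iff forall_4 cylinder_map_def axis_def vector_4)

lemma second_countable_euclidean: "second_countable (euclidean :: 'a::euclidean_space topology)"
proof -
  obtain \<B> :: "'a set set" where "countable \<B>" "\<And>C. C \<in> \<B> \<Longrightarrow> open C"
    "\<And>S. open S \<Longrightarrow> \<exists>U. U \<subseteq> \<B> \<and> S = \<Union>U"
    using univ_second_countable by blast
  note B = this
  have "\<exists>V\<in>\<B>. x \<in> V \<and> V \<subseteq> U" if "open U" "x \<in> U" for U and x :: 'a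
  proof -
    obtain W where "W \<subseteq> \<B>" "U = \<Union>W" using B(3)[OF \<open>open U\<close>] by blast
    then show ?thesis using \<open>x \<in> U\<close> by blast
  qed
  then show ?thesis
    unfolding second_countable_def using B(1,2) by (intro exI[of _ \<B>]) simp
qed

lemma axis_real2 [simp]: "axis 1 1 $ (1::2) = (1::real)" "axis 1 1 $ (2::2) = (0::real)"
  "axis 2 1 $ (1::2) = (0::real)" "axis 2 1 $ (2::2) = (1::real)"
  by (simp_all add: axis_def)

lemma immersed_single_chart:
  assumes V: "open V" and r: "smooth_on V r" and inj: "\<And>q. q \<in> V \<Longrightarrow> inj (frechet_derivative r (at q))"
  shows "immersed_surface (top_of_set V) {(V, id)} r"
proof -
  have "transition_smooth (V, id) (V, id)"
    unfolding transition_smooth_def prod.case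
  proof (rule smooth_on_cong[where f="\<lambda>x. x"])
    have "{q \<in> V. id q \<in> id ` V} = V" by auto
    then show "smooth_on {q \<in> V. id q \<in> id ` V} (\<lambda>x. x)" "open {q \<in> V. id q \<in> id ` V}"
      using V by (simp_all add: smooth_on_ident)
    show "y = the_inv_into V id (id y)" if "y \<in> {q \<in> V. id q \<in> id ` V}" for y
      using that by (simp add: the_inv_into_f_f[where f=id, simplified])
  qed
  then have "compatible_chart (top_of_set V) {(V, id)} (V, id)"
    using V by (simp add: compatible_chart_def subtopology_subtopology)
  moreover have "second_countable (top_of_set V)"
    by (intro second_countable_subtopology) (simp add: second_countable_euclidean)
  ultimately show ?thesis
    using r inj by (simp add: immersed_surface_def smooth_surface_def Hausdorff_space_subtopology)
qed

lemma has_derivative_first_coordinate: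
  assumes "(f has_vector_derivative f') (at (q $ 1))"
  shows "((\<lambda>q :: real^2. f (q $ 1)) has_derivative (\<lambda>Z. Z $ 1 *\<^sub>R f')) (at q)"
proof -
  have "((\<lambda>q :: real^2. q $ 1) has_derivative (\<lambda>Z. Z $ 1)) (at q)"
    by (rule bounded_linear_imp_has_derivative) (rule bounded_linear_vec_nth)
  then show ?thesis
    using assms unfolding has_vector_derivative_def by (rule has_derivative_compose)
qed

text \<open>The coordinate fields are orthonormal throughout and second derivatives only see
  \<gamma>'', so H = \<gamma>''/2. Constant curvature gives constant |H| and \<gamma>'' orthogonal
  to \<gamma>''', which kills the divergence; nonzero torsion keeps the normal part of \<gamma>'''
  from vanishing.\<close>

theorem cylinder_biconservative:
  fixes \<gamma> :: "real \<Rightarrow> real^3" and a :: real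
  assumes I: "open_interval I" and J: "open_interval J" and adm: "admissible_curve I \<gamma>"
  defines "V \<equiv> rectangle I J" and "X \<equiv> cylinder_map \<gamma> a"
  shows "immersed_surface (top_of_set V) {(V, id)} X" "biconservative {(V, id)} X"
    "nonzero_CMC {(V, id)} X" "\<And>p. p \<in> V \<Longrightarrow> \<not> parallel_H_at {(V, id)} X p" "V \<noteq> {}"
proof -
  have oI: "open I" "open J" using I J by (simp_all add: open_interval_def)
  have oV: "open V" unfolding V_def by (rule open_rectangle[OF oI])
  have V1: "q $ 1 \<in> I" if "q \<in> V" for q using that by (simp add: V_def rectangle_def)
  show "V \<noteq> {}"
  proof -
    obtain i j where "i \<in> I" "j \<in> J" using I J by (auto simp: open_interval_def)
    then have "(vector [i, j] :: real^2) \<in> V" by (simp add: V_def rectangle_def)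
    then show ?thesis by blast
  qed
  have s\<gamma>: "smooth_on I \<gamma>" using adm by (simp add: admissible_curve_def arc_length_curve_def)
  define T where "T = dd \<gamma> 1"
  define K where "K = dd T 1"
  define L where "L = dd K 1"
  have sT: "smooth_on I T" and sK: "smooth_on I K"
    unfolding K_def T_def by (intro smooth_on_dd oI s\<gamma>)+
  have vd: "(f has_vector_derivative dd f 1 s) (at s)" if "smooth_on I f" "s \<in> I" for f :: "real \<Rightarrow> real^3" and s
  proof -
    have "(\<lambda>h. dd f h s) = (\<lambda>h. h *\<^sub>R dd f 1 s)"
    proof
      fix h
      show "dd f h s = h *\<^sub>R dd f 1 s"
        using linear_scale[OF linear_dd[OF that(1) oI(1) that(2)], of h 1]
        by (simp only: real_scaleR_def mult_1_right)
    qed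
    then show ?thesis
      using smooth_on_has_derivative[OF that(1) oI(1) that(2)] by (simp only: has_vector_derivative_def)
  qed
  have d: "(\<gamma> has_vector_derivative T s) (at s)" "(T has_vector_derivative K s) (at s)"
    "(K has_vector_derivative L s) (at s)" if "s \<in> I" for s
    by (rule vd[OF s\<gamma> that, folded T_def] vd[OF sT that, folded K_def] vd[OF sK that, folded L_def])+
  have TT: "T s \<bullet> T s = 1" if "s \<in> I" for s
  proof -
    have "norm (vector_derivative \<gamma> (at s)) = 1"
      using adm that by (simp add: admissible_curve_def arc_length_curve_def)
    then show ?thesis unfolding vector_derivative_at[OF d(1)[OF that]] by (simp add: norm_eq_1)
  qed
  obtain k where k0: "k \<noteq> 0" and curv: "\<forall>s\<in>I. curvature \<gamma> s = k"
    using adm by (auto simp: admissible_curve_def)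
  have Kk: "norm (K s) = k" if "s \<in> I" for s
    using frenet_quantities(3)[OF oI(1) that d(1,2)] curv that by simp
  have k: "k > 0"
  proof -
    obtain i where "i \<in> I" using I by (auto simp: open_interval_def)
    from Kk[OF this] k0 show ?thesis by (metis norm_ge_zero less_eq_real_def)
  qed
  have inner_const: "f s \<bullet> dd f 1 s = 0" if "smooth_on I f" "s \<in> I" "\<And>s. s \<in> I \<Longrightarrow> f s \<bullet> f s = c"
    for f :: "real \<Rightarrow> real^3" and s c
  proof -
    have "dd (\<lambda>s. f s \<bullet> f s) 1 s = dd (\<lambda>s. c) 1 s" by (rule dd_cong[OF oI(1) that(2,3)])
    then show ?thesis unfolding dd_inner_smooth[OF oI(1) that(1) that(1) that(2)] by (simp add: inner_commute)
  qed
  have TK: "T s \<bullet> K s = 0" if "s \<in> I" for s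
    unfolding K_def by (rule inner_const[OF sT that TT])
  have KL: "K s \<bullet> L s = 0" if "s \<in> I" for s
    unfolding L_def by (rule inner_const[OF sK that]) (simp add: dot_square_norm Kk)
  have tors: "L s \<noteq> (L s \<bullet> T s) *\<^sub>R T s" if s: "s \<in> I" for s
  proof -
    have "torsion \<gamma> s \<noteq> 0" using adm s by (simp add: admissible_curve_def)
    then have "cross3 (T s) (K s) \<bullet> L s \<noteq> 0" using torsion_eq[OF oI(1) s d Kk] by auto
    moreover have "K s \<noteq> 0" using Kk[OF s] k0 by auto
    ultimately show ?thesis using triple_product_zero_iff[OF TT[OF s] TK[OF s] KL[OF s]] by blast
  qed
  have sc: "smooth_on V (\<lambda>q. embed3 (f (q $ 1)))" if "smooth_on I f" for f
  proof -
    have "smooth_on V (\<lambda>q. q $ 1)"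
      using smooth_on_bounded_linear[OF oV bounded_linear_vec_nth smooth_on_ident[OF oV], of 1] .
    then have "smooth_on V (\<lambda>q. f (q $ 1))"
      by (rule smooth_on_compose[OF that _ oV oI(1) V1])
    then show ?thesis
      by (rule smooth_on_bounded_linear[OF oV, rotated]) (simp add: linear_linear linear_embed3)
  qed
  have sX: "smooth_on V X"
  proof -
    have "smooth_on V (\<lambda>q :: real^2. q $ 2)"
      using smooth_on_bounded_linear[OF oV bounded_linear_vec_nth smooth_on_ident[OF oV], of 2] .
    then show ?thesis unfolding X_def cylinder_map_eq[abs_def]
      by (intro smooth_on_add smooth_on_scaleR smooth_on_const oV sc s\<gamma>)
  qed
  have de: "((\<lambda>q. embed3 (f (q $ 1))) has_derivative (\<lambda>Z. Z $ 1 *\<^sub>R embed3 f')) (at q)"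
    if "(f has_vector_derivative f') (at (q $ 1))" for f f' and q :: "real^2"
  proof -
    have "((\<lambda>q. embed3 (f (q $ 1))) has_derivative (\<lambda>Z. embed3 (Z $ 1 *\<^sub>R f'))) (at q)"
      by (rule bounded_linear.has_derivative[OF _ has_derivative_first_coordinate[OF that]])
         (simp add: linear_linear linear_embed3)
    then show ?thesis by (simp only: linear_scale[OF linear_embed3])
  qed
  have X1: "dd X Z q = Z $ 1 *\<^sub>R embed3 (T (q $ 1)) + Z $ 2 *\<^sub>R axis 4 1" if q: "q \<in> V" for q Z
  proof (rule dd_eqI)
    have "((\<lambda>q :: real^2. q $ 2) has_derivative (\<lambda>Z. Z $ 2)) (at q)"
      by (rule bounded_linear_imp_has_derivative) (rule bounded_linear_vec_nth)
    then have "((\<lambda>q :: real^2. (q $ 2 + a) *\<^sub>R (axis 4 1 :: real^4)) has_derivative (\<lambda>Z. Z $ 2 *\<^sub>R axis 4 1)) (at q)"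
      by (auto intro!: derivative_eq_intros)
    then show "(X has_derivative (\<lambda>Z. Z $ 1 *\<^sub>R embed3 (T (q $ 1)) + Z $ 2 *\<^sub>R axis 4 1)) (at q)"
      unfolding X_def cylinder_map_eq[abs_def] by (intro has_derivative_add de d(1) V1[OF q])
  qed
  have X2: "dd (dd X Y) Z q = (Z $ 1 * Y $ 1) *\<^sub>R embed3 (K (q $ 1))" if q: "q \<in> V" for q Y Z
  proof -
    have "((\<lambda>q. Y $ 1 *\<^sub>R embed3 (T (q $ 1)) + Y $ 2 *\<^sub>R axis 4 1) has_derivative
        (\<lambda>Z. Y $ 1 *\<^sub>R (Z $ 1 *\<^sub>R embed3 (K (q $ 1))) + 0)) (at q)"
      by (intro has_derivative_add has_derivative_scaleR_right has_derivative_const de d(2) V1[OF q])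
    from dd_eqI[OF this, of Z]
    have "dd (\<lambda>q. Y $ 1 *\<^sub>R embed3 (T (q $ 1)) + Y $ 2 *\<^sub>R axis 4 1) Z q = (Z $ 1 * Y $ 1) *\<^sub>R embed3 (K (q $ 1))"
      by (simp add: mult.commute)
    moreover have "dd (dd X Y) Z q = dd (\<lambda>q. Y $ 1 *\<^sub>R embed3 (T (q $ 1)) + Y $ 2 *\<^sub>R axis 4 1) Z q"
      by (rule dd_cong[OF oV q]) (rule X1)
    ultimately show ?thesis by simp
  qed
  have fr: "frame (frechet_derivative X (at q)) (axis 1 1) (axis 2 1)" if q: "q \<in> V" for q
  proof (rule frameI)
    show "linear (frechet_derivative X (at q))"
      unfolding frechet_derivative_eq_dd(1) by (rule linear_dd[OF sX oV q])
    show "\<exists>a b. Z = a *\<^sub>R axis 1 1 + b *\<^sub>R axis 2 1" for Z :: "real^2" using real2_expand[of Z] by blast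
  qed (simp_all only: dd_fold X1[OF q], simp_all add: inner_add_left inner_add_right TT[OF V1[OF q]] inner_axis_axis)
  have inj: "inj (frechet_derivative X (at q))" if q: "q \<in> V" for q
  proof (rule injI)
    fix v w assume eq: "frechet_derivative X (at q) v = frechet_derivative X (at q) w"
    then show "v = w"
      using frame_expand(1)[OF fr[OF q], of v] frame_expand(1)[OF fr[OF q], of w] by metis
  qed
  interpret P: immersed_patch V X by unfold_locales (use oV sX inj in auto)
  have u: "dd X (axis 1 1) q = embed3 (T (q $ 1))" "dd X (axis 2 1) q = axis 4 1" if "q \<in> V" for q
    using X1[OF that] by simp_all
  have N: "P.N q w = w - (w \<bullet> embed3 (T (q $ 1))) *\<^sub>R embed3 (T (q $ 1)) - (w \<bullet> axis 4 1) *\<^sub>R axis 4 1"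
    if "q \<in> V" for q w
    unfolding P.normal_part_eq[OF fr[OF that]] u[OF that] ..
  have H: "P.H q = (1/2) *\<^sub>R embed3 (K (q $ 1))" if q: "q \<in> V" for q
    unfolding P.H_frame[OF q fr[OF q]] P.second_fundamental_form_eq X2[OF q] N[OF q]
    by (simp add: TK[OF V1[OF q]] inner_commute[of "K (q $ 1)"])
  have nH: "norm (P.H q) = k / 2" if q: "q \<in> V" for q
  proof -
    have "norm (embed3 (K (q $ 1))) = norm (K (q $ 1))" by (simp add: norm_eq_sqrt_inner)
    then show ?thesis unfolding H[OF q] using Kk[OF V1[OF q]] by simp
  qed
  have dH: "dd P.H Z q = (Z $ 1 / 2) *\<^sub>R embed3 (L (q $ 1))" if q: "q \<in> V" for q Z
  proof -
    have "((\<lambda>q. (1/2) *\<^sub>R embed3 (K (q $ 1))) has_derivative (\<lambda>Z. (1/2) *\<^sub>R (Z $ 1 *\<^sub>R embed3 (L (q $ 1))))) (at q)"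
      by (intro has_derivative_scaleR_right de d(3) V1[OF q])
    from dd_eqI[OF this, of Z] show ?thesis
      by (subst dd_cong[OF oV q H]) simp_all
  qed
  have cmc: "\<forall>q\<in>V. norm (P.H q) = k / 2" using nH by blast
  show "immersed_surface (top_of_set V) {(V, id)} X" by (rule immersed_single_chart[OF oV sX inj])
  show "nonzero_CMC {(V, id)} X" unfolding nonzero_CMC_def using cmc k by (auto intro!: exI[of _ "k/2"])
  have "divergence X (stress_bienergy X) q Y = 0" if q: "q \<in> V" for q Y
  proof -
    have "embed3 (K (q $ 1)) \<bullet> P.N q (embed3 (L (q $ 1))) = 0"
      unfolding N[OF q]
      by (simp add: inner_diff_right inner_commute[of "K (q $ 1)" "T (q $ 1)"] TK[OF V1[OF q]] KL[OF V1[OF q]])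
    then show ?thesis
      unfolding P.divergence_stress_bienergy[OF q fr[OF q] cmc] X2[OF q] dH[OF q]
        linear_scale[OF P.linear_normal_part[OF q]]
      by simp
  qed
  then show "biconservative {(V, id)} X" by (simp add: biconservative_def)
  show "\<not> parallel_H_at {(V, id)} X p" if p: "p \<in> V" for p
  proof
    assume "parallel_H_at {(V, id)} X p"
    then have "normal_connection X p (axis 1 1) P.H = 0"
      using p by (simp add: parallel_H_at_def)
    then have "P.N p (dd P.H (axis 1 1) p) = 0" by (simp add: normal_connection_def dd_fold)
    then have "P.N p (embed3 (L (p $ 1))) = 0"
      unfolding dH[OF p] linear_scale[OF P.linear_normal_part[OF p]] by simp
    then have "embed3 (L (p $ 1)) = embed3 ((L (p $ 1) \<bullet> T (p $ 1)) *\<^sub>R T (p $ 1))"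
      unfolding N[OF p] linear_scale[OF linear_embed3] by simp
    from embed3_inj[OF this] tors[OF V1[OF p]] show False by blast
  qed
qed

section \<open>Adapted coordinates\<close>

text \<open>\<open>R\<close> carries the last coordinate axis to \<open>e\<close>, and
  \<open>Q w\<close> consists of the first three coordinates of the preimage of \<open>w\<close>:
  orthogonal projection along \<open>e\<close>, read in R^3.\<close>

lemma orthogonal_splitting:
  fixes e :: "real^4"
  assumes "norm e = 1"
  obtains R Q where "orthogonal_transformation R" "linear Q"
    "\<And>w. R (embed3 (Q w) + (w \<bullet> e) *\<^sub>R axis 4 1) = w"
    "\<And>v w. v \<bullet> w = Q v \<bullet> Q w + (v \<bullet> e) * (w \<bullet> e)"
proof -
  have "norm (axis 4 1 :: real^4) = 1" by (simp add: norm_eq_1 inner_axis_axis)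
  then have "norm (axis 4 1 :: real^4) = norm e" using assms by (rule trans[OF _ sym])
  then obtain R :: "real^4 \<Rightarrow> real^4" where R: "orthogonal_transformation R" "R (axis 4 1) = e"
    by (rule orthogonal_transformation_exists)
  define S where "S = inv R"
  have S: "orthogonal_transformation S" unfolding S_def by (rule orthogonal_transformation_inv[OF R(1)])
  have RS: "R (S w) = w" for w
    unfolding S_def using orthogonal_transformation_surj[OF R(1)] by (simp add: surj_f_inv_f)
  have linS: "linear S" using S by (simp add: orthogonal_transformation_def)
  have SS: "S v \<bullet> S w = v \<bullet> w" for v w using S by (simp add: orthogonal_transformation_def)
  define Q where "Q w = (vector [S w $ 1, S w $ 2, S w $ 3] :: real^3)" for w
  have linQ: "linear Q"
    by (rule linearI) (simp_all add: Q_def vec_eq_iff forall_3 linear_add[OF linS] linear_scale[OF linS])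
  have S4: "S w $ 4 = w \<bullet> e" for w
  proof -
    have "w \<bullet> e = R (S w) \<bullet> R (axis 4 1)" by (simp add: RS R(2))
    also have "\<dots> = S w \<bullet> axis 4 1" using R(1) by (simp add: orthogonal_transformation_def)
    also have "\<dots> = S w $ 4" by (simp add: inner_axis)
    finally show ?thesis by simp
  qed
  have Sw: "S w = embed3 (Q w) + (w \<bullet> e) *\<^sub>R axis 4 1" for w
    by (simp add: vec_eq_iff forall_4 Q_def S4 axis_def)
  have "R (embed3 (Q w) + (w \<bullet> e) *\<^sub>R axis 4 1) = w" for w
    unfolding Sw[symmetric] by (rule RS)
  moreover have "v \<bullet> w = Q v \<bullet> Q w + (v \<bullet> e) * (w \<bullet> e)" for v w
    unfolding SS[of v w, symmetric] Sw[of v] Sw[of w]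
    by (simp add: inner_add_left inner_add_right inner_axis_axis)
  ultimately show ?thesis using R(1) linQ by (intro that)
qed

context immersed_patch
begin

lemma normal_part_tangent:
  assumes "q \<in> V" shows "N q (dd r Z q) = 0"
proof -
  have n: "N q (dd r Z q) \<bullet> dd r X q = 0" for X by (rule normal_part_dd[OF assms])
  have "N q (dd r Z q) \<bullet> N q (dd r Z q) = dd r Z q \<bullet> N q (dd r Z q)"
    by (rule normal_part_inner[OF assms n])
  also have "\<dots> = 0" using n by (simp add: inner_commute[of "dd r Z q"])
  finally show ?thesis by simp
qed

theorem cylinder_coordinates:
  assumes cmc: "\<forall>q\<in>V. norm (H q) = c" and c: "c \<noteq> 0"
    and bicons: "\<And>q Y. q \<in> V \<Longrightarrow> divergence r (stress_bienergy r) q Y = 0"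
    and q0: "q0 \<in> V" and X0: "N q0 (dd H X0 q0) \<noteq> 0"
  obtains I J \<gamma> a R g f where "open_interval I" "open_interval J" "admissible_curve I \<gamma>"
    "orthogonal_transformation R" "smooth_on (rectangle I J) g"
    "g ` rectangle I J \<subseteq> V" "open (g ` rectangle I J)" "q0 \<in> g ` rectangle I J"
    "homeomorphism (rectangle I J) (g ` rectangle I J) g f" "smooth_on (g ` rectangle I J) f"
    "\<And>y. y \<in> rectangle I J \<Longrightarrow> r (g y) = R (cylinder_map \<gamma> a y)"
proof -
  obtain d t e where d: "d > 0" "ball q0 d \<subseteq> V" and st: "smooth_on (ball q0 d) t" and e: "norm e = 1"
    and t: "\<And>q. q \<in> ball q0 d \<Longrightarrow> norm (t q) = 1" "\<And>q. q \<in> ball q0 d \<Longrightarrow> t q \<bullet> e = 0"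
    and He: "\<And>q. q \<in> ball q0 d \<Longrightarrow> H q \<bullet> e = 0" and tH: "\<And>q. q \<in> ball q0 d \<Longrightarrow> t q \<bullet> H q = 0"
    and r_Z: "\<And>q Z. q \<in> ball q0 d \<Longrightarrow> dd r Z q = (t q \<bullet> dd r Z q) *\<^sub>R t q + (e \<bullet> dd r Z q) *\<^sub>R e"
    and t_Z: "\<And>q Z. q \<in> ball q0 d \<Longrightarrow> dd t Z q = (2 * (t q \<bullet> dd r Z q)) *\<^sub>R H q"
    and NH: "\<And>q Z. q \<in> ball q0 d \<Longrightarrow> t q \<bullet> dd r Z q \<noteq> 0 \<Longrightarrow> N q (dd H Z q) \<noteq> 0"
    using local_structure[OF assms] by blast
  define U where "U = ball q0 d"
  note t = t[folded U_def] and He = He[folded U_def] and tH = tH[folded U_def] and r_Z = r_Z[folded U_def]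
    and t_Z = t_Z[folded U_def] and NH = NH[folded U_def] and st = st[folded U_def]
  have openU: "open U" and q0U: "q0 \<in> U" using d by (simp_all add: U_def)
  have UV: "q \<in> V" if "q \<in> U" for q using d(2) that by (auto simp: U_def)
  have sub: "smooth_on U h" if "smooth_on V h" for h :: "real^2 \<Rightarrow> 'z::real_normed_vector"
    by (rule smooth_on_subset[OF that open_V openU]) (use UV in blast)
  note sr1 = sub[OF smooth_dd_r(1)] and sH = sub[OF smooth_H]
  define \<alpha> where "\<alpha> Z q = t q \<bullet> dd r Z q" for Z q
  define \<beta> where "\<beta> Z q = e \<bullet> dd r Z q" for Z q
  have s\<alpha>: "smooth_on U (\<alpha> Z)" and s\<beta>: "smooth_on U (\<beta> Z)" for Z
    unfolding \<alpha>_def[abs_def] \<beta>_def[abs_def] by (intro smooth_on_inner smooth_on_const openU st sr1)+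
  have \<alpha>_lin: "\<alpha> (X + Y) q = \<alpha> X q + \<alpha> Y q" "\<alpha> (b *\<^sub>R X) q = b * \<alpha> X q"
    and \<beta>_lin: "\<beta> (X + Y) q = \<beta> X q + \<beta> Y q" "\<beta> (b *\<^sub>R X) q = b * \<beta> X q"
    if "q \<in> U" for X Y q b
    by (simp_all add: \<alpha>_def \<beta>_def r1_lin[OF UV[OF that]] inner_add_right)
  define e1 e2 where "e1 = (axis 1 1 :: real^2)" "e2 = (axis 2 1 :: real^2)"
  have \<alpha>Z: "\<alpha> Z q = Z $ 1 * \<alpha> e1 q + Z $ 2 * \<alpha> e2 q" and \<beta>Z: "\<beta> Z q = Z $ 1 * \<beta> e1 q + Z $ 2 * \<beta> e2 q"
    if "q \<in> U" for Z q
    using arg_cong[OF real2_expand[of Z], of "\<lambda>Z. \<alpha> Z q"] arg_cong[OF real2_expand[of Z], of "\<lambda>Z. \<beta> Z q"]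
    unfolding \<alpha>_lin[OF that] \<beta>_lin[OF that] e1_e2_def by blast+
  define A where "A q = \<alpha> e1 q *\<^sub>R e1 + \<alpha> e2 q *\<^sub>R e2" for q
  have sA: "smooth_on U A"
    unfolding A_def[abs_def] by (intro smooth_on_add smooth_on_scaleR smooth_on_const openU s\<alpha>)
  have AZ: "A q \<bullet> Z = \<alpha> Z q" if "q \<in> U" for q Z
    unfolding \<alpha>Z[OF that, of Z] by (simp add: A_def e1_e2_def inner_add_left inner_axis' )
  \<comment> \<open>The form \<langle>t, dr\<rangle> is closed: the derivative of \<open>t\<close>
    is a multiple of \<open>H\<close>, hence normal, so only the symmetric second derivatives of
    \<open>r\<close> remain.\<close>
  have A_sym: "dd A v q \<bullet> w = dd A w q \<bullet> v" if q: "q \<in> U" for q v w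
  proof -
    have "dd A v q \<bullet> w = t q \<bullet> dd (dd r w) v q" for v w
    proof -
      have "dd A v q \<bullet> w = dd (\<lambda>q. A q \<bullet> w) v q"
        unfolding dd_inner_smooth[OF openU sA smooth_on_const[OF openU] q] by simp
      also have "\<dots> = dd (\<alpha> w) v q" by (rule dd_cong[OF openU q]) (rule AZ)
      also have "\<dots> = t q \<bullet> dd (dd r w) v q + dd t v q \<bullet> dd r w q"
        unfolding \<alpha>_def[abs_def] by (rule dd_inner_smooth[OF openU st sr1 q])
      also have "dd t v q \<bullet> dd r w q = 0" unfolding t_Z[OF q] by (simp add: H_normal[OF UV[OF q]])
      finally show ?thesis by simp
    qed
    then show ?thesis by (simp only: r2_commute[OF UV[OF q], of v w])
  qed
  obtain u where u: "\<And>q. q \<in> U \<Longrightarrow> (u has_derivative (\<lambda>Z. A q \<bullet> Z)) (at q)"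
    using gradient_potential[OF sA[unfolded U_def] A_sym[unfolded U_def]] unfolding U_def by blast
  define \<Phi> where "\<Phi> q = u q *\<^sub>R e1 + (e \<bullet> r q) *\<^sub>R e2" for q
  have \<Phi>': "(\<Phi> has_derivative (\<lambda>Z. \<alpha> Z q *\<^sub>R e1 + \<beta> Z q *\<^sub>R e2)) (at q)" if q: "q \<in> U" for q
  proof -
    have "(u has_derivative (\<lambda>Z. \<alpha> Z q)) (at q)" using u[OF q] unfolding AZ[OF q] .
    moreover have "((\<lambda>q. e \<bullet> r q) has_derivative (\<lambda>Z. \<beta> Z q)) (at q)"
      unfolding \<beta>_def
      by (intro has_derivative_inner_right smooth_on_has_derivative[OF smooth_r open_V UV[OF q]])
    ultimately show ?thesis
      unfolding \<Phi>_def[abs_def] by (intro has_derivative_add has_derivative_scaleR_left)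
  qed
  have s\<Phi>: "smooth_on U \<Phi>"
    by (rule smooth_on_primitive[OF openU \<Phi>'])
       (assumption, intro smooth_on_add smooth_on_scaleR smooth_on_const openU s\<alpha> s\<beta>)
  note dd\<Phi> = dd_eqI[OF \<Phi>']
  \<comment> \<open>The Jacobian determinant of \<open>\<Phi>\<close>. If it vanished, the vectors
    \<open>Z1\<close> and \<open>Z2\<close> below would be annihilated by both
    \<open>\<alpha>\<close> and \<open>\<beta>\<close>, hence zero.\<close>
  define D where "D q = \<alpha> e1 q * \<beta> e2 q - \<alpha> e2 q * \<beta> e1 q" for q
  have inj0: "X = 0" if "q \<in> U" "\<alpha> X q = 0" "\<beta> X q = 0" for q X
  proof -
    have "dd r X q = 0" using r_Z[OF that(1), of X] that(2,3) by (simp add: \<alpha>_def \<beta>_def)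
    then show ?thesis
      using inj_r[OF UV[OF that(1)]] linear_injective_0[OF linear_L[OF UV[OF that(1)]]]
      by (simp add: dd_def)
  qed
  have D0: "D q \<noteq> 0" if q: "q \<in> U" for q
  proof
    assume D: "D q = 0"
    define Z1 where "Z1 = \<beta> e2 q *\<^sub>R e1 + (- \<beta> e1 q) *\<^sub>R e2"
    define Z2 where "Z2 = \<alpha> e2 q *\<^sub>R e1 + (- \<alpha> e1 q) *\<^sub>R e2"
    have "Z1 = 0" by (rule inj0[OF q]) (use D in \<open>simp_all only: Z1_def \<alpha>_lin[OF q] \<beta>_lin[OF q] D_def\<close>, simp_all add: algebra_simps)
    moreover have "Z2 = 0" by (rule inj0[OF q]) (use D in \<open>simp_all only: Z2_def \<alpha>_lin[OF q] \<beta>_lin[OF q] D_def\<close>, simp_all add: algebra_simps)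
    ultimately have "\<beta> e1 q = 0" "\<alpha> e1 q = 0"
      by (simp_all add: Z1_def Z2_def e1_e2_def vec_eq_iff forall_2)
    then have "e1 = 0" by (intro inj0[OF q])
    then show False by (simp add: e1_e2_def axis_eq_0_iff)
  qed
  \<comment> \<open>Cramer's rule: the coordinate vector that the differential of
    \<open>\<Phi>\<close> at \<open>q\<close> maps to \<open>w\<close>.\<close>
  define B where "B w q = ((w $ 1 * \<beta> e2 q - w $ 2 * \<alpha> e2 q) / D q) *\<^sub>R e1
      + ((\<alpha> e1 q * w $ 2 - \<beta> e1 q * w $ 1) / D q) *\<^sub>R e2" for w :: "real^2" and q
  have sD: "smooth_on U D" unfolding D_def[abs_def] by (intro smooth_on_diff smooth_on_mult openU s\<alpha> s\<beta>)
  have sB: "smooth_on U (B w)" for w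
    unfolding B_def[abs_def]
    by (intro smooth_on_add smooth_on_scaleR smooth_on_divide smooth_on_diff smooth_on_mult smooth_on_const
        openU s\<alpha> s\<beta> sD D0)
  have \<alpha>B: "\<alpha> (B w q) q = w $ 1" and \<beta>B: "\<beta> (B w q) q = w $ 2" if q: "q \<in> U" for w q
  proof -
    have "\<alpha> (B w q) q = ((w $ 1 * \<beta> e2 q - w $ 2 * \<alpha> e2 q) * \<alpha> e1 q + (\<alpha> e1 q * w $ 2 - \<beta> e1 q * w $ 1) * \<alpha> e2 q) / D q"
      unfolding B_def \<alpha>_lin[OF q] by (simp add: add_divide_distrib)
    also have "(w $ 1 * \<beta> e2 q - w $ 2 * \<alpha> e2 q) * \<alpha> e1 q + (\<alpha> e1 q * w $ 2 - \<beta> e1 q * w $ 1) * \<alpha> e2 q = w $ 1 * D q"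
      by (simp add: D_def algebra_simps)
    finally show "\<alpha> (B w q) q = w $ 1" using D0[OF q] by simp
    have "\<beta> (B w q) q = ((w $ 1 * \<beta> e2 q - w $ 2 * \<alpha> e2 q) * \<beta> e1 q + (\<alpha> e1 q * w $ 2 - \<beta> e1 q * w $ 1) * \<beta> e2 q) / D q"
      unfolding B_def \<beta>_lin[OF q] by (simp add: add_divide_distrib)
    also have "(w $ 1 * \<beta> e2 q - w $ 2 * \<alpha> e2 q) * \<beta> e1 q + (\<alpha> e1 q * w $ 2 - \<beta> e1 q * w $ 1) * \<beta> e2 q = w $ 2 * D q"
      by (simp add: D_def algebra_simps)
    finally show "\<beta> (B w q) q = w $ 2" using D0[OF q] by simp
  qed
  have fB: "dd \<Phi> (B w q) q = w" if q: "q \<in> U" for w q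
    unfolding dd\<Phi>[OF q] \<alpha>B[OF q] \<beta>B[OF q] e1_e2_def by (rule real2_expand[symmetric])
  have Bf: "B (dd \<Phi> v q) q = v" if q: "q \<in> U" for v q
  proof -
    let ?b = "B (dd \<Phi> v q) q"
    have "\<alpha> ?b q = \<alpha> v q" "\<beta> ?b q = \<beta> v q"
      unfolding \<alpha>B[OF q] \<beta>B[OF q] dd\<Phi>[OF q] by (simp_all add: e1_e2_def)
    then have "\<alpha> (?b + (-1) *\<^sub>R v) q = 0" "\<beta> (?b + (-1) *\<^sub>R v) q = 0"
      unfolding \<alpha>_lin[OF q] \<beta>_lin[OF q] by simp_all
    then have "?b + (-1) *\<^sub>R v = 0" by (rule inj0[OF q])
    then show ?thesis by simp
  qed
  obtain U' W g where U': "open U'" "U' \<subseteq> U" "q0 \<in> U'" and W: "open W" "\<Phi> q0 \<in> W"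
    and hom: "homeomorphism U' W \<Phi> g" and sg: "smooth_on W g"
    and g': "\<And>y. y \<in> W \<Longrightarrow> (g has_derivative (\<lambda>w. B w (g y))) (at y)"
    using smooth_local_inverse[OF openU q0U s\<Phi> sB fB Bf] by metis
  define p where "p = \<Phi> q0"
  obtain h where h: "h > 0" and rect: "rectangle {p $ 1 - h<..<p $ 1 + h} {p $ 2 - h<..<p $ 2 + h} \<subseteq> W"
    using rectangle_in_open[OF W(1) W(2)] unfolding p_def by blast
  define I where "I = {p $ 1 - h<..<p $ 1 + h}"
  define J where "J = {p $ 2 - h<..<p $ 2 + h}"
  define P where "P = rectangle I J"
  have PW: "P \<subseteq> W" using rect by (simp add: P_def I_def J_def)
  have IJ: "open_interval I" "open_interval J"
    using h by (simp_all add: open_interval_def I_def J_def is_interval_oo)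
  have oI: "open I" "open J" and cJ: "convex J" by (simp_all add: I_def J_def)
  have oP: "open P" unfolding P_def by (rule open_rectangle[OF oI])
  have pP: "p \<in> P" using h by (simp add: P_def rectangle_def I_def J_def)
  have gU': "g y \<in> U'" and \<Phi>g: "\<Phi> (g y) = y" if "y \<in> W" for y
    using hom that unfolding homeomorphism_def by blast+
  have gU: "g y \<in> U" if "y \<in> P" for y using gU' U'(2) PW that by blast
  have g\<Phi>: "g (\<Phi> q) = q" if "q \<in> U'" for q using hom that unfolding homeomorphism_def by blast
  have homP: "homeomorphism P (g ` P) g \<Phi>"
    by (rule homeomorphism_of_subsets[OF homeomorphism_symD[OF hom] PW subset_refl refl])
  have gP: "g ` P = U' \<inter> \<Phi> -` P"
  proof (intro equalityI subsetI)
    fix q assume "q \<in> g ` P"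
    then show "q \<in> U' \<inter> \<Phi> -` P" using gU' \<Phi>g PW by auto
  next
    fix q assume q: "q \<in> U' \<inter> \<Phi> -` P"
    then have "q = g (\<Phi> q)" using g\<Phi> by simp
    then show "q \<in> g ` P" using q by blast
  qed
  have ogP: "open (g ` P)"
    unfolding gP
    by (intro continuous_open_preimage U'(1) oP continuous_on_subset[OF smooth_on_continuous[OF s\<Phi>] U'(2)])
  have gPU: "g ` P \<subseteq> U" using gU by blast
  have sgP: "smooth_on P g" by (rule smooth_on_subset[OF sg W(1) oP PW])
  have s\<Phi>P: "smooth_on (g ` P) \<Phi>" by (rule smooth_on_subset[OF s\<Phi> openU ogP gPU])
  have q0P: "q0 \<in> g ` P" using pP U'(3) unfolding gP p_def by simp
  have comp': "((\<lambda>y. F (g y)) has_derivative (\<lambda>w. dd F (B w (g y)) (g y))) (at y)"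
    if "smooth_on U F" "y \<in> P" for F :: "real^2 \<Rightarrow> real^4" and y
    using g'[of y] that(2) PW smooth_on_has_derivative[OF that(1) openU gU[OF that(2)]]
    by (intro has_derivative_compose[of g "\<lambda>w. B w (g y)" y UNIV F "\<lambda>v. dd F v (g y)"]) auto
  \<comment> \<open>In the new coordinates the partial derivatives of \<open>r\<close> are
    \<open>t\<close> and \<open>e\<close>.\<close>
  have rB: "dd r (B w (g y)) (g y) = w $ 1 *\<^sub>R t (g y) + w $ 2 *\<^sub>R e" if "y \<in> P" for w y
    using r_Z[OF gU[OF that], of "B w (g y)"] \<alpha>B[OF gU[OF that], of w] \<beta>B[OF gU[OF that], of w]
    by (simp only: \<alpha>_def \<beta>_def)
  have tB: "dd t (B w (g y)) (g y) = (2 * w $ 1) *\<^sub>R H (g y)" if "y \<in> P" for w y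
    using t_Z[OF gU[OF that], of "B w (g y)"] \<alpha>B[OF gU[OF that], of w] by (simp only: \<alpha>_def)
  obtain R Q where R: "orthogonal_transformation R" and linQ: "linear Q"
    and RQ: "\<And>w. R (embed3 (Q w) + (w \<bullet> e) *\<^sub>R axis 4 1) = w"
    and QQ: "\<And>v w. v \<bullet> w = Q v \<bullet> Q w + (v \<bullet> e) * (w \<bullet> e)"
    using orthogonal_splitting[OF e] by blast
  have ee: "e \<bullet> e = 1" using e by (simp add: norm_eq_1)
  have Qe: "Q e = 0" using QQ[of e e] ee by simp
  have blQ: "bounded_linear Q" using linQ by (simp add: linear_linear)
  \<comment> \<open>The horizontal line through \<open>p\<close>; its image under the immersion,
    projected by \<open>Q\<close>, becomes the base curve.\<close>
  define l1 where "l1 s = s *\<^sub>R e1 + p $ 2 *\<^sub>R e2" for s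
  have l1P: "l1 s \<in> P" if "s \<in> I" for s
    using that h by (simp add: l1_def e1_e2_def P_def rectangle_def J_def)
  define pt where "pt s = g (l1 s)" for s
  have ptU: "pt s \<in> U" if "s \<in> I" for s unfolding pt_def by (rule gU[OF l1P[OF that]])
  define \<gamma> where "\<gamma> s = Q (r (pt s))" for s
  define T where "T s = Q (t (pt s))" for s
  define K where "K s = Q (2 *\<^sub>R H (pt s))" for s
  define L where "L s = Q (2 *\<^sub>R dd H (B e1 (pt s)) (pt s))" for s
  have curve: "((\<lambda>s. Q (F (pt s))) has_vector_derivative Q (dd F (B e1 (pt s)) (pt s))) (at s)"
    if "smooth_on U F" "s \<in> I" for F s
  proof -
    have "((\<lambda>s. l1 s) has_derivative (\<lambda>h. h *\<^sub>R e1)) (at s)"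
      unfolding l1_def by (auto intro!: derivative_eq_intros)
    then have "((\<lambda>s. F (g (l1 s))) has_derivative (\<lambda>h. dd F (B (h *\<^sub>R e1) (g (l1 s))) (g (l1 s)))) (at s)"
      using comp'[OF that(1) l1P[OF that(2)]] by (rule has_derivative_compose)
    then have "((\<lambda>s. F (g (l1 s))) has_vector_derivative dd F (B e1 (g (l1 s))) (g (l1 s))) (at s)"
      unfolding has_vector_derivative_def
        linear_scale[OF has_derivative_linear[OF comp'[OF that(1) l1P[OF that(2)]]]] .
    then show ?thesis unfolding pt_def by (rule bounded_linear.has_vector_derivative[OF blQ])
  qed
  have sr: "smooth_on U r" by (rule sub[OF smooth_r])
  have e11: "e1 $ 1 = 1" "e1 $ 2 = 0" "e2 $ 1 = 0" "e2 $ 2 = 1" by (simp_all add: e1_e2_def)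
  have \<gamma>': "(\<gamma> has_vector_derivative T s) (at s)" if "s \<in> I" for s
    using curve[OF sr that] rB[OF l1P[OF that], of e1] unfolding \<gamma>_def[abs_def] T_def
    by (simp add: pt_def e11)
  have T': "(T has_vector_derivative K s) (at s)" if "s \<in> I" for s
    using curve[OF st that] tB[OF l1P[OF that], of e1] unfolding K_def T_def[abs_def]
    by (simp add: pt_def e11)
  have K': "(K has_vector_derivative L s) (at s)" if "s \<in> I" for s
  proof -
    have "((\<lambda>s. 2 *\<^sub>R Q (H (pt s))) has_vector_derivative 2 *\<^sub>R Q (dd H (B e1 (pt s)) (pt s))) (at s)"
      by (rule bounded_linear.has_vector_derivative[OF bounded_linear_scaleR_right curve[OF sH that]])
    then show ?thesis unfolding K_def[abs_def] L_def linear_scale[OF linQ] .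
  qed
  \<comment> \<open>\<open>Q\<close> loses only the \<open>e\<close> component, so it preserves
    inner products with \<open>t\<close>, with \<open>H\<close> and with the derivatives of
    \<open>H\<close>, all orthogonal to \<open>e\<close>.\<close>
  have Qin: "Q v \<bullet> Q w = v \<bullet> w" if "w \<bullet> e = 0" for v w using QQ[of v w] that by simp
  have TT: "T s \<bullet> T s = 1" if "s \<in> I" for s
    unfolding T_def Qin[OF t(2)[OF ptU[OF that]]] using t(1)[OF ptU[OF that]] by (simp add: norm_eq_1)
  have cpos: "c > 0" using cmc q0 c by (metis norm_ge_zero less_eq_real_def)
  have KK: "norm (K s) = 2 * c" if "s \<in> I" for s
  proof -
    have "K s \<bullet> K s = (2 *\<^sub>R H (pt s)) \<bullet> (2 *\<^sub>R H (pt s))"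
      unfolding K_def by (rule Qin) (simp add: He[OF ptU[OF that]])
    also have "\<dots> = (2 * c)\<^sup>2"
      using cmc UV[OF ptU[OF that]] by (simp add: dot_square_norm power2_eq_square)
    finally have "(norm (K s))\<^sup>2 = (2 * c)\<^sup>2" by (simp only: dot_square_norm)
    then show ?thesis by (rule power2_eq_imp_eq) (use cpos in simp_all)
  qed
  have TK: "T s \<bullet> K s = 0" if "s \<in> I" for s
    unfolding T_def K_def using tH[OF ptU[OF that]] by (subst Qin) (simp_all add: He[OF ptU[OF that]])
  have dHe: "dd H Z q \<bullet> e = 0" if q: "q \<in> U" for Z q
  proof -
    have "dd (\<lambda>q. H q \<bullet> e) Z q = dd (\<lambda>q. 0) Z q" by (rule dd_cong[OF openU q]) (rule He)
    then show ?thesis unfolding dd_inner_smooth[OF openU sH smooth_on_const[OF openU] q] by simp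
  qed
  have KL: "K s \<bullet> L s = 0" if "s \<in> I" for s
    unfolding K_def L_def using dd_H_H[OF UV[OF ptU[OF that]] cmc]
    by (subst Qin) (simp_all add: dHe[OF ptU[OF that]] inner_commute[of "H (pt s)"])
  \<comment> \<open>If \<open>L\<close> were along \<open>T\<close>, the derivative of
    \<open>H\<close> in the direction that \<open>r\<close> maps to \<open>t\<close> would be
    tangent to the surface, against \<open>NH\<close>.\<close>
  have L_neq: "L s \<noteq> (L s \<bullet> T s) *\<^sub>R T s" if s: "s \<in> I" for s
  proof
    assume L: "L s = (L s \<bullet> T s) *\<^sub>R T s"
    let ?q = "pt s" and ?Z = "B e1 (pt s)"
    define \<kappa> where "\<kappa> = L s \<bullet> T s"
    define w where "w = 2 *\<^sub>R dd H ?Z ?q - \<kappa> *\<^sub>R t ?q"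
    have "Q w = L s - \<kappa> *\<^sub>R T s"
      unfolding w_def L_def T_def by (simp only: linear_diff[OF linQ] linear_scale[OF linQ])
    then have "Q w = 0" using L by (simp add: \<kappa>_def)
    moreover have "w \<bullet> e = 0" by (simp add: w_def inner_diff_left dHe[OF ptU[OF s]] t(2)[OF ptU[OF s]])
    ultimately have "w \<bullet> w = 0" using QQ[of w w] by simp
    then have w: "2 *\<^sub>R dd H ?Z ?q = \<kappa> *\<^sub>R t ?q" by (simp add: w_def)
    have tr: "t ?q = dd r ?Z ?q" using rB[OF l1P[OF s], of e1] by (simp add: pt_def e11)
    have "2 *\<^sub>R N ?q (dd H ?Z ?q) = \<kappa> *\<^sub>R N ?q (dd r ?Z ?q)"
      unfolding linear_scale[OF linear_normal_part[OF UV[OF ptU[OF s]]], symmetric] w tr[symmetric] ..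
    then have "N ?q (dd H ?Z ?q) = 0" unfolding normal_part_tangent[OF UV[OF ptU[OF s]]] by simp
    moreover have "t ?q \<bullet> dd r ?Z ?q \<noteq> 0"
      using \<alpha>B[OF ptU[OF s], of e1] by (simp add: \<alpha>_def e11)
    ultimately show False using NH[OF ptU[OF s]] by blast
  qed
  have "admissible_curve I \<gamma>"
    unfolding admissible_curve_def arc_length_curve_def
  proof (intro conjI ballI exI[of _ "2 * c"])
    have "smooth_on I l1"
      unfolding l1_def[abs_def] by (intro smooth_on_add smooth_on_scaleR smooth_on_const smooth_on_ident oI)
    then have "smooth_on I pt"
      unfolding pt_def[abs_def] by (rule smooth_on_compose[OF sgP _ oI(1) oP l1P])
    then have "smooth_on I (\<lambda>s. r (pt s))"
      by (rule smooth_on_compose[OF sr _ oI(1) openU ptU])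
    then show "smooth_on I \<gamma>" unfolding \<gamma>_def[abs_def] by (rule smooth_on_bounded_linear[OF oI(1) blQ])
    show "2 * c \<noteq> 0" using c by simp
    fix s assume s: "s \<in> I"
    show "norm (vector_derivative \<gamma> (at s)) = 1"
      unfolding vector_derivative_at[OF \<gamma>'[OF s]] using TT[OF s] by (simp add: norm_eq_1)
    show "curvature \<gamma> s = 2 * c"
      using frenet_quantities(3)[OF oI(1) s \<gamma>' T'] KK[OF s] by simp
    have "K s \<noteq> 0" using KK[OF s] c by auto
    then have "cross3 (T s) (K s) \<bullet> L s \<noteq> 0"
      using triple_product_zero_iff[OF TT[OF s] TK[OF s] KL[OF s]] L_neq[OF s] by blast
    moreover have "torsion \<gamma> s = (cross3 (T s) (K s) \<bullet> L s) / (2 * c)\<^sup>2"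
      by (rule torsion_eq[OF oI(1) s \<gamma>' T' K' KK])
    ultimately show "torsion \<gamma> s \<noteq> 0" using c by simp
  qed
  \<comment> \<open>\<open>Q e = 0\<close>, so the projected point is constant along the second
    coordinate, and that coordinate is \<langle>e, r\<rangle> itself. Translations are absorbed by
    \<open>\<gamma>\<close> and by the coordinates, whence \<open>a = 0\<close>.\<close>
  moreover have "r (g y) = R (cylinder_map \<gamma> 0 y)" if y: "y \<in> P" for y
  proof -
    have y1: "y $ 1 \<in> I" "y $ 2 \<in> J" using y by (simp_all add: P_def rectangle_def)
    define l2 where "l2 v = y $ 1 *\<^sub>R e1 + v *\<^sub>R e2" for v
    have l2P: "l2 v \<in> P" if "v \<in> J" for v using that y1 by (simp add: l2_def P_def rectangle_def e11)
    have "((\<lambda>v. Q (r (g (l2 v)))) has_vector_derivative 0) (at v within J)" if v: "v \<in> J" for v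
    proof -
      have "((\<lambda>v. l2 v) has_derivative (\<lambda>h. h *\<^sub>R e2)) (at v)"
        unfolding l2_def by (auto intro!: derivative_eq_intros)
      then have "((\<lambda>v. r (g (l2 v))) has_derivative (\<lambda>h. dd r (B (h *\<^sub>R e2) (g (l2 v))) (g (l2 v)))) (at v)"
        using comp'[OF sr l2P[OF v]] by (rule has_derivative_compose)
      then have "((\<lambda>v. r (g (l2 v))) has_vector_derivative e) (at v)"
        unfolding rB[OF l2P[OF v]] by (simp add: has_vector_derivative_def e11)
      from bounded_linear.has_vector_derivative[OF blQ this] show ?thesis
        unfolding Qe by (rule has_vector_derivative_at_within)
    qed
    from has_vector_derivative_zero_constant[OF cJ this] obtain b
      where b: "\<And>v. v \<in> J \<Longrightarrow> Q (r (g (l2 v))) = b" by blast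
    have "p $ 2 \<in> J" using h by (simp add: J_def)
    have "y = l2 (y $ 2)" unfolding l2_def e1_e2_def by (rule real2_expand)
    then have "Q (r (g y)) = Q (r (g (l2 (p $ 2))))" using b[OF y1(2)] b[OF \<open>p $ 2 \<in> J\<close>] by simp
    also have "l2 (p $ 2) = l1 (y $ 1)" by (simp add: l1_def l2_def)
    finally have 1: "Q (r (g y)) = \<gamma> (y $ 1)" by (simp add: \<gamma>_def pt_def)
    have "e \<bullet> r (g y) = \<Phi> (g y) $ 2" by (simp add: \<Phi>_def e11)
    then have 2: "r (g y) \<bullet> e = y $ 2" using \<Phi>g PW y by (auto simp: inner_commute)
    show ?thesis using RQ[of "r (g y)"] unfolding 1 2 cylinder_map_eq by simp
  qed
  ultimately show ?thesis
    using IJ R sgP gPU UV ogP q0P homP s\<Phi>P unfolding P_def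
    by (intro that[of I J \<gamma> R g \<Phi> 0]) blast+
qed

end

section \<open>From coordinates in a patch to charts of the surface\<close>

lemma reparametrized_chart:
  assumes M: "smooth_surface M \<A>" and V\<psi>: "(V, \<psi>) \<in> \<A>"
    and P: "open P" and O: "open (g ` P)" "g ` P \<subseteq> V" and hom: "homeomorphism P (g ` P) g f"
    and sg: "smooth_on P g" and sf: "smooth_on (g ` P) f"
  shows "compatible_chart M \<A> (P, \<psi> \<circ> g)"
proof -
  have cc: "compatible_chart M \<A> d" if "d \<in> \<A>" for d using M that by (simp add: smooth_surface_def)
  have chart: "open W" "openin M (\<eta> ` W)" "homeomorphic_map (top_of_set W) (subtopology M (\<eta> ` W)) \<eta>"
    if "(W, \<eta>) \<in> \<A>" for W \<eta>
    using cc[OF that] by (simp_all add: compatible_chart_def)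
  have trans: "transition_smooth c d" if "c \<in> \<A>" "d \<in> \<A>" for c d
    using cc[OF that(1)] that(2) by (simp add: compatible_chart_def)
  note \<psi> = chart[OF V\<psi>]
  have inj: "inj_on \<eta> W" if "(W, \<eta>) \<in> \<A>" for W \<eta>
    using homeomorphic_imp_injective_map[OF chart(3)[OF that]] by simp
  \<comment> \<open>Transition domains are preimages of open sets under a continuous
    parametrization, hence open, as the lemmas on \<open>smooth_on\<close> require.\<close>
  have pre: "open {q \<in> W. \<eta> q \<in> S}" if "(W, \<eta>) \<in> \<A>" "openin M S" for W \<eta> S
  proof -
    have "continuous_map (top_of_set W) M \<eta>"
      using continuous_map_into_fulltopology[OF homeomorphic_imp_continuous_map[OF chart(3)[OF that(1)]]] .
    from openin_continuous_map_preimage[OF this that(2)]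
    show ?thesis using chart(1)[OF that(1)] by (simp add: openin_open_eq)
  qed
  let ?\<phi> = "\<psi> \<circ> g"
  have im: "?\<phi> ` P = \<psi> ` (g ` P)" by (simp add: image_comp)
  have "openin (top_of_set V) (g ` P)" using O \<psi>(1) by (simp add: openin_open_eq)
  then have "openin (subtopology M (\<psi> ` V)) (\<psi> ` (g ` P))"
    using homeomorphic_map_openness_eq[OF \<psi>(3)] by blast
  then have open\<phi>: "openin M (?\<phi> ` P)"
    unfolding im using \<psi>(2) by (rule openin_trans_full)
  have "homeomorphic_maps (top_of_set P) (top_of_set (g ` P)) g f"
    using hom unfolding homeomorphic_maps_def homeomorphism_def by auto
  then have hg: "homeomorphic_map (top_of_set P) (top_of_set (g ` P)) g"
    by (rule homeomorphic_maps_imp_map)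
  have sub: "\<psi> ` V \<inter> \<psi> ` (g ` P) = \<psi> ` (g ` P)" "V \<inter> g ` P = g ` P" using O(2) by blast+
  have "topspace M \<inter> \<psi> ` V = \<psi> ` V" using openin_subset[OF \<psi>(2)] by blast
  then have "\<psi> ` (topspace (top_of_set V) \<inter> g ` P) = topspace (subtopology M (\<psi> ` V)) \<inter> \<psi> ` (g ` P)"
    using sub by simp
  from homeomorphic_map_subtopologies[OF \<psi>(3) this]
  have "homeomorphic_map (top_of_set (g ` P)) (subtopology M (\<psi> ` (g ` P))) \<psi>"
    by (simp add: subtopology_subtopology sub)
  from homeomorphic_map_compose[OF hg this]
  have hom\<phi>: "homeomorphic_map (top_of_set P) (subtopology M (?\<phi> ` P)) ?\<phi>" unfolding im .
  then have inj\<phi>: "inj_on ?\<phi> P" using homeomorphic_imp_injective_map by fastforce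
  have fg: "f (g y) = y" if "y \<in> P" for y using hom that unfolding homeomorphism_def by blast
  have gV: "g y \<in> V" if "y \<in> P" for y using O(2) that by blast
  \<comment> \<open>Each transition with the new chart is one of the given atlas, restricted to an
    open set and composed with \<open>g\<close> before it or with \<open>f\<close> after it.\<close>
  have 1: "transition_smooth (P, ?\<phi>) (W, \<eta>)" if W: "(W, \<eta>) \<in> \<A>" for W \<eta>
  proof -
    let ?A = "{q \<in> V. \<psi> q \<in> \<eta> ` W}" and ?S = "{q \<in> P. ?\<phi> q \<in> \<eta> ` W}"
    have "smooth_on ?A (\<lambda>q. the_inv_into W \<eta> (\<psi> q))"
      using trans[OF V\<psi> W] by (simp add: transition_smooth_def)
    moreover have S0: "open ?A" by (rule pre[OF V\<psi> chart(2)[OF W]])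
    moreover have "?S = P \<inter> g -` ?A" using gV by auto
    then have S: "open ?S"
      using continuous_open_preimage[OF smooth_on_continuous[OF sg] P S0] by simp
    moreover have "smooth_on ?S g" by (rule smooth_on_subset[OF sg P S]) blast
    ultimately have "smooth_on ?S (\<lambda>q. the_inv_into W \<eta> (\<psi> (g q)))"
      by (intro smooth_on_compose[of ?A "\<lambda>q. the_inv_into W \<eta> (\<psi> q)" ?S g]) (use gV in auto)
    then show ?thesis by (simp add: transition_smooth_def)
  qed
  have 2: "transition_smooth (W, \<eta>) (P, ?\<phi>)" if W: "(W, \<eta>) \<in> \<A>" for W \<eta>
  proof -
    let ?A = "{q \<in> W. \<eta> q \<in> \<psi> ` V}" and ?S = "{q \<in> W. \<eta> q \<in> ?\<phi> ` P}"
    have s0: "smooth_on ?A (\<lambda>q. the_inv_into V \<psi> (\<eta> q))"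
      using trans[OF W V\<psi>] by (simp add: transition_smooth_def)
    have S0: "open ?A" by (rule pre[OF W \<psi>(2)])
    have S: "open ?S" by (rule pre[OF W open\<phi>])
    have "?S \<subseteq> ?A" using gV by auto
    then have s: "smooth_on ?S (\<lambda>q. the_inv_into V \<psi> (\<eta> q))" by (rule smooth_on_subset[OF s0 S0 S])
    have inv: "the_inv_into V \<psi> (?\<phi> y) = g y" if "y \<in> P" for y
      using the_inv_into_f_f[OF inj[OF V\<psi>] gV[OF that]] by simp
    have "smooth_on ?S (\<lambda>q. f (the_inv_into V \<psi> (\<eta> q)))"
    proof (rule smooth_on_compose[OF sf s S O(1)])
      fix q assume "q \<in> ?S"
      then obtain y where "y \<in> P" "\<eta> q = ?\<phi> y" by auto
      then show "the_inv_into V \<psi> (\<eta> q) \<in> g ` P" using inv by simp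
    qed
    then have "smooth_on ?S (\<lambda>q. the_inv_into P ?\<phi> (\<eta> q))"
    proof (rule smooth_on_cong[OF _ S])
      fix q assume "q \<in> ?S"
      then obtain y where y: "y \<in> P" "\<eta> q = ?\<phi> y" by auto
      show "f (the_inv_into V \<psi> (\<eta> q)) = the_inv_into P ?\<phi> (\<eta> q)"
        unfolding y(2) inv[OF y(1)] the_inv_into_f_f[OF inj\<phi> y(1)] by (rule fg[OF y(1)])
    qed
    then show ?thesis by (simp add: transition_smooth_def)
  qed
  show ?thesis
    unfolding compatible_chart_def using P open\<phi> hom\<phi> 1 2 by auto
qed

lemma biconservative_surface_cylinder:
  assumes im: "immersed_surface M \<A> x" and bi: "biconservative \<A> x" and cmc: "nonzero_CMC \<A> x"
    and np: "\<not> parallel_H_at \<A> x p"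
  shows "\<exists>I J \<gamma> a \<phi> R. open_interval I \<and> open_interval J \<and> admissible_curve I \<gamma> \<and>
     orthogonal_transformation R \<and> compatible_chart M \<A> (rectangle I J, \<phi>) \<and> p \<in> \<phi> ` rectangle I J \<and>
     (\<forall>q\<in>rectangle I J. x (\<phi> q) = R (cylinder_map \<gamma> a q))"
proof -
  obtain V \<psi> q0 X0 where V\<psi>: "(V, \<psi>) \<in> \<A>" and q0: "q0 \<in> V" "\<psi> q0 = p"
    and X0: "normal_connection (x \<circ> \<psi>) q0 X0 (mean_curvature_vector (x \<circ> \<psi>)) \<noteq> 0"
    using np unfolding parallel_H_at_def by auto
  have surf: "smooth_surface M \<A>" using im by (simp add: immersed_surface_def)
  then have "compatible_chart M \<A> (V, \<psi>)" using V\<psi> by (simp add: smooth_surface_def)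
  then have oV: "open V" by (simp add: compatible_chart_def)
  interpret P: immersed_patch V "x \<circ> \<psi>"
    by unfold_locales (use oV im V\<psi> in \<open>auto simp: immersed_surface_def\<close>)
  obtain c where c: "c \<noteq> 0" "\<forall>q\<in>V. norm (P.H q) = c" using cmc V\<psi> by (fastforce simp: nonzero_CMC_def)
  have div: "divergence (x \<circ> \<psi>) (stress_bienergy (x \<circ> \<psi>)) q Y = 0" if "q \<in> V" for q Y
    using bi V\<psi> that by (fastforce simp: biconservative_def)
  have N: "P.N q0 (dd P.H X0 q0) \<noteq> 0" using X0 by (simp add: normal_connection_def dd_fold)
  obtain I J \<gamma> a R g f where "open_interval I" "open_interval J" and rest: "admissible_curve I \<gamma>"
    "orthogonal_transformation R" "smooth_on (rectangle I J) g"
    "g ` rectangle I J \<subseteq> V" "open (g ` rectangle I J)" "q0 \<in> g ` rectangle I J"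
    "homeomorphism (rectangle I J) (g ` rectangle I J) g f" "smooth_on (g ` rectangle I J) f"
    and eq: "\<And>y. y \<in> rectangle I J \<Longrightarrow> (x \<circ> \<psi>) (g y) = R (cylinder_map \<gamma> a y)"
    using P.cylinder_coordinates[OF c(2,1) div q0(1) N] by metis
  moreover have "open (rectangle I J)"
    using \<open>open_interval I\<close> \<open>open_interval J\<close> by (intro open_rectangle) (simp_all add: open_interval_def)
  then have "compatible_chart M \<A> (rectangle I J, \<psi> \<circ> g)"
    by (rule reparametrized_chart[OF surf V\<psi> _ rest(5,4,7,3,8)])
  moreover have "p \<in> (\<psi> \<circ> g) ` rectangle I J" using rest(6) q0(2) by auto
  moreover have "\<forall>y\<in>rectangle I J. x ((\<psi> \<circ> g) y) = R (cylinder_map \<gamma> a y)" using eq by simp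
  ultimately show ?thesis by blast
qed

text \<open>The local form is asserted around points where \<nabla>^\<bottom>H is nonzero: a
  cylinder over a curve of constant curvature whose torsion vanishes at some parameters but not at
  all is non-PMC, yet over those parameters it has no such description. \<open>R\<close> is the
  ambient isometry that puts the rulings along the last axis.\<close>

theorem proposition5p2:
  shows
    "(\<forall>(M :: 'm topology) \<A> x.
        immersed_surface M \<A> x \<and> \<not> PMC M \<A> x \<and> biconservative \<A> x \<and> nonzero_CMC \<A> x \<longrightarrow>
        (\<forall>p\<in>topspace M. \<not> parallel_H_at \<A> x p \<longrightarrow>
          (\<exists>I J \<gamma> a \<phi> R.
             open_interval I \<and> open_interval J \<and> admissible_curve I \<gamma> \<and>
             orthogonal_transformation R \<and>
             compatible_chart M \<A> (rectangle I J, \<phi>) \<and> p \<in> \<phi> ` rectangle I J \<and>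
             (\<forall>q\<in>rectangle I J. x (\<phi> q) = R (cylinder_map \<gamma> a q)))))
   \<and> (\<forall>I J \<gamma> a.
        open_interval I \<and> open_interval J \<and> admissible_curve I \<gamma> \<longrightarrow>
        (let V = rectangle I J; M = top_of_set V; \<A> = {(V, id)}; X = cylinder_map \<gamma> a in
           immersed_surface M \<A> X \<and> \<not> PMC M \<A> X \<and> biconservative \<A> X \<and> nonzero_CMC \<A> X \<and>
           (\<forall>p\<in>topspace M. \<not> parallel_H_at \<A> X p)))"
proof (intro conjI allI impI ballI)
  fix M :: "'m topology" and \<A> x p
  assume "immersed_surface M \<A> x \<and> \<not> PMC M \<A> x \<and> biconservative \<A> x \<and> nonzero_CMC \<A> x"
    and "\<not> parallel_H_at \<A> x p"
  then show "\<exists>I J \<gamma> a \<phi> R.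
             open_interval I \<and> open_interval J \<and> admissible_curve I \<gamma> \<and>
             orthogonal_transformation R \<and>
             compatible_chart M \<A> (rectangle I J, \<phi>) \<and> p \<in> \<phi> ` rectangle I J \<and>
             (\<forall>q\<in>rectangle I J. x (\<phi> q) = R (cylinder_map \<gamma> a q))"
    by (intro biconservative_surface_cylinder) blast+
next
  fix I J \<gamma> and a :: real
  assume "open_interval I \<and> open_interval J \<and> admissible_curve I \<gamma>"
  then have c: "open_interval I" "open_interval J" "admissible_curve I \<gamma>" by blast+
  note cyl = cylinder_biconservative(1-4)[OF c, where a=a] cylinder_biconservative(5)[OF c]
  show "let V = rectangle I J; M = top_of_set V; \<A> = {(V, id)}; X = cylinder_map \<gamma> a in
           immersed_surface M \<A> X \<and> \<not> PMC M \<A> X \<and> biconservative \<A> X \<and> nonzero_CMC \<A> X \<and>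
           (\<forall>p\<in>topspace M. \<not> parallel_H_at \<A> X p)"
    unfolding Let_def PMC_def using cyl by auto
qed

end
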